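(* Let $F\in\mathbb K[\mathbf a,\gamma][x,y]\setminus\mathbb K[\mathbf a,\gamma]$ be irreducible over $\overline{\mathbb F}$ and such that the projective curve $\mathcal C(F^h)$ has only ordinary singularities. Suppose that $\mathcal C(F)$ is a rational curve, and let $\mathbf a^0\in\Omega_{\mathrm{singOrd}(F^h)}$. If $\mathcal C(F,\mathbf a^0)$ is irreducible, then $\mathcal C(F,\mathbf a^0)$ is rational.
   Context: **Specialization.** $\mathbb K$ is a computable field of characteristic zero with algebraic closure $\overline{\mathbb K}$; $\mathbf a=(a_1,\dots,a_n)$ are parameters (indeterminates), $\mathbb L=\mathbb K(\mathbf a)$, $\gamma$ is algebraic over $\mathbb L$, $\mathbb F=\mathbb L(\gamma)$, and $\mathbb S=\overline{\mathbb K}^{\,n}$. $\mathbb V(\cdot)\subset\mathbb S$ is the common zero set of polynomials in $\mathbb K[\mathbf a]$ ($\mathbb V(\emptyset)=\mathbb S$). Let $p(\mathbf a,t)=t^k+\sum_{i<k}\frac{N_i}{D_i}t^i$ ($N_i,D_i\in\mathbb K[\mathbf a]$ coprime) be the minimal polynomial of $\gamma$ over $\mathbb L$, $D=\mathrm{lcm}(D_0,\dots,D_{k-1})$, $\Omega_\gamma=\mathbb S\setminus\mathbb V(D)$. For $\mathbf a^0\in\Omega_\gamma$, $\gamma^0\in\overline{\mathbb K}$ is a root of $p(\mathbf a^0,t)$ (any fixed choice). Each $f\in\mathbb F$ is written canonically as $f=\sum_{i=0}^{k-1}\frac{U_i(\mathbf a)}{W(\mathbf a)}\gamma^i$ with $U_i,W\in\mathbb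 K[\mathbf a]$, $\gcd(U_0,\dots,U_{k-1},W)=1$; its denominator is $W$, its numerator is $\sum U_i\gamma^i$; if $W(\mathbf a^0)\ne0$ the specialization $f(\mathbf a^0)$ is obtained by substituting $(\mathbf a^0,\gamma^0)$ for $(\mathbf a,\gamma)$. Polynomials over $\mathbb F$ are specialized coefficientwise. $\mathrm{Norm}(f)=\prod_i f(\mathbf a,\gamma_i)\in\mathbb L$, over all roots $\gamma_i$ of $p(\mathbf a,t)$ in $\overline{\mathbb L}$. For a polynomial $H$ over $\mathbb F$ with set of nonzero coefficients $C_H$: $\Omega_{\mathrm{def}(H)}=\Omega_\gamma\setminus\mathbb V(\mathrm{lcm}\{\mathrm{denom}(C):C\in C_H\})$ and $\Omega_{\mathrm{nonZ}(H)}=\Omega_{\mathrm{def}(H)}\setminus\mathbb V(\{\mathrm{numer}(\mathrm{Norm}(\mathrm{numer}(C))):C\in C_H\})$. **Gcd and squarefreeness sets.** For nonzero $f_1,f_2\in\mathbb F[u][v]$ let $g=\gcd_{\mathbb F[u][v]}(f_1,f_2)$ (a fixed choice), $f_i=f_i^*g$, $A_i,B\in\mathbb F[u]$ the leading coefficients w.r.t. $v$ of $f_i,g$, and $R=\mathrm{res}_v(f_1^*,f_2^* )$; $\Omega_{\gcd(f_1,f_2)}$ is the intersection of $\Omega_{\mathrm{def}(h)}$ for $h\in\{f_1,f_2,f_1^*,f_2^*,g,R\}$ and $\Omega_{\mathrm{nonZ}(h)}$ for $h\in\{A_1,A_2,B,R\}$ (same definition in $\mathbb F[v]$). For nonzero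 $f_1,\dots,f_r\in\mathbb F[v]$ with gcd $g$ having leading coefficient $A$, put $f_Z=f_2+f_3Z+\dots+f_rZ^{r-2}\in\mathbb F[Z][v]$ and $\Omega_{\gcd(f_1,\dots,f_r)}=\Omega_{\gcd_{\mathbb F[Z][v]}(f_1,f_Z)}\cap\Omega_{\mathrm{def}(g)}\cap\Omega_{\mathrm{nonZ}(A)}$. Zero polynomials in a list are omitted; if one polynomial $f$ remains the set is $\Omega_{\mathrm{nonZ}}$ of its leading coefficient intersected with $\Omega_{\mathrm{def}(f)}$. For squarefree $f\in\mathbb F[v]$ with discriminant $R$ and leading coefficient $A$: $\Omega_{\mathrm{sqfree}(f)}=\Omega_{\mathrm{def}(f)}\cap\Omega_{\mathrm{nonZ}(R)}\cap\Omega_{\mathrm{nonZ}(A)}$. **Curves.** For a nonconstant polynomial $G\in\mathbb F[x,y]$ irreducible over $\overline{\mathbb F}$, of total degree $d$, $G^h$ is its homogenization, $\mathcal C(G)$, $\mathcal C(G^h)$ the affine/projective plane curves over $\overline{\mathbb F}$; if $g_d$ is the degree-$d$ form of $G$, $\Omega_G=\Omega_{\mathrm{def}(G)}\cap\Omega_{\mathrm{nonZ}(g_d)}$. $\mathcal C(G,\mathbf a^0)$ is the curve over $\overline{\mathbb K}$ defined by $G(\mathbf a^0,\gamma^0,x,y)$ (irreducible means this polynomial is irreducible over $\overline{\mathbb K}$). A curve is rational if it admits a rational parametrization over the algebraically closed base field (equivalently it is irreducible of geometric genus zero). A point is $r$-fold if all partial derivatives of order $<r$ vanish there and some of order $r$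 does not; it is singular if $r\ge2$, and ordinary if its $r$ tangents are distinct. **Families.** An irreducible $\mathbb F$-family is $\mathcal F=\{(f_1:f_2:f_3)\}_m:=\{(f_1(\alpha):f_2(\alpha):f_3(\alpha)):m(\alpha)=0\}\subset\mathbb P^2(\overline{\mathbb F})$, with $m\in\mathbb F[t]$ irreducible of positive degree and $f_i\in\mathbb F[t]$ reduced modulo $m$, not all zero. **Standard decomposition** $\mathscr D(G^h)$ of the singular locus. $\mathcal C(G)$ is in regular position w.r.t. $x$ if the coefficient of $y^{\deg G}$ is a nonzero constant and $G(a,b_i)=G_x(a,b_i)=0$ ($i=1,2$) implies $b_1=b_2$. Apply an affine linear change of coordinates over $\mathbb K$ to reach regular position (if needed). Singularities at infinity: factor $G^h(x,y,0)=\prod g_i^{e_i}$ over $\mathbb F$, and take the families $\{(1:t:0)\}_{g_i(1,t)}$ at which all first partials of $G^h$ vanish modulo $g_i(1,t)$. Affine singularities: let $\{A(x),y-B(x)\}$ ($A$ squarefree, $\deg B<\deg A$) be the normed reduced lexicographic ($x<y$) Gröbner basis of $\sqrt{\langle G,G_x,G_y\rangle}$; each irreducible factor $m$ of $A$ gives $\{(t:B(t):1)\}_m$. Undo the linear change. The result consists of irreducible families of the forms $\{(f_1:f_2:1)\}_m$ and $\{(L_1:L_2:0)\}_m$ ($L_i\in\mathbb K[t]$, $\deg L_i\le1$, $\gcd(L_1,L_2)=1$). **Open sets of a family** $\mathcal F=\{(f_1:f_2:f_3)\}_m\in\mathscr D(G^h)$ of ordinary $r$-fold points. (i) $\Omega_{\mathrm{def}(\mathcal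 F)}=\Omega_{\gcd(f_1,f_2,m)}\cap\Omega_{\mathrm{sqfree}(m)}\cap\Omega_{\mathrm{nonZ}(A)}\cap\Omega_G$, where $A$ is the product of the leading coefficients in $t$ of $m$ and of the nonzero ones among $f_1,f_2$ if $f_3=1$, and $A$ is the leading coefficient of $m$ if $f_3=0$. (ii) Let $H^*$ be an order-$r$ partial derivative of $G^h$ with $H^*(f_1,f_2,f_3)\not\equiv0$ mod $m$, $H$ the remainder of $H^*(f_1,f_2,f_3)$ by $m$, $R=\mathrm{res}_t(H,m)$; $\Omega_{\mathrm{mult}(\mathcal F)}=\Omega_{\mathrm{def}(\mathcal F)}\cap\Omega_{\mathrm{nonZ}(H)}\cap\Omega_{\mathrm{nonZ}(R)}$. (iii) Let $T(\mathbf a,t,x,y,z)$ be the defining tangent polynomial: for $f_3=1$, the reduction modulo $m$ of $\sum_{i=0}^r\binom ri\frac{\partial^rG}{\partial x^i\partial y^{r-i}}(f_1,f_2)(x-f_1z)^i(y-f_2z)^{r-i}$; for $f_3=0$, similarly, the reduction modulo $m$ of $\sum_{i+j+k=r}\frac{r!}{i!j!k!}\frac{\partial^rG^h}{\partial x^i\partial y^j\partial z^k}(f_1,f_2,0)x^iy^jz^k$. After a linear change of coordinates over $\mathbb K$ if necessary, assume no tangent is independent of $x$ and distinct tangents $T_1,T_2$ satisfy $T_1(x,1,1)\ne T_2(x,1,1)$. Let $D(\mathbf a,t)$ be the reduction modulo $m$ of the discriminant w.r.t. $x$ of $T(\mathbf a,t,x,1,1)$, $N=\mathrm{res}_t(D,m)$,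 $A(\mathbf a,t)$ the leading coefficient of $T(\mathbf a,t,x,1,1)$ w.r.t. $x$, $R=\mathrm{res}_t(A,m)$, $S=\mathrm{res}_t(T(\mathbf a,t,x,0,0),m)$; $\Omega_{\mathrm{ord}(\mathcal F)}=\Omega_{\mathrm{mult}(\mathcal F)}\cap\Omega_{\mathrm{nonZ}(R)}\cap\Omega_{\mathrm{nonZ}(N)}\cap\Omega_{\mathrm{nonZ}(S)}$. **The set in the claim** (with $G=F$): $\Omega_{\mathrm{singOrd}(F^h)}=\bigcap_{\mathcal F\in\mathscr D(F^h)}\Omega_{\mathrm{ord}(\mathcal F)}$ if $\mathcal C(F^h)$ is singular, and $\Omega_{\mathrm{singOrd}(F^h)}=\Omega_F$ otherwise. *)

theory Defs
  imports
    "HOL-Library.Poly_Mapping"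
    "HOL-Computational_Algebra.Fraction_Field"
    "HOL-Computational_Algebra.Squarefree"
    "HOL-Algebra.Algebraic_Closure_Type"
    "Subresultants.Resultant_Prelim"
begin

hide_const (open) UnivPoly.coeff UnivPoly.monom up_ring.coeff up_ring.monom

section \<open>Parameters, the field of definition, and specialization\<close>

text \<open>
  The parameters are indexed by a finite type \<open>'n\<close>. The three type synonyms are
  $K[\mathbf a]$, $L = K(\mathbf a)$ and $\overline L$. The last one is also
  $\overline F$ for $F = L(\gamma)$, so \<open>F\<close> and the polynomial rings
  over it are treated as subsets of \<open>acl\<close> and of types of polynomials over it.
\<close>

type_synonym ('n, 'k) par = "('n \<Rightarrow>\<^sub>0 nat) \<Rightarrow>\<^sub>0 'k"
type_synonym ('n, 'k) parfrac = "('n, 'k) par fract"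
type_synonym ('n, 'k) acl = "('n, 'k) parfrac alg_closure"

definition par_eval ::
    "('n::finite \<Rightarrow> 'k alg_closure) \<Rightarrow> ('n, 'k::field) par \<Rightarrow> 'k alg_closure" where
  "par_eval a P =
     (\<Sum>\<mu>\<in>Poly_Mapping.keys P. to_ac (Poly_Mapping.lookup P \<mu>) *
       (\<Prod>i\<in>UNIV. a i ^ Poly_Mapping.lookup \<mu> i))"

definition zero_locus ::
    "('n::finite, 'k::field) par set \<Rightarrow> ('n \<Rightarrow> 'k alg_closure) set" where
  "zero_locus A = {a. \<forall>P\<in>A. par_eval a P = 0}"

definition is_lcm :: "'a::comm_ring_1 set \<Rightarrow> 'a \<Rightarrow> bool" where
  "is_lcm A D \<longleftrightarrow> (\<forall>P\<in>A. P dvd D) \<and> (\<forall>E. (\<forall>P\<in>A. P dvd E) \<longrightarrow> D dvd E)"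

definition trivial_gcd :: "'a::comm_ring_1 set \<Rightarrow> bool" where
  "trivial_gcd A \<longleftrightarrow> (\<forall>c. (\<forall>P\<in>A. c dvd P) \<longrightarrow> c dvd 1)"

definition lowest_terms ::
    "('n::{finite,linorder}, 'k::field) parfrac \<Rightarrow> ('n, 'k) par \<times> ('n, 'k) par" where
  "lowest_terms q = (SOME (N, D). D \<noteq> 0 \<and> q = Fract N D \<and> trivial_gcd {N, D})"

definition frac_num :: "('n::{finite,linorder}, 'k::field) parfrac \<Rightarrow> ('n, 'k) par" where
  "frac_num q = fst (lowest_terms q)"

definition frac_den :: "('n::{finite,linorder}, 'k::field) parfrac \<Rightarrow> ('n, 'k) par" where
  "frac_den q = snd (lowest_terms q)"

definition of_par :: "('n::{finite,linorder}, 'k::field) par \<Rightarrow> ('n, 'k) acl" where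
  "of_par P = to_ac (Fract P 1)"

definition of_base :: "'k::field \<Rightarrow> ('n::{finite,linorder}, 'k) acl" where
  "of_base c = of_par (Poly_Mapping.single 0 c)"

definition min_poly ::
    "('n::{finite,linorder}, 'k::field) acl \<Rightarrow> ('n, 'k) parfrac poly" where
  "min_poly \<gamma> = (THE p. lead_coeff p = 1 \<and> poly (map_poly to_ac p) \<gamma> = 0 \<and>
     (\<forall>q. q \<noteq> 0 \<and> poly (map_poly to_ac q) \<gamma> = 0 \<longrightarrow> degree p \<le> degree q))"

definition ext_field ::
    "('n::{finite,linorder}, 'k::field) acl \<Rightarrow> ('n, 'k) acl set" where
  "ext_field \<gamma> = {poly (map_poly to_ac P) \<gamma> / poly (map_poly to_ac Q) \<gamma> | P Q.
     poly (map_poly to_ac Q) \<gamma> \<noteq> 0}"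

definition par_ring ::
    "('n::{finite,linorder}, 'k::field) acl \<Rightarrow> ('n, 'k) acl set" where
  "par_ring \<gamma> = range (\<lambda>U. poly (map_poly of_par U) \<gamma>)"

text \<open>
  The least common multiple is unique up to a nonzero constant, so that the zero locus
  of the set of all least common multiples is the zero locus of any one of them.
\<close>

definition Omega_gen ::
    "('n::{finite,linorder}, 'k::field) acl \<Rightarrow> ('n \<Rightarrow> 'k alg_closure) set" where
  "Omega_gen \<gamma> = UNIV - zero_locus
     {D. is_lcm ((\<lambda>i. frac_den (coeff (min_poly \<gamma>) i)) ` {..<degree (min_poly \<gamma>)}) D}"

definition min_poly_at ::
    "('n::{finite,linorder}, 'k::field) acl \<Rightarrow> ('n \<Rightarrow> 'k alg_closure) \<Rightarrow> 'k alg_closure poly"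
  where
  "min_poly_at \<gamma> a =
     map_poly (\<lambda>q. par_eval a (frac_num q) / par_eval a (frac_den q)) (min_poly \<gamma>)"

text \<open>
  In \<open>canonical \<gamma> f U W\<close> the coefficients of \<open>U\<close> are $U_0, \dots, U_{k-1}$.
  The pair \<open>(U, W)\<close> is unique up to a common nonzero constant factor.
\<close>

definition canonical ::
    "('n::{finite,linorder}, 'k::field) acl \<Rightarrow> ('n, 'k) acl \<Rightarrow>
     ('n, 'k) par poly \<Rightarrow> ('n, 'k) par \<Rightarrow> bool" where
  "canonical \<gamma> f U W \<longleftrightarrow>
     W \<noteq> 0 \<and> degree U < degree (min_poly \<gamma>) \<and>
     f = poly (map_poly of_par U) \<gamma> / of_par W \<and>
     trivial_gcd (insert W (set (coeffs U)))"

definition canon_num ::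
    "('n::{finite,linorder}, 'k::field) acl \<Rightarrow> ('n, 'k) acl \<Rightarrow> ('n, 'k) par poly" where
  "canon_num \<gamma> f = fst (SOME (U, W). canonical \<gamma> f U W)"

definition denom ::
    "('n::{finite,linorder}, 'k::field) acl \<Rightarrow> ('n, 'k) acl \<Rightarrow> ('n, 'k) par" where
  "denom \<gamma> f = snd (SOME (U, W). canonical \<gamma> f U W)"

definition numer ::
    "('n::{finite,linorder}, 'k::field) acl \<Rightarrow> ('n, 'k) acl \<Rightarrow> ('n, 'k) acl" where
  "numer \<gamma> f = poly (map_poly of_par (canon_num \<gamma> f)) \<gamma>"

definition Norm ::
    "('n::{finite,linorder}, 'k::field) acl \<Rightarrow> ('n, 'k) acl \<Rightarrow> ('n, 'k) acl" where
  "Norm \<gamma> f = (\<Prod>\<gamma>'\<in>{\<gamma>'. poly (map_poly to_ac (min_poly \<gamma>)) \<gamma>' = 0}.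
     poly (map_poly of_par (canon_num \<gamma> f)) \<gamma>' / of_par (denom \<gamma> f))"

definition special ::
    "('n::{finite,linorder}, 'k::field) acl \<Rightarrow> ('n \<Rightarrow> 'k alg_closure) \<Rightarrow> 'k alg_closure \<Rightarrow>
     ('n, 'k) acl \<Rightarrow> 'k alg_closure" where
  "special \<gamma> a \<gamma>0 f =
     poly (map_poly (par_eval a) (canon_num \<gamma> f)) \<gamma>0 / par_eval a (denom \<gamma> f)"

text \<open>
  The sets below take the set of nonzero coefficients of a polynomial as argument;
  \<open>cset0\<close>, \<open>cset1\<close>, \<open>cset2\<close> are this set for a constant, a univariate and a bivariate
  polynomial. The norm lies in $L$, so its numerator is the constant coefficient of its
  canonical numerator.
\<close>

definition cset0 :: "'a::zero \<Rightarrow> 'a set" where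
  "cset0 c = {c} - {0}"

definition cset1 :: "'a::zero poly \<Rightarrow> 'a set" where
  "cset1 p = set (coeffs p) - {0}"

definition cset2 :: "'a::zero poly poly \<Rightarrow> 'a set" where
  "cset2 p = (\<Union>c\<in>set (coeffs p). cset1 c)"

definition Omega_def ::
    "('n::{finite,linorder}, 'k::field) acl \<Rightarrow> ('n, 'k) acl set \<Rightarrow>
     ('n \<Rightarrow> 'k alg_closure) set" where
  "Omega_def \<gamma> C = Omega_gen \<gamma> - zero_locus {D. is_lcm (denom \<gamma> ` C) D}"

definition Omega_nonZ ::
    "('n::{finite,linorder}, 'k::field) acl \<Rightarrow> ('n, 'k) acl set \<Rightarrow>
     ('n \<Rightarrow> 'k alg_closure) set" where
  "Omega_nonZ \<gamma> C = Omega_def \<gamma> C -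
     zero_locus ((\<lambda>c. coeff (canon_num \<gamma> (Norm \<gamma> (numer \<gamma> c))) 0) ` C)"


section \<open>Divisibility and gcds over a subring\<close>

definition polys1 :: "'a::zero set \<Rightarrow> 'a poly set" where
  "polys1 R = {p. set (coeffs p) \<subseteq> R}"

definition polys2 :: "'a::zero set \<Rightarrow> 'a poly poly set" where
  "polys2 R = polys1 (polys1 R)"

definition dvd_in :: "'a::comm_ring_1 set \<Rightarrow> 'a \<Rightarrow> 'a \<Rightarrow> bool" where
  "dvd_in R p q \<longleftrightarrow> (\<exists>c\<in>R. q = p * c)"

definition is_gcd_in :: "'a::comm_ring_1 set \<Rightarrow> 'a set \<Rightarrow> 'a \<Rightarrow> bool" where
  "is_gcd_in R A g \<longleftrightarrow> g \<in> R \<and> (\<forall>f\<in>A. dvd_in R g f) \<and>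
     (\<forall>h\<in>R. (\<forall>f\<in>A. dvd_in R h f) \<longrightarrow> dvd_in R h g)"

definition irreducible_in :: "'a::comm_ring_1 set \<Rightarrow> 'a \<Rightarrow> bool" where
  "irreducible_in R p \<longleftrightarrow> p \<in> R \<and> p \<noteq> 0 \<and> \<not> dvd_in R p 1 \<and>
     (\<forall>a\<in>R. \<forall>b\<in>R. p = a * b \<longrightarrow> dvd_in R a 1 \<or> dvd_in R b 1)"

text \<open>\<open>P\<close> contains exactly one representative of each class of associated irreducible factors.\<close>

definition is_factorization_in ::
    "'a::comm_ring_1 set \<Rightarrow> 'a \<Rightarrow> 'a \<Rightarrow> 'a set \<Rightarrow> ('a \<Rightarrow> nat) \<Rightarrow> bool" where
  "is_factorization_in R f c P e \<longleftrightarrow>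
     finite P \<and> (\<forall>g\<in>P. irreducible_in R g \<and> 0 < e g) \<and>
     (\<forall>g\<in>P. \<forall>h\<in>P. g \<noteq> h \<longrightarrow> \<not> dvd_in R g h) \<and>
     c \<in> R \<and> dvd_in R c 1 \<and> f = c * (\<Prod>g\<in>P. g ^ e g)"


section \<open>Open sets for gcds and squarefreeness\<close>

text \<open>
  A polynomial in $F[u][v]$ has outer variable $v$ and inner variable $u$.
  Sets depending on choices (of gcds, of coordinates, \dots) are given as relations
  \<open>is_Omega_\<dots>\<close> which hold for the sets that result from some admissible choice.
\<close>

definition Omega_gcd2 ::
    "('n::{finite,linorder}, 'k::field) acl \<Rightarrow> ('n, 'k) acl poly poly \<Rightarrow>
     ('n, 'k) acl poly poly \<Rightarrow> ('n, 'k) acl poly poly \<Rightarrow> ('n \<Rightarrow> 'k alg_closure) set" where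
  "Omega_gcd2 \<gamma> f1 f2 g =
     (let h1 = f1 div g; h2 = f2 div g; R = resultant h1 h2 in
       (\<Inter>h\<in>{f1, f2, h1, h2, g}. Omega_def \<gamma> (cset2 h)) \<inter> Omega_def \<gamma> (cset1 R) \<inter>
       (\<Inter>h\<in>{lead_coeff f1, lead_coeff f2, lead_coeff g, R}. Omega_nonZ \<gamma> (cset1 h)))"

definition swap_vars :: "'a::comm_ring_1 poly poly \<Rightarrow> 'a poly poly" where
  "swap_vars p = (\<Sum>i\<le>degree p. map_poly (\<lambda>c. monom c i) (coeff p i))"

text \<open>
  After removal of zero polynomials, \<open>hs\<close> is the list $f_1, \dots, f_r$ and
  \<open>swap_vars (Poly (tl hs))\<close> is $f_Z = f_2 + f_3 Z + \dots + f_r Z^{r-2}$ in $F[Z][v]$.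
\<close>

definition is_Omega_gcd ::
    "('n::{finite,linorder}, 'k::field) acl \<Rightarrow> ('n, 'k) acl poly list \<Rightarrow>
     ('n \<Rightarrow> 'k alg_closure) set \<Rightarrow> bool" where
  "is_Omega_gcd \<gamma> fs \<Omega> \<longleftrightarrow>
     (let hs = filter (\<lambda>f. f \<noteq> 0) fs in
       if length hs = 1
       then \<Omega> = Omega_nonZ \<gamma> (cset0 (lead_coeff (hd hs))) \<inter> Omega_def \<gamma> (cset1 (hd hs))
       else (\<exists>gZ g.
         let f1 = map_poly (\<lambda>c. [:c:]) (hd hs); fZ = swap_vars (Poly (tl hs)) in
           is_gcd_in (polys2 (ext_field \<gamma>)) {f1, fZ} gZ \<and>
           is_gcd_in (polys1 (ext_field \<gamma>)) (set hs) g \<and>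
           \<Omega> = Omega_gcd2 \<gamma> f1 fZ gZ \<inter> Omega_def \<gamma> (cset1 g) \<inter>
             Omega_nonZ \<gamma> (cset0 (lead_coeff g))))"

text \<open>The division is exact.\<close>

definition discriminant :: "'a::idom_divide poly \<Rightarrow> 'a" where
  "discriminant f =
     (-1) ^ (degree f * (degree f - 1) div 2) * (resultant f (pderiv f) div lead_coeff f)"

definition Omega_sqfree ::
    "('n::{finite,linorder}, 'k::field) acl \<Rightarrow> ('n, 'k) acl poly \<Rightarrow>
     ('n \<Rightarrow> 'k alg_closure) set" where
  "Omega_sqfree \<gamma> f = Omega_def \<gamma> (cset1 f) \<inter>
     Omega_nonZ \<gamma> (cset0 (discriminant f)) \<inter> Omega_nonZ \<gamma> (cset0 (lead_coeff f))"


section \<open>Plane curves\<close>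

text \<open>
  A polynomial in $x, y$ has outer variable $y$ and inner variable $x$; a polynomial in
  $x, y, z$ has outer variable $z$, then $y$, then innermost $x$. The argument \<open>h\<close> of the
  evaluation functions maps the coefficients into the ring of the values.
\<close>

definition eval2 ::
    "('a::zero \<Rightarrow> 'b::comm_ring_1) \<Rightarrow> 'a poly poly \<Rightarrow> 'b \<Rightarrow> 'b \<Rightarrow> 'b" where
  "eval2 h G x y = poly (poly (map_poly (map_poly h) G) [:y:]) x"

definition eval3 ::
    "('a::zero \<Rightarrow> 'b::comm_ring_1) \<Rightarrow> 'a poly poly poly \<Rightarrow> 'b \<Rightarrow> 'b \<Rightarrow> 'b \<Rightarrow> 'b" where
  "eval3 h H x y z =
     poly (poly (poly (map_poly (map_poly (map_poly h)) H) [:[:z:]:]) [:y:]) x"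

definition partial2 :: "nat \<Rightarrow> nat \<Rightarrow> 'a::idom poly poly \<Rightarrow> 'a poly poly" where
  "partial2 i j G = ((map_poly pderiv ^^ i) ((pderiv ^^ j) G))"

definition partial3 :: "nat \<Rightarrow> nat \<Rightarrow> nat \<Rightarrow> 'a::idom poly poly poly \<Rightarrow> 'a poly poly poly" where
  "partial3 i j k H =
     ((map_poly (map_poly pderiv) ^^ i) ((map_poly pderiv ^^ j) ((pderiv ^^ k) H)))"

definition total_degree :: "'a::zero poly poly \<Rightarrow> nat" where
  "total_degree G = Max {i + j | i j. coeff (coeff G j) i \<noteq> 0}"

definition top_form :: "'a::comm_ring_1 poly poly \<Rightarrow> 'a poly poly" where
  "top_form G = (let d = total_degree G in
     \<Sum>i\<le>d. monom (monom (coeff (coeff G (d - i)) i) i) (d - i))"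

definition homogenize :: "'a::comm_ring_1 poly poly \<Rightarrow> 'a poly poly poly" where
  "homogenize G = (let d = total_degree G in
     \<Sum>i\<le>d. \<Sum>j\<le>d - i. monom (monom (monom (coeff (coeff G j) i) i) j) (d - i - j))"

definition lin_form :: "'a::comm_ring_1 \<Rightarrow> 'a \<Rightarrow> 'a \<Rightarrow> 'a poly poly poly" where
  "lin_form \<alpha> \<beta> \<delta> = [:[:[:0, \<alpha>:], [:\<beta>:]:], [:[:\<delta>:]:]:]"

definition const3 :: "'a::zero \<Rightarrow> 'a poly poly poly" where
  "const3 c = [:[:[:c:]:]:]"

text \<open>
  The form $\sum_{i+j+k=r} \frac{r!}{i!j!k!} c_{ijk} x^i y^j z^k$; with $c_{ijk}$ the partial
  derivatives of order $r$ at an $r$-fold point, it is the product of the tangents there.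
\<close>

definition taylor_form ::
    "nat \<Rightarrow> (nat \<Rightarrow> nat \<Rightarrow> nat \<Rightarrow> 'a::comm_ring_1) \<Rightarrow> 'a poly poly poly" where
  "taylor_form r c = (\<Sum>i\<le>r. \<Sum>j\<le>r - i.
     let k = r - i - j in
       monom (monom (monom (of_nat (fact r div (fact i * fact j * fact k)) * c i j k) i) j) k)"

definition fold_point ::
    "'a::field poly poly poly \<Rightarrow> 'a \<Rightarrow> 'a \<Rightarrow> 'a \<Rightarrow> nat \<Rightarrow> bool" where
  "fold_point H x y z r \<longleftrightarrow>
     (\<forall>i j k. i + j + k < r \<longrightarrow> eval3 id (partial3 i j k H) x y z = 0) \<and>
     (\<exists>i j k. i + j + k = r \<and> eval3 id (partial3 i j k H) x y z \<noteq> 0)"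

definition singular_curve :: "'a::field poly poly poly \<Rightarrow> bool" where
  "singular_curve H \<longleftrightarrow>
     (\<exists>x y z r. (x, y, z) \<noteq> (0, 0, 0) \<and> 2 \<le> r \<and> fold_point H x y z r)"

text \<open>
  Two linear forms define the same tangent iff they are proportional, that is, iff one
  divides the other (both being nonzero).
\<close>

definition ordinary_point :: "'a::field poly poly poly \<Rightarrow> 'a \<Rightarrow> 'a \<Rightarrow> 'a \<Rightarrow> nat \<Rightarrow> bool" where
  "ordinary_point H x y z r \<longleftrightarrow>
     (\<exists>l. taylor_form r (\<lambda>i j k. eval3 id (partial3 i j k H) x y z) = (\<Prod>s<r. l s) \<and>
        (\<forall>s<r. \<exists>\<alpha> \<beta> \<delta>. l s = lin_form \<alpha> \<beta> \<delta>) \<and>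
        (\<forall>s<r. \<forall>s'<r. s \<noteq> s' \<longrightarrow> \<not> l s dvd l s'))"

definition only_ordinary_singularities :: "'a::field poly poly poly \<Rightarrow> bool" where
  "only_ordinary_singularities H \<longleftrightarrow>
     (\<forall>x y z r. (x, y, z) \<noteq> (0, 0, 0) \<and> 2 \<le> r \<and> fold_point H x y z r \<longrightarrow>
        ordinary_point H x y z r)"

text \<open>
  The pair $(p_1/q_1, p_2/q_2)$ of rational functions is a rational parametrization: almost all
  parameter values give a point of the curve, and almost all points of the curve are obtained.
\<close>

definition rational_parametrization ::
    "'a::field poly poly \<Rightarrow> 'a poly \<Rightarrow> 'a poly \<Rightarrow> 'a poly \<Rightarrow> 'a poly \<Rightarrow> bool" where
  "rational_parametrization f p1 q1 p2 q2 \<longleftrightarrow>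
     q1 \<noteq> 0 \<and> q2 \<noteq> 0 \<and> coprime p1 q1 \<and> coprime p2 q2 \<and>
     finite {t. poly q1 t \<noteq> 0 \<and> poly q2 t \<noteq> 0 \<and>
       eval2 id f (poly p1 t / poly q1 t) (poly p2 t / poly q2 t) \<noteq> 0} \<and>
     finite {(x, y). eval2 id f x y = 0 \<and>
       \<not> (\<exists>t. poly q1 t \<noteq> 0 \<and> poly q2 t \<noteq> 0 \<and>
             x = poly p1 t / poly q1 t \<and> y = poly p2 t / poly q2 t)}"

definition rational_curve :: "'a::field poly poly \<Rightarrow> bool" where
  "rational_curve f \<longleftrightarrow> (\<exists>p1 q1 p2 q2. rational_parametrization f p1 q1 p2 q2)"

definition Omega_curve ::
    "('n::{finite,linorder}, 'k::field) acl \<Rightarrow> ('n, 'k) acl poly poly \<Rightarrow>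
     ('n \<Rightarrow> 'k alg_closure) set" where
  "Omega_curve \<gamma> G = Omega_def \<gamma> (cset2 G) \<inter> Omega_nonZ \<gamma> (cset2 (top_form G))"


section \<open>Standard decomposition of the singular locus\<close>

text \<open>The tuple \<open>(f1, f2, f3, m)\<close> stands for the family $\{(f_1:f_2:f_3)\}_m$.\<close>

type_synonym 'a family = "'a poly \<times> 'a poly \<times> 'a poly \<times> 'a poly"

definition regular_position :: "'a::field poly poly \<Rightarrow> bool" where
  "regular_position G \<longleftrightarrow>
     (\<exists>c. c \<noteq> 0 \<and> coeff G (total_degree G) = [:c:]) \<and>
     (\<forall>a b1 b2. (\<forall>b\<in>{b1, b2}. eval2 id G a b = 0 \<and> eval2 id (partial2 1 0 G) a b = 0)
        \<longrightarrow> b1 = b2)"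

text \<open>
  The polynomial of the curve in the new coordinates, where the old coordinates are
  expressed by the new ones as $M (x,y)^T + (b_1,b_2)^T$.
\<close>

definition affine_change ::
    "'k::field mat \<Rightarrow> 'k \<Rightarrow> 'k \<Rightarrow> ('n::{finite,linorder}, 'k) acl poly poly \<Rightarrow>
     ('n, 'k) acl poly poly" where
  "affine_change M b1 b2 G = eval2 (\<lambda>c. [:[:c:]:]) G
     [:[:of_base b1, of_base (M $$ (0, 0)):], [:of_base (M $$ (0, 1)):]:]
     [:[:of_base b2, of_base (M $$ (1, 0)):], [:of_base (M $$ (1, 1)):]:]"

fun undo_change ::
    "'k::field mat \<Rightarrow> 'k \<Rightarrow> 'k \<Rightarrow> ('n::{finite,linorder}, 'k) acl family \<Rightarrow>
     ('n, 'k) acl family" where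
  "undo_change M b1 b2 (f1, f2, f3, m) =
     (let g1 = smult (of_base (M $$ (0, 0))) f1 + smult (of_base (M $$ (0, 1))) f2
               + smult (of_base b1) f3;
          g2 = smult (of_base (M $$ (1, 0))) f1 + smult (of_base (M $$ (1, 1))) f2
               + smult (of_base b2) f3
      in if f3 = 0 then (g1, g2, f3, m) else (g1 mod m, g2 mod m, f3, m))"

definition is_infinity_part ::
    "('n::{finite,linorder}, 'k::field) acl \<Rightarrow> ('n, 'k) acl poly poly \<Rightarrow>
     ('n, 'k) acl family set \<Rightarrow> bool" where
  "is_infinity_part \<gamma> G \<D> \<longleftrightarrow>
     (\<exists>c P e. is_factorization_in (polys2 (ext_field \<gamma>)) (top_form G) c P e \<and>
        \<D> = {(1, [:0, 1:], 0, m) | m. m \<in> (\<lambda>g. map_poly (\<lambda>q. poly q 1) g) ` P \<and>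
               (\<forall>i j k. i + j + k = 1 \<longrightarrow>
                  m dvd eval3 (\<lambda>c. [:c:]) (partial3 i j k (homogenize G)) 1 [:0, 1:] 0)})"

definition radical_ideal :: "'a::comm_ring_1 set \<Rightarrow> 'a set \<Rightarrow> 'a set" where
  "radical_ideal R A = {p \<in> R. \<exists>N u. u ` A \<subseteq> R \<and> p ^ N = (\<Sum>f\<in>A. u f * f)}"

text \<open>
  Lexicographic order with $x < y$. The monomial $x^i y^j$ is represented by \<open>(j, i)\<close>.
\<close>

definition lex_lead :: "'a::zero poly poly \<Rightarrow> nat \<times> nat" where
  "lex_lead p = (degree p, degree (lead_coeff p))"

definition mono_dvd :: "nat \<times> nat \<Rightarrow> nat \<times> nat \<Rightarrow> bool" where
  "mono_dvd \<mu> \<nu> \<longleftrightarrow> fst \<mu> \<le> fst \<nu> \<and> snd \<mu> \<le> snd \<nu>"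

definition is_normed_reduced_GB :: "'a::field poly poly set \<Rightarrow> 'a poly poly set \<Rightarrow> bool" where
  "is_normed_reduced_GB I B \<longleftrightarrow>
     finite B \<and> B \<subseteq> I - {0} \<and>
     (\<forall>p\<in>I - {0}. \<exists>b\<in>B. mono_dvd (lex_lead b) (lex_lead p)) \<and>
     (\<forall>b\<in>B. lead_coeff (lead_coeff b) = 1) \<and>
     (\<forall>b\<in>B. \<forall>b'\<in>B - {b}. \<forall>i j. coeff (coeff b j) i \<noteq> 0 \<longrightarrow> \<not> mono_dvd (lex_lead b') (j, i))"

text \<open>
  The Groebner basis is \<open>{1}\<close> if there are no affine singularities. The variable $x$ of the
  polynomials $A(x)$, $B(x)$ becomes the parameter $t$ of the family.
\<close>

definition is_affine_part ::
    "('n::{finite,linorder}, 'k::field) acl \<Rightarrow> ('n, 'k) acl poly poly \<Rightarrow>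
     ('n, 'k) acl family set \<Rightarrow> bool" where
  "is_affine_part \<gamma> G \<D> \<longleftrightarrow>
     (let I = radical_ideal (polys2 (ext_field \<gamma>)) {G, partial2 1 0 G, partial2 0 1 G} in
       is_normed_reduced_GB I {1} \<and> \<D> = {} \<or>
       (\<exists>A B c P e.
          is_normed_reduced_GB I {[:A:], [:- B, 1:]} \<and> squarefree A \<and> degree B < degree A \<and>
          is_factorization_in (polys1 (ext_field \<gamma>)) A c P e \<and>
          \<D> = (\<lambda>m. ([:0, 1:], B, 1, m)) ` P))"

definition is_standard_decomposition ::
    "('n::{finite,linorder}, 'k::field) acl \<Rightarrow> ('n, 'k) acl poly poly \<Rightarrow>
     ('n, 'k) acl family set \<Rightarrow> bool" where
  "is_standard_decomposition \<gamma> G \<D> \<longleftrightarrow>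
     (\<exists>M b1 b2 \<D>1 \<D>2.
        M \<in> carrier_mat 2 2 \<and> det M \<noteq> 0 \<and>
        (regular_position G \<longrightarrow> M = 1\<^sub>m 2 \<and> b1 = 0 \<and> b2 = 0) \<and>
        regular_position (affine_change M b1 b2 G) \<and>
        is_infinity_part \<gamma> (affine_change M b1 b2 G) \<D>1 \<and>
        is_affine_part \<gamma> (affine_change M b1 b2 G) \<D>2 \<and>
        \<D> = undo_change M b1 b2 ` (\<D>1 \<union> \<D>2))"


section \<open>Open sets of a family\<close>

fun is_Omega_def_family ::
    "('n::{finite,linorder}, 'k::field) acl \<Rightarrow> ('n, 'k) acl poly poly \<Rightarrow>
     ('n, 'k) acl family \<Rightarrow> ('n \<Rightarrow> 'k alg_closure) set \<Rightarrow> bool" where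
  "is_Omega_def_family \<gamma> G (f1, f2, f3, m) \<Omega> \<longleftrightarrow>
     (\<exists>\<Omega>0. is_Omega_gcd \<gamma> [f1, f2, m] \<Omega>0 \<and>
        (let A = (if f3 = 0 then lead_coeff m
                  else lead_coeff m * (\<Prod>f\<leftarrow>filter (\<lambda>f. f \<noteq> 0) [f1, f2]. lead_coeff f)) in
          \<Omega> = \<Omega>0 \<inter> Omega_sqfree \<gamma> m \<inter> Omega_nonZ \<gamma> (cset0 A) \<inter> Omega_curve \<gamma> G))"

fun partial_at_family ::
    "'a::field poly poly \<Rightarrow> 'a family \<Rightarrow> nat \<Rightarrow> nat \<Rightarrow> nat \<Rightarrow> 'a poly" where
  "partial_at_family G (f1, f2, f3, m) i j k =
     eval3 (\<lambda>c. [:c:]) (partial3 i j k (homogenize G)) f1 f2 f3"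

fun family_modulus :: "'a::zero family \<Rightarrow> 'a poly" where
  "family_modulus (f1, f2, f3, m) = m"

definition fold_family :: "'a::field poly poly \<Rightarrow> 'a family \<Rightarrow> nat \<Rightarrow> bool" where
  "fold_family G \<F> r \<longleftrightarrow>
     (\<forall>i j k. i + j + k < r \<longrightarrow> family_modulus \<F> dvd partial_at_family G \<F> i j k) \<and>
     (\<exists>i j k. i + j + k = r \<and> \<not> family_modulus \<F> dvd partial_at_family G \<F> i j k)"

definition is_Omega_mult ::
    "('n::{finite,linorder}, 'k::field) acl \<Rightarrow> ('n, 'k) acl poly poly \<Rightarrow>
     ('n, 'k) acl family \<Rightarrow> nat \<Rightarrow> ('n \<Rightarrow> 'k alg_closure) set \<Rightarrow> bool" where
  "is_Omega_mult \<gamma> G \<F> r \<Omega> \<longleftrightarrow>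
     (\<exists>i j k \<Omega>0.
        i + j + k = r \<and> \<not> family_modulus \<F> dvd partial_at_family G \<F> i j k \<and>
        is_Omega_def_family \<gamma> G \<F> \<Omega>0 \<and>
        (let H = partial_at_family G \<F> i j k mod family_modulus \<F> in
          \<Omega> = \<Omega>0 \<inter> Omega_nonZ \<gamma> (cset1 H) \<inter>
            Omega_nonZ \<gamma> (cset0 (resultant H (family_modulus \<F>)))))"

text \<open>A polynomial in $x, y, z$ over $F[t]$.\<close>

fun tangent_poly ::
    "'a::field poly poly \<Rightarrow> 'a family \<Rightarrow> nat \<Rightarrow> 'a poly poly poly poly" where
  "tangent_poly G (f1, f2, f3, m) r =
     map_poly (map_poly (map_poly (\<lambda>c. c mod m)))
       (if f3 = 0
        then taylor_form r (\<lambda>i j k.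
               eval3 (\<lambda>c. [:c:]) (partial3 i j k (homogenize G)) f1 f2 0)
        else (\<Sum>i\<le>r. const3 (of_nat (r choose i) *
                 eval2 (\<lambda>c. [:c:]) (partial2 i (r - i) G) f1 f2) *
               lin_form 1 0 (- f1) ^ i * lin_form 0 1 (- f2) ^ (r - i)))"

text \<open>
  At each root \<open>\<tau>\<close> of $m$: no tangent is independent of $x$, and distinct tangents stay
  distinct, that is non-proportional, after $y = z = 1$.
\<close>

definition tangents_in_position :: "'a::field poly poly poly poly \<Rightarrow> 'a poly \<Rightarrow> bool" where
  "tangents_in_position T m \<longleftrightarrow>
     (\<forall>\<tau>. poly m \<tau> = 0 \<longrightarrow>
       (let T0 = map_poly (map_poly (map_poly (\<lambda>c. poly c \<tau>))) T in
         (\<forall>\<alpha> \<beta> \<delta>. lin_form \<alpha> \<beta> \<delta> dvd T0 \<longrightarrow> \<alpha> \<noteq> 0) \<and>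
         (\<forall>\<alpha> \<beta> \<delta> \<alpha>' \<beta>' \<delta>'.
            lin_form \<alpha> \<beta> \<delta> dvd T0 \<and> lin_form \<alpha>' \<beta>' \<delta>' dvd T0 \<and>
            \<not> lin_form \<alpha> \<beta> \<delta> dvd lin_form \<alpha>' \<beta>' \<delta>' \<longrightarrow>
            \<not> [:\<beta> + \<delta>, \<alpha>:] dvd [:\<beta>' + \<delta>', \<alpha>':])))"

definition linear_change ::
    "'k::field mat \<Rightarrow> ('n::{finite,linorder}, 'k) acl poly poly poly poly \<Rightarrow>
     ('n, 'k) acl poly poly poly poly" where
  "linear_change M T =
     (let l = (\<lambda>i. lin_form [:of_base (M $$ (i, 0)):] [:of_base (M $$ (i, 1)):]
                 [:of_base (M $$ (i, 2)):])
      in eval3 const3 T (l 0) (l 1) (l 2))"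

definition is_Omega_ord ::
    "('n::{finite,linorder}, 'k::field) acl \<Rightarrow> ('n, 'k) acl poly poly \<Rightarrow>
     ('n, 'k) acl family \<Rightarrow> ('n \<Rightarrow> 'k alg_closure) set \<Rightarrow> bool" where
  "is_Omega_ord \<gamma> G \<F> \<Omega> \<longleftrightarrow>
     (\<exists>r \<Omega>0 M.
        fold_family G \<F> r \<and> is_Omega_mult \<gamma> G \<F> r \<Omega>0 \<and>
        M \<in> carrier_mat 3 3 \<and> det M \<noteq> 0 \<and>
        (tangents_in_position (tangent_poly G \<F> r) (family_modulus \<F>) \<longrightarrow> M = 1\<^sub>m 3) \<and>
        tangents_in_position (linear_change M (tangent_poly G \<F> r)) (family_modulus \<F>) \<and>
        (let m = family_modulus \<F>;
             T = linear_change M (tangent_poly G \<F> r);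
             T11 = poly (poly T 1) 1;
             T00 = poly (poly T 0) 0;
             D = discriminant T11 mod m;
             N = resultant D m;
             R = resultant (lead_coeff T11) m;
             S = resultant (swap_vars T00) (map_poly (\<lambda>c. [:c:]) m)
         in \<Omega> = \<Omega>0 \<inter> Omega_nonZ \<gamma> (cset0 R) \<inter> Omega_nonZ \<gamma> (cset0 N) \<inter>
              Omega_nonZ \<gamma> (cset1 S)))"

definition is_Omega_singOrd ::
    "('n::{finite,linorder}, 'k::field) acl \<Rightarrow> ('n, 'k) acl poly poly \<Rightarrow>
     ('n \<Rightarrow> 'k alg_closure) set \<Rightarrow> bool" where
  "is_Omega_singOrd \<gamma> G \<Omega> \<longleftrightarrow>
     (if singular_curve (homogenize G)
      then (\<exists>\<D> \<omega>. is_standard_decomposition \<gamma> G \<D> \<and>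
              (\<forall>\<F>\<in>\<D>. is_Omega_ord \<gamma> G \<F> (\<omega> \<F>)) \<and> \<Omega> = (\<Inter>\<F>\<in>\<D>. \<omega> \<F>))
      else \<Omega> = Omega_curve \<gamma> G)"

definition special_curve ::
    "('n::{finite,linorder}, 'k::field) acl \<Rightarrow> ('n \<Rightarrow> 'k alg_closure) \<Rightarrow> 'k alg_closure \<Rightarrow>
     ('n, 'k) acl poly poly \<Rightarrow> 'k alg_closure poly poly" where
  "special_curve \<gamma> a \<gamma>0 G = map_poly (map_poly (special \<gamma> a \<gamma>0)) G"

end

theory Submission
  imports Defs
begin

text \<open>
  Degenerations of rational curves are rational: this makes the genus formula unnecessary.
  Substituting $(\mathbf a^0, \gamma^0)$ for $(\mathbf a, \gamma)$ is a ring homomorphism on a local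
  subring of $\overline{F}$, and it extends to a place of $\overline{F}$ with values in
  $\overline{K}$ (Chevalley). A parametrization of the curve is moved by a substitution
  $t \mapsto s + c t$ such that its reduction at the place is not constant. The
  reduction then satisfies the specialized equation, and a nonconstant parametrization of an
  irreducible curve reaches all of its points but at most one. All that is needed of
  $\mathbf a^0$ is that the coefficients of $F$ are defined and that the form of highest degree does not
  vanish. This is part of the conditions of every family of the standard decomposition, and
  the decomposition of a singular curve contains at least one family.
\<close>

section \<open>Places\<close>

text \<open>The coefficientwise reduction of a parametrization may be constant or lie at infinity,
  and the substitution in \<open>t\<close> is adapted to one rational function only. Hence the
  coordinates used are \<open>x - c y\<close>, which is kept nonconstant, and \<open>y\<close>. The
  number \<open>c\<close> is chosen such that the specialized form of highest degree does not vanish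
  at \<open>(c, 1)\<close>, that is, such that \<open>(c : 1 : 0)\<close> is not on the specialized
  curve. This serves twice: every line \<open>x - c y = z\<close> meets the original curve, so
  \<open>x - c y\<close> is not constant along it; and a reduction with infinite \<open>y\<close>
  would land on the excluded point.

  A second obstacle is that the open sets express nonvanishing through norms and not through
  specialized values. The place itself relates the two: all conjugates of \<open>\<gamma>\<close>
  are integral there, because the minimal polynomial is monic over the local ring of the
  point.\<close>

locale place =
  fixes R :: "'e::field set" and res :: "'e \<Rightarrow> 'k::field"
  assumes one_mem [simp]: "1 \<in> R"
    and diff_mem: "x \<in> R \<Longrightarrow> y \<in> R \<Longrightarrow> x - y \<in> R"
    and mult_mem: "x \<in> R \<Longrightarrow> y \<in> R \<Longrightarrow> x * y \<in> R"
    and res_one [simp]: "res 1 = 1"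
    and res_diff: "x \<in> R \<Longrightarrow> y \<in> R \<Longrightarrow> res (x - y) = res x - res y"
    and res_mult: "x \<in> R \<Longrightarrow> y \<in> R \<Longrightarrow> res (x * y) = res x * res y"
    and mem_or_inverse_mem: "x \<in> R \<or> inverse x \<in> R"
    and inverse_mem: "x \<in> R \<Longrightarrow> res x \<noteq> 0 \<Longrightarrow> inverse x \<in> R"

text \<open>Partial ring homomorphisms are encoded by their graphs, so that extension is inclusion
  of sets and Zorn's lemma applies directly. Closure under differences together with the last clause
  makes the graph single-valued.\<close>

definition ring_graph :: "('e::comm_ring_1 \<times> 'k::comm_ring_1) set \<Rightarrow> bool" where
  "ring_graph \<Phi> \<longleftrightarrow> (1, 1) \<in> \<Phi> \<and>
     (\<forall>x a y b. (x, a) \<in> \<Phi> \<longrightarrow> (y, b) \<in> \<Phi> \<longrightarrow>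
        (x - y, a - b) \<in> \<Phi> \<and> (x * y, a * b) \<in> \<Phi>) \<and>
     (\<forall>a. (0, a) \<in> \<Phi> \<longrightarrow> a = 0)"

context
  fixes \<Phi> :: "('e::comm_ring_1 \<times> 'k::comm_ring_1) set"
  assumes \<Phi>: "ring_graph \<Phi>"
begin

lemma ring_graph_one: "(1, 1) \<in> \<Phi>"
  and ring_graph_diff: "(x, a) \<in> \<Phi> \<Longrightarrow> (y, b) \<in> \<Phi> \<Longrightarrow> (x - y, a - b) \<in> \<Phi>"
  and ring_graph_mult: "(x, a) \<in> \<Phi> \<Longrightarrow> (y, b) \<in> \<Phi> \<Longrightarrow> (x * y, a * b) \<in> \<Phi>"
  and ring_graph_zeroD: "(0, a) \<in> \<Phi> \<Longrightarrow> a = 0"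
  using \<Phi> by (auto simp: ring_graph_def)

lemma ring_graph_zero: "(0, 0) \<in> \<Phi>"
  using ring_graph_diff[OF ring_graph_one ring_graph_one] by simp

lemma ring_graph_uminus: "(x, a) \<in> \<Phi> \<Longrightarrow> (- x, - a) \<in> \<Phi>"
  using ring_graph_diff[OF ring_graph_zero] by simp

lemma ring_graph_add: "(x, a) \<in> \<Phi> \<Longrightarrow> (y, b) \<in> \<Phi> \<Longrightarrow> (x + y, a + b) \<in> \<Phi>"
  using ring_graph_diff[OF _ ring_graph_uminus, of x a y b] by simp

lemma ring_graph_unique: "(x, a) \<in> \<Phi> \<Longrightarrow> (x, b) \<in> \<Phi> \<Longrightarrow> a = b"
  using ring_graph_diff[of x a x b] ring_graph_zeroD[of "a - b"] by simp

lemma ring_graph_power: "(x, a) \<in> \<Phi> \<Longrightarrow> (x ^ n, a ^ n) \<in> \<Phi>"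
  by (induction n) (auto intro: ring_graph_one ring_graph_mult)

lemma ring_graph_sum: "(\<And>i. i \<in> A \<Longrightarrow> (f i, g i) \<in> \<Phi>) \<Longrightarrow> (sum f A, sum g A) \<in> \<Phi>"
  by (induction A rule: infinite_finite_induct) (auto intro: ring_graph_zero ring_graph_add)

end

lemma in_set_coeffs: "coeff p i \<noteq> 0 \<Longrightarrow> coeff p i \<in> set (coeffs p)"
  by (metis coeff_0 coeff_in_coeffs le_degree)

text \<open>The partial homomorphism on coefficients, again as a relation. All indices are compared,
  also those beyond both degrees, where the pair is \<open>(0, 0)\<close>.\<close>

definition poly_graph ::
    "('e::comm_ring_1 \<times> 'k::comm_ring_1) set \<Rightarrow> 'e poly \<Rightarrow> 'k poly \<Rightarrow> bool" where
  "poly_graph \<Phi> f g \<longleftrightarrow> (\<forall>i. (coeff f i, coeff g i) \<in> \<Phi>)"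

context
  fixes \<Phi> :: "('e::comm_ring_1 \<times> 'k::comm_ring_1) set"
  assumes \<Phi>: "ring_graph \<Phi>"
begin

lemma poly_graph_diff:
  "poly_graph \<Phi> f g \<Longrightarrow> poly_graph \<Phi> f' g' \<Longrightarrow> poly_graph \<Phi> (f - f') (g - g')"
  by (simp add: poly_graph_def ring_graph_diff[OF \<Phi>])

lemma poly_graph_mult:
  "poly_graph \<Phi> f g \<Longrightarrow> poly_graph \<Phi> f' g' \<Longrightarrow> poly_graph \<Phi> (f * f') (g * g')"
  by (auto simp: poly_graph_def coeff_mult intro!: ring_graph_sum[OF \<Phi>] ring_graph_mult[OF \<Phi>])

lemma poly_graph_monom: "(x, a) \<in> \<Phi> \<Longrightarrow> poly_graph \<Phi> (monom x n) (monom a n)"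
  by (auto simp: poly_graph_def ring_graph_zero[OF \<Phi>])

lemma poly_graph_pCons:
  "(x, a) \<in> \<Phi> \<Longrightarrow> poly_graph \<Phi> f g \<Longrightarrow> poly_graph \<Phi> (pCons x f) (pCons a g)"
  by (auto simp: poly_graph_def coeff_pCons split: nat.splits)

lemma poly_graph_0: "poly_graph \<Phi> 0 0"
  by (auto simp: poly_graph_def ring_graph_zero[OF \<Phi>])

text \<open>Adjoins \<open>x\<close> with prescribed value \<open>\<xi>\<close>. The assumption is
  what makes the value of \<open>poly f x\<close> independent of the polynomial \<open>f\<close>
  that represents it.\<close>

lemma ring_graph_extend:
  assumes "\<And>f g. poly_graph \<Phi> f g \<Longrightarrow> poly f x = 0 \<Longrightarrow> poly g \<xi> = 0"
  defines "\<Psi> \<equiv> {(poly f x, poly g \<xi>) | f g. poly_graph \<Phi> f g}"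
  shows "ring_graph \<Psi>" "\<Phi> \<subseteq> \<Psi>" "(x, \<xi>) \<in> \<Psi>"
proof -
  have in_\<Psi>: "(poly f x, poly g \<xi>) \<in> \<Psi>" if "poly_graph \<Phi> f g" for f g
    using that by (auto simp: \<Psi>_def)
  show "\<Phi> \<subseteq> \<Psi>"
  proof
    fix z assume "z \<in> \<Phi>"
    thus "z \<in> \<Psi>"
      using in_\<Psi>[OF poly_graph_pCons[OF _ poly_graph_0], of "fst z" "snd z"] by simp
  qed
  show "(x, \<xi>) \<in> \<Psi>"
    using in_\<Psi>[OF poly_graph_monom[OF ring_graph_one[OF \<Phi>]], of 1] by (simp add: poly_monom)
  show "ring_graph \<Psi>"
    unfolding ring_graph_def
  proof (intro conjI allI impI)
    show "(1, 1) \<in> \<Psi>" using \<open>\<Phi> \<subseteq> \<Psi>\<close> ring_graph_one[OF \<Phi>] by blast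
  next
    fix u a v b assume "(u, a) \<in> \<Psi>" "(v, b) \<in> \<Psi>"
    then obtain f g f' g' where *: "poly_graph \<Phi> f g" "poly_graph \<Phi> f' g'"
      "u = poly f x" "a = poly g \<xi>" "v = poly f' x" "b = poly g' \<xi>"
      by (auto simp: \<Psi>_def)
    show "(u - v, a - b) \<in> \<Psi>" "(u * v, a * b) \<in> \<Psi>"
      using in_\<Psi>[OF poly_graph_diff[OF *(1,2)]] in_\<Psi>[OF poly_graph_mult[OF *(1,2)]] *
      by simp_all
  next
    fix a assume "(0, a) \<in> \<Psi>"
    thus "a = 0" using assms(1) by (auto simp: \<Psi>_def)
  qed
qed

end

lemma poly_altdef_le:
  fixes p :: "'a::comm_semiring_1 poly"
  assumes "degree p \<le> n"
  shows "poly p x = (\<Sum>i\<le>n. coeff p i * x ^ i)"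
  unfolding poly_altdef using assms
  by (intro sum.mono_neutral_left) (auto simp: coeff_eq_0)

text \<open>The reversed polynomial, which clears the negative powers of \<open>x\<close>. Any bound
  \<open>n\<close> on the degree is allowed, so that two polynomials can be reversed with the same
  \<open>n\<close>.\<close>

lemma poly_inverse_scaled:
  fixes f :: "'a::field poly"
  assumes "x \<noteq> 0" "degree f \<le> n"
  shows "x ^ n * poly f (inverse x) = (\<Sum>i\<le>n. coeff f i * x ^ (n - i))"
  unfolding poly_altdef_le[OF assms(2)] sum_distrib_left
  by (intro sum.cong) (use assms in \<open>auto simp: power_diff field_simps\<close>)

section \<open>Chevalley's extension theorem: maximal partial homomorphisms are places\<close>

definition maximal_graph :: "('e::field \<times> 'k::field) set \<Rightarrow> bool" where
  "maximal_graph \<Phi> \<longleftrightarrow> ring_graph \<Phi> \<and> (\<forall>\<Psi>. ring_graph \<Psi> \<longrightarrow> \<Phi> \<subseteq> \<Psi> \<longrightarrow> \<Psi> = \<Phi>)"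

context
  fixes \<Phi> :: "('e::field \<times> 'k::field) set"
  assumes maximal: "maximal_graph \<Phi>"
begin

lemma maximal_ring_graph: "ring_graph \<Phi>"
  using maximal by (simp add: maximal_graph_def)

private lemmas \<Phi> = maximal_ring_graph

lemma maximal_graph_mem:
  assumes "\<And>f g. poly_graph \<Phi> f g \<Longrightarrow> poly f x = 0 \<Longrightarrow> poly g \<xi> = 0"
  shows "(x, \<xi>) \<in> \<Phi>"
proof -
  have "poly_graph \<Phi> f g \<longrightarrow> poly f x = 0 \<longrightarrow> poly g \<xi> = 0" for f g
    using assms by blast
  note ext = ring_graph_extend[OF \<Phi> this[rule_format]]
  have "{(poly f x, poly g \<xi>) | f g. poly_graph \<Phi> f g} = \<Phi>"
    by (rule maximal[unfolded maximal_graph_def, THEN conjunct2, rule_format])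
      (use ext(1,2) in auto)
  thus ?thesis using ext(3) by auto
qed

text \<open>The domain is local. A relation for \<open>1/b\<close>, multiplied by
  \<open>b ^ n\<close>, becomes a relation among elements of the domain, and its image is the
  corresponding relation for \<open>1/\<beta>\<close>. So \<open>1/b\<close> can be given the value
  \<open>1/\<beta>\<close>, and by maximality it already has it.\<close>

lemma maximal_graph_inverse:
  assumes "(b, \<beta>) \<in> \<Phi>" "\<beta> \<noteq> 0"
  shows "(inverse b, inverse \<beta>) \<in> \<Phi>"
proof (rule maximal_graph_mem)
  fix f g assume fg: "poly_graph \<Phi> f g" "poly f (inverse b) = 0"
  have "b \<noteq> 0" using assms ring_graph_zeroD[OF \<Phi>] by auto
  define n where "n = max (degree f) (degree g)"
  have "(\<Sum>i\<le>n. coeff f i * b ^ (n - i), \<Sum>i\<le>n. coeff g i * \<beta> ^ (n - i)) \<in> \<Phi>"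
    using fg(1) assms(1)
    by (intro ring_graph_sum[OF \<Phi>] ring_graph_mult[OF \<Phi>] ring_graph_power[OF \<Phi>])
      (auto simp: poly_graph_def)
  also have "(\<Sum>i\<le>n. coeff f i * b ^ (n - i)) = 0"
    using poly_inverse_scaled[OF \<open>b \<noteq> 0\<close>, of f n] fg by (simp add: n_def)
  finally have "(\<Sum>i\<le>n. coeff g i * \<beta> ^ (n - i)) = 0"
    using ring_graph_zeroD[OF \<Phi>] by blast
  thus "poly g (inverse \<beta>) = 0"
    using poly_inverse_scaled[OF \<open>\<beta> \<noteq> 0\<close>, of g n] assms by (simp add: n_def)
qed

text \<open>The constant coefficient of \<open>f\<close> has value 1 and all others have value 0:
  the elements of value 0 generate the unit ideal in the ring obtained by adjoining
  \<open>x\<close>. This is the obstruction to giving \<open>x\<close> a value.\<close>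

definition unit_relation :: "'e \<Rightarrow> nat \<Rightarrow> bool" where
  "unit_relation x n \<longleftrightarrow> (\<exists>f. degree f \<le> n \<and> poly f x = 0 \<and> poly_graph \<Phi> f 1)"

text \<open>Chevalley's descent. The relation for \<open>1/x\<close>, multiplied by
  \<open>x ^ m\<close>, is a relation for \<open>x\<close> whose coefficient of degree
  \<open>m\<close> is a unit, so a multiple of it cancels the term of degree \<open>n\<close> in
  \<open>f\<close>.\<close>

lemma unit_relation_reduce:
  assumes "unit_relation x n" "unit_relation (inverse x) m" "m \<le> n" "x \<noteq> 0"
  shows "0 < n" "unit_relation x (n - 1)"
proof -
  obtain f where f: "degree f \<le> n" "poly f x = 0" "poly_graph \<Phi> f 1"
    using assms by (auto simp: unit_relation_def)
  obtain h where h: "degree h \<le> m" "poly h (inverse x) = 0" "poly_graph \<Phi> h 1"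
    using assms by (auto simp: unit_relation_def)
  have f0: "(coeff f 0, 1) \<in> \<Phi>" "0 < i \<Longrightarrow> (coeff f i, 0) \<in> \<Phi>"
    and h0: "(coeff h 0, 1) \<in> \<Phi>" "0 < i \<Longrightarrow> (coeff h i, 0) \<in> \<Phi>" for i
    using f(3)[unfolded poly_graph_def, rule_format, of 0] h(3)[unfolded poly_graph_def, rule_format, of 0]
      f(3)[unfolded poly_graph_def, rule_format, of i] h(3)[unfolded poly_graph_def, rule_format, of i]
    by simp_all
  have nz: "coeff f 0 \<noteq> 0" "coeff h 0 \<noteq> 0"
    using f0 h0 ring_graph_zeroD[OF \<Phi>] by fastforce+
  show "0 < n"
  proof (rule ccontr)
    assume "\<not> 0 < n"
    hence "f = [:coeff f 0:]" using f(1) by (metis degree_eq_zeroE coeff_pCons_0 le_zero_eq not_gr_zero)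
    hence "poly f x = coeff f 0" by (metis poly_const_conv)
    thus False using f nz by simp
  qed
  \<comment> \<open>\<open>coeff h 0\<close> is the coefficient of \<open>x ^ m\<close> in the
    reversed relation \<open>k\<close>. As \<open>c\<close> has value 0, subtracting the multiple
    leaves the values of all coefficients unchanged, even if \<open>m = n\<close> and the constant
    term is affected.\<close>
  define c where "c = coeff f n * inverse (coeff h 0)"
  have c: "(c, 0) \<in> \<Phi>"
    using ring_graph_mult[OF \<Phi> f0(2)[OF \<open>0 < n\<close>] maximal_graph_inverse[OF h0(1)]]
    by (simp add: c_def)
  define k where "k = (\<Sum>i\<le>m. monom (coeff h i) (m - i))"
  have "poly k x = (\<Sum>i\<le>m. coeff h i * x ^ (m - i))"
    by (simp add: k_def poly_sum poly_monom)
  hence kx: "poly k x = 0"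
    using poly_inverse_scaled[OF assms(4) h(1)] h by simp
  have ck: "coeff k j = (if j \<le> m then coeff h (m - j) else 0)" for j
  proof -
    have "coeff k j = (\<Sum>i\<le>m. if i = m - j \<and> j \<le> m then coeff h i else 0)"
      unfolding k_def coeff_sum by (intro sum.cong) auto
    thus ?thesis by (auto simp: sum.delta)
  qed
  define f' where "f' = f - monom c (n - m) * k"
  have cf': "coeff f' j = coeff f j - (if n - m \<le> j then c * coeff k (j - (n - m)) else 0)" for j
    by (simp add: f'_def coeff_monom_mult)
  have kk: "\<exists>a. (coeff k j, a) \<in> \<Phi>" for j
    using h(3) ring_graph_zero[OF \<Phi>] by (auto simp: ck poly_graph_def)
  have "(coeff f' j, coeff 1 j) \<in> \<Phi>" for j
  proof -
    obtain a where "(coeff k (j - (n - m)), a) \<in> \<Phi>" using kk by blast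
    from ring_graph_mult[OF \<Phi> c this] have "(c * coeff k (j - (n - m)), 0) \<in> \<Phi>" by simp
    from ring_graph_diff[OF \<Phi> _ this, of "coeff f j" "coeff 1 j"] show ?thesis
      using f(3) by (auto simp: cf' poly_graph_def)
  qed
  hence 1: "poly_graph \<Phi> f' 1" by (simp add: poly_graph_def)
  have 2: "poly f' x = 0" by (simp add: f'_def f kx)
  have "coeff f' j = 0" if "j > n - 1" for j
  proof (cases "j = n")
    case True
    thus ?thesis using assms(3) nz by (simp add: cf' ck c_def)
  next
    case False
    hence "j > n" using that by simp
    thus ?thesis using f(1) assms(3) by (auto simp: cf' ck coeff_eq_0)
  qed
  hence "degree f' \<le> n - 1" by (intro degree_le) auto
  with 1 2 show "unit_relation x (n - 1)" by (auto simp: unit_relation_def)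
qed

text \<open>The statement is symmetric in \<open>x\<close> and \<open>1/x\<close>, so the relation
  of larger degree can always be shortened, whereas no relation of degree 0 exists.\<close>

lemma unit_relation_contradiction:
  assumes "unit_relation x n" "unit_relation (inverse x) m" "x \<noteq> 0"
  shows False
  using assms
proof (induction "n + m" arbitrary: x n m rule: less_induct)
  case less
  show ?case
  proof (cases "m \<le> n")
    case True
    from unit_relation_reduce[OF less.prems(1,2) True less.prems(3)]
    show ?thesis using less.hyps[of "n - 1" m x] less.prems by simp
  next
    case False
    have *: "unit_relation (inverse (inverse x)) n" using less.prems by simp
    from unit_relation_reduce[OF less.prems(2) *] False less.prems
    have "0 < m" "unit_relation (inverse x) (m - 1)" by auto
    thus ?thesis using less.hyps[of n "m - 1" x] less.prems by simp
  qed
qed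

end

text \<open>\<open>J\<close> collects the images of the relations satisfied by \<open>x\<close>. A
  common root of its members could be taken as the value of \<open>x\<close>, so there is none. The
  values form a field, hence long division stays inside \<open>J\<close> and a member of least
  degree divides all others. Over an algebraically closed field it must be constant, and scaling it
  to 1 gives the unit relation.\<close>

lemma maximal_graph_unit_relation:
  fixes \<Phi> :: "('e::field \<times> 'k::alg_closed_field) set"
  assumes maximal: "maximal_graph \<Phi>"
    and x: "\<nexists>a. (x, a) \<in> \<Phi>"
  shows "\<exists>n. unit_relation \<Phi> x n"
proof -
  note \<Phi> = maximal_ring_graph[OF maximal]
  note inv = maximal_graph_inverse[OF maximal]
  define J where "J = {g. \<exists>f. poly_graph \<Phi> f g \<and> poly f x = 0}"
  have "\<exists>g\<in>J. poly g \<xi> \<noteq> 0" for \<xi>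
  proof (rule ccontr)
    assume "\<not> ?thesis"
    hence "(x, \<xi>) \<in> \<Phi>"
      by (intro maximal_graph_mem[OF maximal]) (auto simp: J_def)
    thus False using x by blast
  qed
  note ex = this
  obtain g0 where "g0 \<in> J" "poly g0 0 \<noteq> 0" using ex by blast
  hence "g0 \<noteq> 0" by auto
  define g where "g = arg_min degree (\<lambda>g. g \<in> J \<and> g \<noteq> 0)"
  have g: "g \<in> J" "g \<noteq> 0" "\<And>g'. g' \<in> J \<Longrightarrow> g' \<noteq> 0 \<Longrightarrow> degree g \<le> degree g'"
    using arg_min_nat_lemma[of "\<lambda>g. g \<in> J \<and> g \<noteq> 0" g0 degree] \<open>g0 \<in> J\<close> \<open>g0 \<noteq> 0\<close>
    by (auto simp: g_def)
  obtain f where f: "poly_graph \<Phi> f g" "poly f x = 0" using g by (auto simp: J_def)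
  have dvd: "g dvd g'" if "g' \<in> J" for g'
    using that
  proof (induction "degree g'" arbitrary: g' rule: less_induct)
    case less
    show ?case
    proof (cases "g' = 0 \<or> degree g = 0")
      case True
      thus ?thesis using g(2) by (auto simp: is_unit_iff_degree intro: unit_imp_dvd)
    next
      case False
      obtain f' where f': "poly_graph \<Phi> f' g'" "poly f' x = 0" using less.prems by (auto simp: J_def)
      have le: "degree g \<le> degree g'" using g(3)[OF less.prems] False by simp
      obtain a b where "(a, lead_coeff g') \<in> \<Phi>" "(b, lead_coeff g) \<in> \<Phi>"
        using f(1) f'(1) by (auto simp: poly_graph_def)
      hence "(a * inverse b, lead_coeff g' / lead_coeff g) \<in> \<Phi>"
        using ring_graph_mult[OF \<Phi> _ inv, of a "lead_coeff g'" b "lead_coeff g"] g(2)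
        by (simp add: field_simps)
      note m = poly_graph_monom[OF \<Phi> this, of "degree g' - degree g"]
      define r where "r = g' - monom (lead_coeff g' / lead_coeff g) (degree g' - degree g) * g"
      have "r \<in> J"
        unfolding J_def mem_Collect_eq r_def
        by (rule exI, rule conjI, rule poly_graph_diff[OF \<Phi> f'(1) poly_graph_mult[OF \<Phi> m f(1)]])
          (simp add: f f')
      moreover have "r = 0 \<or> degree r < degree g'"
      proof -
        have "degree r \<le> degree g'" unfolding r_def
          using degree_monom_le[of "lead_coeff g' / lead_coeff g" "degree g' - degree g"] le
          by (intro degree_diff_le order.refl order.trans[OF degree_mult_le]) simp
        moreover have "coeff r (degree g') = 0"
          using le g(2) by (simp add: r_def coeff_monom_mult)
        ultimately show ?thesis
          using leading_coeff_0_iff[of r] by (cases "degree r = degree g'") auto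
      qed
      ultimately have "g dvd r" using less.hyps[of r] by auto
      moreover have "g' = r + monom (lead_coeff g' / lead_coeff g) (degree g' - degree g) * g"
        by (simp add: r_def)
      ultimately show ?thesis by (metis dvd_add dvd_triv_right)
    qed
  qed
  have "degree g = 0"
  proof (rule ccontr)
    assume "degree g \<noteq> 0"
    then obtain \<xi> where "poly g \<xi> = 0" using alg_closed_imp_poly_has_root[of g] by auto
    moreover obtain g' where "g' \<in> J" "poly g' \<xi> \<noteq> 0" using ex by blast
    ultimately show False using dvd[of g'] by (auto elim!: dvdE)
  qed
  then obtain \<beta> where \<beta>: "g = [:\<beta>:]" by (elim degree_eq_zeroE)
  with g have "\<beta> \<noteq> 0" by auto
  have "(coeff f 0, \<beta>) \<in> \<Phi>" using f(1) \<beta> by (metis coeff_pCons_0 poly_graph_def)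
  from poly_graph_monom[OF \<Phi> inv[OF this \<open>\<beta> \<noteq> 0\<close>], of 0]
  have "poly_graph \<Phi> (monom (inverse (coeff f 0)) 0 * f) (monom (inverse \<beta>) 0 * g)"
    using f(1) by (rule poly_graph_mult[OF \<Phi>])
  moreover have "monom (inverse \<beta>) 0 * g = 1"
    using \<open>\<beta> \<noteq> 0\<close> by (simp add: \<beta> monom_0 one_pCons)
  moreover have "poly (monom (inverse (coeff f 0)) 0 * f) x = 0" by (simp add: f)
  ultimately show ?thesis unfolding unit_relation_def[OF maximal] by (metis order.refl)
qed

text \<open>Zorn's lemma gives a maximal graph. If neither \<open>x\<close> nor \<open>1/x\<close>
  were in its domain, both would satisfy a unit relation.\<close>

theorem place_extension:
  fixes \<Phi> :: "('e::field \<times> 'k::alg_closed_field) set"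
  assumes "ring_graph \<Phi>"
  obtains R and res :: "'e \<Rightarrow> 'k"
    where "place R res" "\<And>x a. (x, a) \<in> \<Phi> \<Longrightarrow> x \<in> R \<and> res x = a"
proof -
  define AA where "AA = {\<Psi>. ring_graph \<Psi> \<and> \<Phi> \<subseteq> \<Psi>}"
  have "\<exists>M\<in>AA. \<forall>\<Psi>\<in>AA. M \<subseteq> \<Psi> \<longrightarrow> \<Psi> = M"
  proof (rule subset_Zorn_nonempty)
    show "AA \<noteq> {}" using assms by (auto simp: AA_def)
  next
    fix CC assume C: "CC \<noteq> {}" "subset.chain AA CC"
    have rg: "ring_graph \<Psi>" "\<Phi> \<subseteq> \<Psi>" if "\<Psi> \<in> CC" for \<Psi>
      using that C(2) by (auto simp: subset.chain_def AA_def)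
    have "ring_graph (\<Union>CC)"
      unfolding ring_graph_def
    proof (intro conjI allI impI)
      obtain \<Psi> where "\<Psi> \<in> CC" using C(1) by blast
      thus "(1, 1) \<in> \<Union>CC" using ring_graph_one[OF rg(1)] by blast
    next
      fix x a y b assume "(x, a) \<in> \<Union>CC" "(y, b) \<in> \<Union>CC"
      then obtain \<Psi> \<Psi>' where "\<Psi> \<in> CC" "\<Psi>' \<in> CC" "(x, a) \<in> \<Psi>" "(y, b) \<in> \<Psi>'" by blast
      moreover from this have "\<Psi> \<subseteq> \<Psi>' \<or> \<Psi>' \<subseteq> \<Psi>"
        using C(2) by (auto simp: subset.chain_def)
      ultimately obtain \<Psi>'' where "\<Psi>'' \<in> CC" "(x, a) \<in> \<Psi>''" "(y, b) \<in> \<Psi>''" by blast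
      thus "(x - y, a - b) \<in> \<Union>CC" "(x * y, a * b) \<in> \<Union>CC"
        using ring_graph_diff[OF rg(1)[OF \<open>\<Psi>'' \<in> CC\<close>]] ring_graph_mult[OF rg(1)[OF \<open>\<Psi>'' \<in> CC\<close>]]
        by (meson UnionI)+
    next
      fix a assume "(0, a) \<in> \<Union>CC"
      then obtain \<Psi> where "\<Psi> \<in> CC" "(0, a) \<in> \<Psi>" by blast
      thus "a = 0" using ring_graph_zeroD[OF rg(1)] by metis
    qed
    thus "\<Union>CC \<in> AA" using C(1) rg by (auto simp: AA_def)
  qed
  obtain M where M: "ring_graph M" "\<Phi> \<subseteq> M"
    and max: "maximal_graph M"
  proof -
    from \<open>\<exists>M\<in>AA. _\<close> obtain M where "M \<in> AA" "\<And>\<Psi>. \<Psi> \<in> AA \<Longrightarrow> M \<subseteq> \<Psi> \<Longrightarrow> \<Psi> = M" by blast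
    thus ?thesis using that[of M] by (auto simp: AA_def maximal_graph_def)
  qed
  \<comment> \<open>Outside the domain of \<open>M\<close> the value is unspecified; the axioms of
    \<open>place\<close> constrain \<open>res\<close> only on the domain.\<close>
  define res where "res x = (THE a. (x, a) \<in> M)" for x
  have res: "x \<in> Domain M" "res x = a" if "(x, a) \<in> M" for x a
    using that the_equality[of "\<lambda>a. (x, a) \<in> M" a] ring_graph_unique[OF M(1) _ that]
    unfolding res_def by (blast, blast)
  have dom: "(x, res x) \<in> M" if "x \<in> Domain M" for x
    using that res by (metis DomainE)
  note inv = maximal_graph_inverse[OF max]
  show ?thesis
  proof
    show "place (Domain M) res"
    proof
      show "1 \<in> Domain M" "res 1 = 1" using res[OF ring_graph_one[OF M(1)]] by auto
    next
      fix x y assume "x \<in> Domain M" "y \<in> Domain M"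
      note * = this[THEN dom]
      from res[OF ring_graph_diff[OF M(1) *]] res[OF ring_graph_mult[OF M(1) *]]
      show "x - y \<in> Domain M" "x * y \<in> Domain M"
        "res (x - y) = res x - res y" "res (x * y) = res x * res y" by auto
    next
      fix x
      show "x \<in> Domain M \<or> inverse x \<in> Domain M"
      proof (cases "x = 0")
        case True
        thus ?thesis using ring_graph_zero[OF M(1)] by auto
      next
        case False
        show ?thesis
        proof (rule ccontr)
          assume "\<not> ?thesis"
          hence "\<exists>n. unit_relation M x n" "\<exists>n. unit_relation M (inverse x) n"
            using maximal_graph_unit_relation[OF max, of x] maximal_graph_unit_relation[OF max, of "inverse x"] by blast+
          thus False using unit_relation_contradiction[OF max] False by blast
        qed
      qed
    next
      fix x assume "x \<in> Domain M" "res x \<noteq> 0"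
      thus "inverse x \<in> Domain M" using inv[OF dom[of x]] by blast
    qed
  next
    fix x a assume "(x, a) \<in> \<Phi>"
    hence "(x, a) \<in> M" using M(2) by blast
    thus "x \<in> Domain M \<and> res x = a" using res[of x a] by simp
  qed
qed

section \<open>Residues, valuations and reduction of polynomials at a place\<close>

context place
begin

lemma zero_mem [simp]: "0 \<in> R" and res_zero [simp]: "res 0 = 0"
  using diff_mem[of 1 1] res_diff[of 1 1] by simp_all

lemma uminus_mem: "x \<in> R \<Longrightarrow> - x \<in> R" and res_uminus: "x \<in> R \<Longrightarrow> res (- x) = - res x"
  using diff_mem[of 0 x] res_diff[of 0 x] by simp_all

lemma add_mem: "x \<in> R \<Longrightarrow> y \<in> R \<Longrightarrow> x + y \<in> R"
  and res_add: "x \<in> R \<Longrightarrow> y \<in> R \<Longrightarrow> res (x + y) = res x + res y"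
  using diff_mem[OF _ uminus_mem, of x y] res_diff[OF _ uminus_mem, of x y]
  by (simp_all add: res_uminus)

lemma power_mem: "x \<in> R \<Longrightarrow> x ^ n \<in> R" and res_power: "x \<in> R \<Longrightarrow> res (x ^ n) = res x ^ n"
  by (induction n) (auto simp: mult_mem res_mult)

lemma sum_mem: "(\<And>i. i \<in> A \<Longrightarrow> f i \<in> R) \<Longrightarrow> sum f A \<in> R"
  by (induction A rule: infinite_finite_induct) (auto simp: add_mem)

lemma res_sum: "(\<And>i. i \<in> A \<Longrightarrow> f i \<in> R) \<Longrightarrow> res (sum f A) = (\<Sum>i\<in>A. res (f i))"
  by (induction A rule: infinite_finite_induct) (auto simp: res_add sum_mem)

lemma prod_mem: "(\<And>i. i \<in> A \<Longrightarrow> f i \<in> R) \<Longrightarrow> prod f A \<in> R"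
  by (induction A rule: infinite_finite_induct) (auto simp: mult_mem)

lemma res_prod: "(\<And>i. i \<in> A \<Longrightarrow> f i \<in> R) \<Longrightarrow> res (prod f A) = (\<Prod>i\<in>A. res (f i))"
  by (induction A rule: infinite_finite_induct) (auto simp: res_mult prod_mem)

lemma of_nat_mem: "of_nat n \<in> R" and res_of_nat: "res (of_nat n) = of_nat n"
  by (induction n) (auto simp: add_mem res_add)

lemma res_inverse_eq_0:
  assumes "x \<notin> R"
  shows "inverse x \<in> R" "res (inverse x) = 0"
proof -
  show *: "inverse x \<in> R" using mem_or_inverse_mem assms by blast
  show "res (inverse x) = 0" using inverse_mem[OF *] assms by auto
qed

text \<open>Divisibility by elements of \<open>R\<close> is a total preorder on the nonzero elements
  of the field; \<open>c\<close> has largest absolute value for the valuation of the place.\<close>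

lemma finite_has_dominant:
  assumes "finite S" "S \<noteq> {}" "0 \<notin> S"
  shows "\<exists>c\<in>S. \<forall>x\<in>S. x / c \<in> R"
  using assms
proof (induction S rule: finite_ne_induct)
  case (singleton x)
  thus ?case by auto
next
  case (insert y S)
  then obtain c where c: "c \<in> S" "\<forall>x\<in>S. x / c \<in> R" by auto
  hence nz: "c \<noteq> 0" "y \<noteq> 0" using insert.prems by auto
  show ?case
  proof (cases "y / c \<in> R")
    case True
    thus ?thesis using c by auto
  next
    case False
    hence "c / y \<in> R" using mem_or_inverse_mem[of "y / c"] nz by (auto simp: field_simps)
    hence "x / y \<in> R" if "x \<in> S" for x
      using mult_mem[of "x / c" "c / y"] c that nz by (simp add: field_simps)
    thus ?thesis using nz by auto
  qed
qed

lemma finite_has_smallest: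
  assumes "finite S" "S \<noteq> {}" "0 \<notin> S"
  shows "\<exists>c\<in>S. \<forall>x\<in>S. c / x \<in> R"
proof -
  have "\<exists>c\<in>inverse ` S. \<forall>x\<in>inverse ` S. x / c \<in> R"
    using assms by (intro finite_has_dominant) auto
  then obtain c where c: "c \<in> S" "\<And>x. x \<in> S \<Longrightarrow> inverse x / inverse c \<in> R" by auto
  moreover have "inverse x / inverse c = c / x" for x by (simp add: field_simps)
  ultimately show ?thesis by auto
qed

definition integral_polys :: "'e poly set" where
  "integral_polys = {f. \<forall>i. coeff f i \<in> R}"

abbreviation red :: "'e poly \<Rightarrow> 'k poly" where
  "red \<equiv> map_poly res"

lemma coeff_red [simp]: "coeff (red f) i = res (coeff f i)"
  by (simp add: coeff_map_poly)

lemma integral_polysD: "f \<in> integral_polys \<Longrightarrow> coeff f i \<in> R"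
  by (simp add: integral_polys_def)

lemma integral_polys_diff: "f \<in> integral_polys \<Longrightarrow> g \<in> integral_polys \<Longrightarrow> f - g \<in> integral_polys"
  and red_diff: "f \<in> integral_polys \<Longrightarrow> g \<in> integral_polys \<Longrightarrow> red (f - g) = red f - red g"
  by (auto simp: integral_polys_def poly_eq_iff diff_mem res_diff)

lemma integral_polys_add: "f \<in> integral_polys \<Longrightarrow> g \<in> integral_polys \<Longrightarrow> f + g \<in> integral_polys"
  and red_add: "f \<in> integral_polys \<Longrightarrow> g \<in> integral_polys \<Longrightarrow> red (f + g) = red f + red g"
  by (auto simp: integral_polys_def poly_eq_iff add_mem res_add)

lemma integral_polys_mult: "f \<in> integral_polys \<Longrightarrow> g \<in> integral_polys \<Longrightarrow> f * g \<in> integral_polys"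
  and red_mult: "f \<in> integral_polys \<Longrightarrow> g \<in> integral_polys \<Longrightarrow> red (f * g) = red f * red g"
  by (auto simp: integral_polys_def poly_eq_iff coeff_mult res_mult res_sum[OF mult_mem]
      intro!: sum_mem mult_mem)

lemma integral_polys_smult: "c \<in> R \<Longrightarrow> f \<in> integral_polys \<Longrightarrow> smult c f \<in> integral_polys"
  and red_smult: "c \<in> R \<Longrightarrow> f \<in> integral_polys \<Longrightarrow> red (smult c f) = smult (res c) (red f)"
  by (auto simp: integral_polys_def poly_eq_iff mult_mem res_mult)

lemma integral_polys_1: "1 \<in> integral_polys" and red_1: "red 1 = 1"
  by (auto simp: integral_polys_def coeff_1)

lemma integral_polys_0: "0 \<in> integral_polys" and red_0: "red 0 = 0"
  by (auto simp: integral_polys_def)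

lemma integral_polys_power: "f \<in> integral_polys \<Longrightarrow> f ^ n \<in> integral_polys"
  and red_power: "f \<in> integral_polys \<Longrightarrow> red (f ^ n) = red f ^ n"
  by (induction n) (auto simp: integral_polys_mult red_mult integral_polys_1 red_1)

lemma integral_polys_sum: "(\<And>i. i \<in> A \<Longrightarrow> f i \<in> integral_polys) \<Longrightarrow> sum f A \<in> integral_polys"
  by (induction A rule: infinite_finite_induct) (auto simp: integral_polys_add integral_polys_0)

lemma red_sum:
  "(\<And>i. i \<in> A \<Longrightarrow> f i \<in> integral_polys) \<Longrightarrow> red (sum f A) = (\<Sum>i\<in>A. red (f i))"
  by (induction A rule: infinite_finite_induct) (auto simp: red_add integral_polys_sum red_0)

lemma integral_polys_pCons:
  "c \<in> R \<Longrightarrow> f \<in> integral_polys \<Longrightarrow> pCons c f \<in> integral_polys"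
  by (auto simp: integral_polys_def coeff_pCons split: nat.splits)

lemma integral_poly_mem:
  assumes "f \<in> integral_polys" "x \<in> R"
  shows "poly f x \<in> R" "res (poly f x) = poly (red f) (res x)"
proof -
  have "degree (red f) \<le> degree f" by (intro degree_le) (auto simp: coeff_eq_0)
  have m: "coeff f i * x ^ i \<in> R" for i
    using assms by (auto intro: mult_mem power_mem integral_polysD)
  show "poly f x \<in> R" unfolding poly_altdef using m by (intro sum_mem) auto
  show "res (poly f x) = poly (red f) (res x)"
    unfolding poly_altdef[of f x] poly_altdef_le[OF \<open>degree (red f) \<le> degree f\<close>]
    using assms m by (subst res_sum) (auto simp: res_mult res_power power_mem integral_polysD)
qed

lemma red_pCons [simp]: "red (pCons c f) = pCons (res c) (red f)"
  by (rule poly_eqI) (auto simp: coeff_pCons split: nat.splits)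

text \<open>Division by a coefficient of largest absolute value, taken over both polynomials at
  once: the quotient \<open>p / q\<close> is preserved, and not both reductions vanish.\<close>

lemma normalize_pair:
  assumes "p \<noteq> 0 \<or> q \<noteq> 0"
  obtains C where "C \<noteq> 0" "smult (inverse C) p \<in> integral_polys" "smult (inverse C) q \<in> integral_polys"
    "red (smult (inverse C) p) \<noteq> 0 \<or> red (smult (inverse C) q) \<noteq> 0"
proof -
  define S where "S = (set (coeffs p) \<union> set (coeffs q)) - {0}"
  have in_S: "coeff p i \<in> S \<or> coeff p i = 0" "coeff q i \<in> S \<or> coeff q i = 0" for i
    by (auto simp: S_def in_set_coeffs)
  have "S \<noteq> {}"
    using assms in_S by (metis empty_iff leading_coeff_0_iff)
  then obtain c where c: "c \<in> S" "\<forall>x\<in>S. x / c \<in> R"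
    using finite_has_dominant[of S] by (auto simp: S_def)
  have nz: "c \<noteq> 0" using c by (auto simp: S_def)
  show ?thesis
  proof
    show "c \<noteq> 0" by fact
    show "smult (inverse c) p \<in> integral_polys" "smult (inverse c) q \<in> integral_polys"
      unfolding integral_polys_def using in_S c(2)
      by (auto simp: field_simps) (metis div_0 zero_mem)+
    have "(\<exists>i. coeff p i = c) \<or> (\<exists>i. coeff q i = c)"
      using c(1) by (auto simp: S_def coeffs_def split: if_splits)
    thus "red (smult (inverse c) p) \<noteq> 0 \<or> red (smult (inverse c) q) \<noteq> 0"
    proof (elim disjE exE)
      fix i assume "coeff p i = c"
      hence "coeff (red (smult (inverse c) p)) i \<noteq> 0" using nz by simp
      thus ?thesis by force
    next
      fix i assume "coeff q i = c"
      hence "coeff (red (smult (inverse c) q)) i \<noteq> 0" using nz by simp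
      thus ?thesis by force
    qed
  qed
qed

lemma normalize_poly:
  assumes "p \<noteq> 0"
  obtains C p' where "C \<noteq> 0" "p = smult C p'" "p' \<in> integral_polys" "red p' \<noteq> 0"
proof -
  obtain C where "C \<noteq> 0" "smult (inverse C) p \<in> integral_polys" "red (smult (inverse C) p) \<noteq> 0"
    using normalize_pair[of p p] assms by metis
  thus ?thesis using that[of C "smult (inverse C) p"] by simp
qed

end

section \<open>Lifting of roots and nonconstant reductions\<close>

locale alg_place = place R res
  for R :: "'e::alg_closed_field set" and res :: "'e \<Rightarrow> 'k::{alg_closed_field,field_char_0}"
begin

text \<open>Takes the place of Hensel's lemma. Over an algebraically closed field \<open>f\<close>
  splits into linear factors, and each can be scaled to be integral with nonzero reduction. A root
  of the reduction of \<open>f\<close> is then a root of the reduction of one factor.\<close>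

lemma root_lift:
  assumes "f \<in> integral_polys" "red f \<noteq> 0" "poly (red f) \<xi> = 0"
  shows "\<exists>\<beta>\<in>R. poly f \<beta> = 0 \<and> res \<beta> = \<xi>"
  using assms
proof (induction "degree f" arbitrary: f rule: less_induct)
  case less
  have "degree f \<noteq> 0"
  proof
    assume "degree f = 0"
    then obtain a where "f = [:a:]" by (elim degree_eq_zeroE)
    thus False using less.prems by (cases "res a = 0") (auto simp:)
  qed
  then obtain \<beta> where \<beta>: "poly f \<beta> = 0" using alg_closed_imp_poly_has_root[of f] by auto
  \<comment> \<open>For a root outside \<open>R\<close> the scaled factor reduces to the constant -1
    and contributes no root.\<close>
  define g where "g = (if \<beta> \<in> R then [:- \<beta>, 1:] else [:- 1, inverse \<beta>:])"
  have "\<beta> \<noteq> 0" if "\<beta> \<notin> R" using that by auto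
  hence "[:- \<beta>, 1:] = smult (if \<beta> \<in> R then 1 else \<beta>) g" by (auto simp: g_def)
  moreover have "[:- \<beta>, 1:] dvd f" using \<beta> by (simp add: poly_eq_0_iff_dvd)
  ultimately have "g dvd f" by (metis smult_dvd_cancel)
  then obtain h where h: "f = g * h" by (elim dvdE)
  have g: "g \<in> integral_polys" "red g \<noteq> 0" "degree g \<le> 1"
    using res_inverse_eq_0[of \<beta>]
    by (auto simp: g_def res_uminus intro!: integral_polys_pCons integral_polys_0 uminus_mem)
  have "h \<noteq> 0" using h less.prems by auto
  then obtain C h' where C: "C \<noteq> 0" "h = smult C h'" "h' \<in> integral_polys" "red h' \<noteq> 0"
    by (rule normalize_poly)
  have f: "f = smult C (g * h')" using C by (simp add: h)
  have "red (g * h') \<noteq> 0" using g C by (simp add: red_mult)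
  \<comment> \<open>This coefficient is a unit of \<open>R\<close>, and \<open>C\<close> times it is
    a coefficient of the integral polynomial \<open>f\<close>; so the scalar \<open>C\<close> is
    integral.\<close>
  then obtain i where "res (coeff (g * h') i) \<noteq> 0" by (metis coeff_red leading_coeff_0_iff)
  moreover have "coeff (g * h') i \<in> R"
    using g C by (intro integral_polysD integral_polys_mult)
  ultimately have "inverse (coeff (g * h') i) \<in> R" "coeff (g * h') i \<noteq> 0"
    using inverse_mem by auto
  moreover have "coeff f i = C * coeff (g * h') i" by (simp add: f)
  ultimately have "C \<in> R" using mult_mem[of "coeff f i" "inverse (coeff (g * h') i)"]
      integral_polysD[OF less.prems(1), of i]
    by (simp add: mult.assoc)
  have red_f: "red f = smult (res C) (red g * red h')"
    unfolding f using \<open>C \<in> R\<close> g C by (simp add: red_smult red_mult integral_polys_mult)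
  hence "res C \<noteq> 0" using less.prems by auto
  with red_f less.prems have "poly (red g) \<xi> = 0 \<or> poly (red h') \<xi> = 0" by auto
  thus ?case
  proof
    assume *: "poly (red g) \<xi> = 0"
    show ?thesis
    proof (cases "\<beta> \<in> R")
      case True
      thus ?thesis using * \<beta> by (intro bexI[of _ \<beta>]) (auto simp: g_def res_uminus)
    next
      case False
      thus ?thesis using * res_inverse_eq_0[OF False] by (auto simp: g_def res_uminus)
    qed
  next
    assume *: "poly (red h') \<xi> = 0"
    have "g \<noteq> 0" using g by auto
    have "degree g = 1 \<or> \<beta> \<notin> R" by (auto simp: g_def)
    moreover have "degree g = 1" if "\<beta> \<notin> R" using \<open>\<beta> \<notin> R \<Longrightarrow> \<beta> \<noteq> 0\<close> that by (auto simp: g_def)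
    ultimately have "degree g = 1" by blast
    hence "degree h < degree f" using h \<open>g \<noteq> 0\<close> \<open>h \<noteq> 0\<close> by (simp add: degree_mult_eq)
    hence "degree h' < degree f" using C by simp
    from less.hyps[OF this] C * have "\<exists>\<beta>\<in>R. poly h' \<beta> = 0 \<and> res \<beta> = \<xi>" by simp
    thus ?thesis by (auto simp: f)
  qed
qed

text \<open>
  Moving a closest pair of points with different values in \<open>{0, 1, -1}\<close> to 0 and 1 makes the
  points with distinct values stay distinct after reduction.
\<close>

lemma nonconstant_reduction:
  fixes p q :: "'e poly"
  assumes common: "\<And>t. poly p t = 0 \<Longrightarrow> poly q t \<noteq> 0"
    and nonconst: "degree p > 0 \<or> degree q > 0"
  obtains s c C where "c \<noteq> 0" "C \<noteq> 0"
    "smult (inverse C) (pcompose p [:s, c:]) \<in> integral_polys"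
    "smult (inverse C) (pcompose q [:s, c:]) \<in> integral_polys"
    "\<And>\<alpha> \<beta>. smult \<alpha> (red (smult (inverse C) (pcompose p [:s, c:]))) +
            smult \<beta> (red (smult (inverse C) (pcompose q [:s, c:]))) = 0 \<Longrightarrow> \<alpha> = 0 \<and> \<beta> = 0"
proof -
  \<comment> \<open>Three values with distinct residues, by characteristic zero. One of them may be
    taken nowhere by \<open>p / q\<close>. Later one may be lost under reduction, and two that are
    not lost are used.\<close>
  define U where "U = {0, 1, - 1 :: 'e}"
  have U: "u \<in> R" "res u \<in> {0, 1, - 1}" if "u \<in> U" for u
    using that by (auto simp: U_def uminus_mem res_uminus)
  have U_inj: "u = u'" if "u \<in> U" "u' \<in> U" "res u = res u'" for u u'
    using that by (auto simp: U_def res_uminus)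
  have neq_res: "res (- 1) = - 1" "res 1 \<noteq> res (- 1)"
  proof -
    show "res (- 1) = - 1" by (simp add: res_uminus)
    have "(1::'k) + 1 \<noteq> 0" by simp
    hence "(1::'k) \<noteq> - 1" by (metis add.right_inverse)
    thus "res 1 \<noteq> res (- 1)" by (simp add: res_uminus)
  qed
  have neq: "(0::'e) \<noteq> 1" "(0::'e) \<noteq> - 1" "(1::'e) \<noteq> - 1"
    using neq_res(2) by (simp, simp, metis)
  \<comment> \<open>The fibre of \<open>p / q\<close> over \<open>u\<close>. Distinct fibres are
    disjoint because \<open>p\<close> and \<open>q\<close> have no common zero.\<close>
  define L where "L u = {t. poly (p - smult u q) t = 0}" for u
  have disj: "u = u'" if "t \<in> L u" "t \<in> L u'" for t u u'
    using that common[of t] by (auto simp: L_def)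
  have const: "degree p = 0 \<and> degree q = 0"
    if d: "degree (p - smult u q) = 0" "degree (p - smult u' q) = 0" "u \<noteq> u'" for u u'
  proof -
    obtain a where a: "p - smult u q = [:a:]" using d(1) by (rule degree_eq_zeroE)
    obtain b where b: "p - smult u' q = [:b:]" using d(2) by (rule degree_eq_zeroE)
    note ab = a b
    have "smult (u' - u) q = (p - smult u q) - (p - smult u' q)"
      by (simp add: smult_diff_left)
    hence "smult (u' - u) q = [:a - b:]" by (simp add: ab)
    hence "degree (smult (u' - u) q) = 0" by simp
    hence q: "degree q = 0" using d(3) by simp
    have "p = [:a:] + smult u q" using ab(1) by (metis diff_add_cancel)
    hence "degree p \<le> 0" using q by (metis degree_add_le degree_pCons_0 degree_smult_le le_zero_eq)
    with q show ?thesis by simp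
  qed
  have L_nonempty: "L u \<noteq> {}" if "degree (p - smult u q) \<noteq> 0" for u
    using that alg_closed_imp_poly_has_root[of "p - smult u q"] by (auto simp: L_def)
  have L_finite: "finite (L u)" for u
  proof (cases "p - smult u q = 0")
    case True
    hence *: "p = smult u q" by simp
    hence "degree q = 0"
      using common alg_closed_imp_poly_has_root[of q] by (metis neq0_conv poly_smult mult_zero_right)
    with * nonconst show ?thesis by (simp split: if_splits)
  next
    case False
    thus ?thesis unfolding L_def by (rule poly_roots_finite)
  qed
  \<comment> \<open>Differences of points in two different fibres. The scale \<open>c\<close> will
    be one of smallest absolute value among them.\<close>
  define D where "D = (\<Union>u\<in>U. \<Union>u'\<in>U - {u}. (\<lambda>(t, t'). t' - t) ` (L u \<times> L u'))"
  have D_I: "t' - t \<in> D" if "u \<in> U" "u' \<in> U" "u \<noteq> u'" "t \<in> L u" "t' \<in> L u'" for u u' t t'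
  proof -
    have "t' - t \<in> (\<lambda>(t, t'). t' - t) ` (L u \<times> L u')" using that by force
    thus ?thesis using that unfolding D_def by blast
  qed
  have "finite D" using L_finite by (auto simp: D_def U_def)
  moreover have "0 \<notin> D" using disj by (auto simp: D_def)
  moreover have "D \<noteq> {}"
  proof -
    \<comment> \<open>At most one of the three polynomials \<open>p - u q\<close> is constant, so at
      least two fibres are nonempty.\<close>
    have "\<exists>u\<in>U. \<exists>u'\<in>U. u \<noteq> u' \<and> degree (p - smult u q) \<noteq> 0 \<and> degree (p - smult u' q) \<noteq> 0"
    proof (rule ccontr)
      assume "\<not> ?thesis"
      hence *: "degree (p - smult u q) = 0 \<or> degree (p - smult u' q) = 0"
        if "u \<in> U" "u' \<in> U" "u \<noteq> u'" for u u' using that by blast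
      show False
      proof -
        define d where "d u \<longleftrightarrow> degree (p - smult u q) = 0" for u
        have "0 \<in> U" "1 \<in> U" "- 1 \<in> U" by (auto simp: U_def)
        note U3 = this
        have "d 0 \<or> d 1" "d 0 \<or> d (- 1)" "d 1 \<or> d (- 1)"
          unfolding d_def
          by (rule *[OF U3(1,2) neq(1)], rule *[OF U3(1,3) neq(2)], rule *[OF U3(2,3) neq(3)])
        moreover have "\<not> (d u \<and> d u')" if "u \<noteq> u'" for u u'
          using const[OF _ _ that] nonconst unfolding d_def by linarith
        ultimately show False using neq by blast
      qed
    qed
    then obtain u u' t t' where "u \<in> U" "u' \<in> U" "u \<noteq> u'" "t \<in> L u" "t' \<in> L u'"
      using L_nonempty by blast
    thus ?thesis using D_I by blast
  qed
  ultimately obtain c where c: "c \<in> D" "\<And>d. d \<in> D \<Longrightarrow> c / d \<in> R" "c \<noteq> 0"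
    using finite_has_smallest[of D] by blast
  obtain u0 u1 s s' where u01: "u0 \<in> U" "u1 \<in> U" "u0 \<noteq> u1" "s \<in> L u0" "s' \<in> L u1" "c = s' - s"
  proof -
    from c(1) obtain u u' z where "u \<in> U" "u' \<in> U - {u}" "z \<in> L u \<times> L u'" "c = snd z - fst z"
      unfolding D_def by (auto simp: case_prod_beta)
    thus ?thesis using that[of u u' "fst z" "snd z"] by (auto simp: mem_Times_iff)
  qed
  define P where "P = pcompose p [:s, c:]"
  define Q where "Q = pcompose q [:s, c:]"
  have "P \<noteq> 0 \<or> Q \<noteq> 0"
    using nonconst c(3) by (auto simp: P_def Q_def pcompose_eq_0_iff)
  then obtain C where C: "C \<noteq> 0" "smult (inverse C) P \<in> integral_polys" "smult (inverse C) Q \<in> integral_polys"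
    "red (smult (inverse C) P) \<noteq> 0 \<or> red (smult (inverse C) Q) \<noteq> 0"
    by (rule normalize_pair)
  define p' where "p' = smult (inverse C) P"
  define q' where "q' = smult (inverse C) Q"
  have int: "p' \<in> integral_polys" "q' \<in> integral_polys" using C by (auto simp: p'_def q'_def)
  have root: "poly (p' - smult u q') t = 0 \<longleftrightarrow> s + c * t \<in> L u" for u t
    using C(1) by (simp add: p'_def q'_def P_def Q_def L_def poly_pcompose field_simps)
  have independent: "\<alpha> = 0 \<and> \<beta> = 0" if rel: "smult \<alpha> (red p') + smult \<beta> (red q') = 0" for \<alpha> \<beta>
  proof (rule ccontr)
    assume "\<not> ?thesis"
    hence "\<alpha> \<noteq> 0 \<or> \<beta> \<noteq> 0" by blast
    hence "\<exists>a b g. red p' = smult a g \<and> red q' = smult b g"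
    proof
      assume "\<alpha> \<noteq> 0"
      have "smult \<alpha> (red p') = smult (- \<beta>) (red q')" using rel by (simp add: eq_neg_iff_add_eq_0)
      hence "smult (inverse \<alpha>) (smult \<alpha> (red p')) = smult (inverse \<alpha>) (smult (- \<beta>) (red q'))" by simp
      hence "red p' = smult (inverse \<alpha> * - \<beta>) (red q')" using \<open>\<alpha> \<noteq> 0\<close> by simp
      thus ?thesis by (intro exI[of _ "inverse \<alpha> * - \<beta>"] exI[of _ 1] exI[of _ "red q'"]) simp
    next
      assume "\<beta> \<noteq> 0"
      have "smult \<beta> (red q') = smult (- \<alpha>) (red p')" using rel
        by (simp add: eq_neg_iff_add_eq_0 add.commute)
      hence "smult (inverse \<beta>) (smult \<beta> (red q')) = smult (inverse \<beta>) (smult (- \<alpha>) (red p'))" by simp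
      hence "red q' = smult (inverse \<beta> * - \<alpha>) (red p')" using \<open>\<beta> \<noteq> 0\<close> by simp
      thus ?thesis by (intro exI[of _ "inverse \<beta> * - \<alpha>"] exI[of _ 1] exI[of _ "red p'"]) simp
    qed
    then obtain a b g where abg: "red p' = smult a g" "red q' = smult b g" by blast
    have "red p' \<noteq> 0 \<or> red q' \<noteq> 0" using C(4) by (simp only: p'_def q'_def)
    hence nz: "g \<noteq> 0" "a \<noteq> 0 \<or> b \<noteq> 0" unfolding abg by auto
    \<comment> \<open>If the two reductions are proportional, \<open>p' - u q'\<close> reduces to a
      multiple of \<open>g\<close>. It is nonzero for the good values \<open>u\<close>, and at most
      one value is bad.\<close>
    define good where "good u \<longleftrightarrow> a - res u * b \<noteq> 0" for u
    have bad_unique: "u = u'" if "u \<in> U" "u' \<in> U" "\<not> good u" "\<not> good u'" for u u'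
    proof (rule U_inj)
      have *: "a = res u * b" "a = res u' * b" using that by (simp_all add: good_def)
      hence "b \<noteq> 0" using nz(2) by auto
      moreover have "res u * b = res u' * b" using * by metis
      ultimately show "res u = res u'" by simp
    qed (use that in auto)
    have red_u: "red (p' - smult u q') = smult (a - res u * b) g" if "u \<in> U" for u
      using int U(1)[OF that] abg
      by (simp add: red_diff red_smult integral_polys_smult smult_diff_left)
    have int_u: "p' - smult u q' \<in> integral_polys" if "u \<in> U" for u
      using int U(1)[OF that] by (intro integral_polys_diff integral_polys_smult)
    \<comment> \<open>After the substitution the closest pair sits at 0 and 1, and at least one of
      its two values is good.\<close>
    have "\<exists>w \<tau>. w \<in> U \<and> good w \<and> \<tau> \<in> R \<and> s + c * \<tau> \<in> L w"
    proof (cases "good u0")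
      case True
      thus ?thesis using u01(1,4) by (intro exI[of _ u0] exI[of _ 0]) simp
    next
      case False
      hence "good u1" using bad_unique[OF u01(1,2) False] u01(3) by argo
      thus ?thesis using u01(2,5) by (intro exI[of _ u1] exI[of _ 1]) (simp add: u01(6))
    qed
    then obtain w \<tau> where w: "w \<in> U" "good w" "\<tau> \<in> R" "s + c * \<tau> \<in> L w" by blast
    \<comment> \<open>A second good value exists, since at most one of the two values other than
      \<open>w\<close> is bad.\<close>
    have "\<exists>v\<in>U. \<exists>v'\<in>U. v \<noteq> w \<and> v' \<noteq> w \<and> v \<noteq> v'"
      using w(1) neq neq[symmetric] unfolding U_def
      by (elim insertE emptyE)
        (auto intro: bexI[of _ 0] bexI[of _ 1] bexI[of _ "- 1"])
    then obtain v v' where v: "v \<in> U" "v' \<in> U" "v \<noteq> w" "v' \<noteq> w" "v \<noteq> v'" by blast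
    hence "\<exists>w'\<in>U. good w' \<and> w' \<noteq> w"
      using bad_unique[OF v(1,2)] by (cases "good v") auto
    then obtain w' where w': "w' \<in> U" "good w'" "w' \<noteq> w" by blast
    \<comment> \<open>The zero \<open>\<tau>\<close> for \<open>w\<close> reduces to a zero of
      \<open>g\<close>, hence to a zero of the reduction for \<open>w'\<close> as well. This lifts
      to a point \<open>\<beta>'\<close> of another fibre with the same residue as
      \<open>\<tau>\<close>, closer to it than the minimal distance \<open>c\<close> allows.\<close>
    have "res (poly (p' - smult w q') \<tau>) = poly (smult (a - res w * b) g) (res \<tau>)"
      using integral_poly_mem(2)[OF int_u[OF w(1)] w(3)] red_u[OF w(1)] by simp
    hence "poly g (res \<tau>) = 0" using root[of w \<tau>] w by (simp add: good_def)
    hence "poly (red (p' - smult w' q')) (res \<tau>) = 0" using red_u[OF w'(1)] by simp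
    moreover have "red (p' - smult w' q') \<noteq> 0" using red_u[OF w'(1)] w'(2) nz(1) by (simp add: good_def)
    ultimately obtain \<beta>' where \<beta>': "\<beta>' \<in> R" "poly (p' - smult w' q') \<beta>' = 0" "res \<beta>' = res \<tau>"
      using root_lift[OF int_u[OF w'(1)]] by blast
    have mem: "s + c * \<beta>' \<in> L w'" using \<beta>'(2) root by blast
    have "\<beta>' \<noteq> \<tau>" using disj[OF mem] w(4) w'(3) by blast
    have "(s + c * \<beta>') - (s + c * \<tau>) \<in> D" using D_I[OF w(1) w'(1) _ w(4) mem] w'(3) by blast
    from c(2)[OF this] have "c / (c * (\<beta>' - \<tau>)) \<in> R" by (simp add: algebra_simps)
    hence "inverse (\<beta>' - \<tau>) \<in> R" using c(3) by (simp add: inverse_eq_divide)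
    moreover have "\<beta>' - \<tau> \<in> R" "res (\<beta>' - \<tau>) = 0" using \<beta>' w by (auto simp: diff_mem res_diff)
    ultimately have "res ((\<beta>' - \<tau>) * inverse (\<beta>' - \<tau>)) = 0" by (simp add: res_mult)
    thus False using \<open>\<beta>' \<noteq> \<tau>\<close> by simp
  qed
  show ?thesis
    using that[of c C s] c(3) C(1) int independent by (simp add: p'_def q'_def P_def Q_def)
qed

end

section \<open>Rational parametrizations\<close>

text \<open>Makes gcds and unique factorization available for the polynomial rings over algebraic
  closures.\<close>

instance alg_closure :: (field) field_gcd ..

lemma eval2_id: "eval2 id g x y = poly (poly g [:y:]) x"
proof -
  have "map_poly (map_poly id) g = g"
    by (intro poly_eqI) (simp add: coeff_map_poly)
  thus ?thesis by (simp add: eval2_def)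
qed

lemma ring_graph_poly:
  assumes "ring_graph \<Phi>" "poly_graph \<Phi> f g" "(x, a) \<in> \<Phi>"
  shows "(poly f x, poly g a) \<in> \<Phi>"
proof -
  define n where "n = max (degree f) (degree g)"
  show ?thesis
    unfolding poly_altdef_le[of f n x, unfolded n_def, OF max.cobounded1, folded n_def]
      poly_altdef_le[of g n a, unfolded n_def, OF max.cobounded2, folded n_def]
    using assms(2,3)
    by (intro ring_graph_sum[OF assms(1)] ring_graph_mult[OF assms(1)] ring_graph_power[OF assms(1)])
      (auto simp: poly_graph_def)
qed

lemma ring_graph_eval2:
  assumes \<Phi>: "ring_graph \<Phi>" and h: "\<And>c. (h c, h' c) \<in> \<Phi>" "h 0 = 0" "h' 0 = 0"
    and x: "(x, a) \<in> \<Phi>" and y: "(y, b) \<in> \<Phi>"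
  shows "(eval2 h G x y, eval2 h' G a b) \<in> \<Phi>"
proof -
  define M where "M = map_poly (map_poly h) G"
  define M' where "M' = map_poly (map_poly h') G"
  define n where "n = max (degree M) (degree M')"
  have pg: "poly_graph \<Phi> (coeff M i) (coeff M' i)" for i
    by (auto simp: poly_graph_def M_def M'_def coeff_map_poly h)
  have eq: "poly (poly f [:z:]) w = (\<Sum>i\<le>n. poly (coeff f i) w * z ^ i)"
    if "degree f \<le> n" for f :: "'r::comm_ring_1 poly poly" and z w
    unfolding poly_altdef_le[OF that] by (simp add: poly_sum)
  show ?thesis
    unfolding eval2_def M_def[symmetric] M'_def[symmetric]
    by (subst (1 2) eq) (auto simp: n_def intro!: ring_graph_sum[OF \<Phi>] ring_graph_mult[OF \<Phi>]
        ring_graph_power[OF \<Phi>] ring_graph_poly[OF \<Phi>] x y pg)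
qed

text \<open>Elimination of the outer variable. An element \<open>d\<close> of least outer degree in
  the ideal of \<open>f\<close> and \<open>g\<close> is the candidate; pseudo-division replaces
  division over the fraction field of the coefficients.\<close>

lemma prime_elem_elimination:
  fixes f g :: "'a::idom poly poly"
  assumes f: "prime_elem f" and "\<not> f dvd g"
  obtains a b c where "c \<noteq> 0" "a * f + b * g = [:c:]"
proof (cases "degree f = 0")
  case True
  then obtain c where c: "f = [:c:]" by (elim degree_eq_zeroE)
  moreover have "f \<noteq> 0" using f by (auto simp: prime_elem_def)
  ultimately show ?thesis using that[of c 1 0] by auto
next
  case False
  define I where "I = {d. d \<noteq> 0 \<and> (\<exists>a b. d = a * f + b * g)}"
  have f_nz: "f \<noteq> 0" using False by auto
  have "f \<in> I" using f_nz unfolding I_def by (auto intro: exI[of _ 1] exI[of _ 0])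
  define d where "d = arg_min degree (\<lambda>d. d \<in> I)"
  have d: "d \<in> I" and min: "\<And>d'. d' \<in> I \<Longrightarrow> degree d \<le> degree d'"
    using arg_min_nat_lemma[of "\<lambda>d. d \<in> I" f degree] \<open>f \<in> I\<close> by (auto simp: d_def)
  then obtain a b where ab: "d = a * f + b * g" and d_nz: "d \<noteq> 0" by (auto simp: I_def)
  define l where "l = lead_coeff d"
  have l: "l \<noteq> 0" using d_nz by (simp add: l_def)
  \<comment> \<open>Up to a power of the leading coefficient of \<open>d\<close>, each element of
    the ideal is a multiple of \<open>d\<close>: the pseudo-remainder lies in the ideal and has
    smaller degree.\<close>
  have div: "\<exists>k w. smult (l ^ k) u = d * w" if u: "u = a' * f + b' * g" for u a' b'
  proof -
    obtain w r where wr: "pseudo_divmod u d = (w, r)" by fastforce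
    define k where "k = Suc (degree u) - degree d"
    have eq: "smult (l ^ k) u = d * w + r" and deg: "r = 0 \<or> degree r < degree d"
      using pseudo_divmod[OF d_nz wr] by (simp_all add: l_def k_def)
    have "r = (smult (l ^ k) a' - w * a) * f + (smult (l ^ k) b' - w * b) * g"
      using eq unfolding u ab by (simp add: algebra_simps smult_add_right)
    hence "r \<noteq> 0 \<Longrightarrow> r \<in> I" unfolding I_def by blast
    hence "r = 0" using deg min[of r] by force
    with eq show ?thesis by auto
  qed
  obtain k w where kw: "smult (l ^ k) f = d * w" using div[of f 1 0] by auto
  obtain k' w' where kw': "smult (l ^ k') g = d * w'" using div[of g 0 1] by auto
  have "f dvd smult (l ^ k) f" by (simp add: dvd_smult)
  hence "f dvd d * w" using kw by simp
  \<comment> \<open>If the prime \<open>f\<close> divided \<open>d\<close>, it would divide a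
    polynomial free of the outer variable times \<open>g\<close>, which is excluded. So it divides
    \<open>w\<close>, and cancelling \<open>f\<close> shows that \<open>d\<close> divides a nonzero
    constant in the outer variable.\<close>
  hence "f dvd d \<or> f dvd w" using f by (rule prime_elem_dvd_multD[rotated])
  thus ?thesis
  proof
    assume "f dvd d"
    hence "f dvd [:l ^ k':] * g" using kw' by simp
    hence "f dvd [:l ^ k':] \<or> f dvd g" using f by (rule prime_elem_dvd_multD[rotated])
    hence "f dvd [:l ^ k':]" using assms(2) by blast
    hence "degree f \<le> degree [:l ^ k':]" using l by (intro dvd_imp_degree_le) auto
    thus ?thesis using False by simp
  next
    assume "f dvd w"
    then obtain v where v: "w = f * v" by (elim dvdE)
    have "f * [:l ^ k:] = f * (d * v)" using kw by (simp add: v mult_ac)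
    hence "[:l ^ k:] = d * v" by (rule mult_left_cancel[THEN iffD1, OF f_nz])
    hence "d dvd [:l ^ k:]" by simp
    hence "degree d \<le> degree [:l ^ k:]" using l by (intro dvd_imp_degree_le) auto
    then obtain c where "d = [:c:]" by (auto elim: degree_eq_zeroE)
    thus ?thesis using that[of c a b] ab d_nz by auto
  qed
qed

text \<open>A fibre consists of zeros of \<open>p - \<xi> q\<close>. It can be infinite only if
  \<open>p = \<xi> q\<close>, and then coprimality makes both polynomials constant.\<close>

lemma infinite_cofinite_image:
  fixes p q :: "'a::field_char_0 poly"
  assumes "q \<noteq> 0" "coprime p q" "degree p > 0 \<or> degree q > 0" "finite (- T)"
    "\<And>t. t \<in> T \<Longrightarrow> poly q t \<noteq> 0"
  shows "infinite ((\<lambda>t. poly p t / poly q t) ` T)"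
proof
  assume "finite ((\<lambda>t. poly p t / poly q t) ` T)"
  moreover have "infinite T" using assms(4) infinite_UNIV_char_0 finite_compl by blast
  ultimately obtain t0 where t0: "t0 \<in> T" "infinite {t \<in> T. poly p t / poly q t = poly p t0 / poly q t0}"
    using pigeonhole_infinite by blast
  define \<xi> where "\<xi> = poly p t0 / poly q t0"
  have "{t \<in> T. poly p t / poly q t = \<xi>} \<subseteq> {t. poly (p - smult \<xi> q) t = 0}"
    using assms(5) by (auto simp: field_simps)
  hence "infinite {t. poly (p - smult \<xi> q) t = 0}"
    using t0(2) finite_subset unfolding \<xi>_def by blast
  hence "p - smult \<xi> q = 0" using poly_roots_finite by blast
  hence p: "p = smult \<xi> q" by simp
  hence "q dvd p" by (simp add: dvd_smult)
  hence "is_unit q" using assms(2) by (metis coprime_common_divisor dvd_refl)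
  hence "degree q = 0" by (simp add: is_unit_iff_degree assms(1))
  thus False using p assms(3) by (simp split: if_splits)
qed

text \<open>The vanishing ideal of the parametrized curve is generated by \<open>f\<close>. If the
  first coordinate is not constant, a polynomial \<open>g\<close> outside this ideal would yield, by
  elimination, a nonzero polynomial in \<open>x\<close> alone with infinitely many zeros. Otherwise
  the curve is a vertical line.\<close>

lemma dvd_of_vanishing_on_parametrization:
  fixes f g :: "'a::{alg_closed_field,field_gcd,field_char_0} poly poly"
  assumes f: "irreducible f" and q: "q1 \<noteq> 0" "q2 \<noteq> 0" "coprime p1 q1" "coprime p2 q2"
    and nonconst: "(degree p1 > 0 \<or> degree q1 > 0) \<or> (degree p2 > 0 \<or> degree q2 > 0)"
    and T: "finite (- T)" "\<And>t. t \<in> T \<Longrightarrow> poly q1 t \<noteq> 0 \<and> poly q2 t \<noteq> 0"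
    and van: "\<And>t. t \<in> T \<Longrightarrow> eval2 id f (poly p1 t / poly q1 t) (poly p2 t / poly q2 t) = 0"
      "\<And>t. t \<in> T \<Longrightarrow> eval2 id g (poly p1 t / poly q1 t) (poly p2 t / poly q2 t) = 0"
  shows "f dvd g"
proof (cases "degree p1 > 0 \<or> degree q1 > 0")
  case True
  show ?thesis
  proof (rule ccontr)
    assume "\<not> f dvd g"
    moreover have "prime_elem f" using f by (rule irreducible_imp_prime_elem)
    ultimately obtain a b c where c: "c \<noteq> 0" "a * f + b * g = [:c:]"
      using prime_elem_elimination by blast
    have "poly c (poly p1 t / poly q1 t) = 0" if "t \<in> T" for t
      using arg_cong[OF c(2), of "\<lambda>g. eval2 id g (poly p1 t / poly q1 t) (poly p2 t / poly q2 t)"]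
        van[OF that] by (simp add: eval2_id)
    hence "(\<lambda>t. poly p1 t / poly q1 t) ` T \<subseteq> {z. poly c z = 0}" by blast
    hence "finite ((\<lambda>t. poly p1 t / poly q1 t) ` T)"
      using poly_roots_finite[OF c(1)] finite_subset by blast
    thus False using infinite_cofinite_image[OF q(1,3) True T(1)] T(2) by blast
  qed
next
  case False
  obtain \<alpha> \<beta> where ab: "p1 = [:\<alpha>:]" "q1 = [:\<beta>:]"
    using False by (metis degree_eq_zeroE neq0_conv)
  define \<xi> where "\<xi> = \<alpha> / \<beta>"
  \<comment> \<open>The second coordinate takes infinitely many values, so each polynomial vanishing
    on the curve is divisible by \<open>x - \<xi>\<close>. This holds for the irreducible
    \<open>f\<close> in particular, which is therefore an associate of
    \<open>x - \<xi>\<close>.\<close>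
  have dvd: "[:[:- \<xi>, 1:]:] dvd h"
    if "\<And>t. t \<in> T \<Longrightarrow> eval2 id h (poly p1 t / poly q1 t) (poly p2 t / poly q2 t) = 0" for h
  proof -
    define h' where "h' = map_poly (\<lambda>c. poly c \<xi>) h"
    have h': "poly h' y = eval2 id h \<xi> y" for y
    proof -
      have "degree h' \<le> degree h" unfolding h'_def by (intro degree_le) (auto simp: coeff_map_poly coeff_eq_0)
      thus ?thesis
        unfolding eval2_id poly_altdef[of h] poly_sum by (subst poly_altdef_le) (auto simp: h'_def coeff_map_poly)
    qed
    have "(\<lambda>t. poly p2 t / poly q2 t) ` T \<subseteq> {y. poly h' y = 0}"
      using that by (auto simp: h' \<xi>_def ab)
    moreover have "infinite ((\<lambda>t. poly p2 t / poly q2 t) ` T)"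
    proof (rule infinite_cofinite_image[OF q(2,4) _ T(1)])
      show "degree p2 > 0 \<or> degree q2 > 0" using False nonconst by argo
    qed (use T(2) in simp)
    ultimately have "h' = 0" using poly_roots_finite finite_subset by blast
    hence "poly (coeff h i) \<xi> = 0" for i
      by (metis coeff_0 coeff_map_poly h'_def poly_0)
    hence "[:- \<xi>, 1:] dvd coeff h i" for i by (simp add: poly_eq_0_iff_dvd)
    thus ?thesis by (simp add: const_poly_dvd_iff)
  qed
  have "\<not> is_unit [:[:- \<xi>, 1:]:]"
    by (auto simp: is_unit_const_poly_iff is_unit_iff_degree)
  hence "f dvd [:[:- \<xi>, 1:]:]"
    using dvd[OF van(1)] f by (metis irreducibleD' dvd_refl)
  thus ?thesis using dvd[OF van(2)] dvd_trans by blast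
qed

section \<open>Points of a parametrized curve and places of the field of rational functions\<close>

lemma poly_to_fract_X:
  "poly (map_poly (\<lambda>c. to_fract [:c:]) a) (to_fract [:0, 1:]) = to_fract (a :: 'a::field poly)"
proof (induction a)
  case (pCons c a)
  have "map_poly (\<lambda>c. to_fract [:c:]) (pCons c a) = pCons (to_fract [:c:]) (map_poly (\<lambda>c. to_fract [:c:]) a)"
    by (rule poly_eqI) (auto simp: coeff_map_poly coeff_pCons split: nat.splits)
  hence "poly (map_poly (\<lambda>c. to_fract [:c:]) (pCons c a)) (to_fract [:0, 1:]) =
    to_fract ([:c:] + [:0, 1:] * a)"
    using pCons.IH by (simp only: poly_pCons to_fract_add to_fract_mult)
  also have "[:c:] + [:0, 1:] * a = pCons c a" by simp
  finally show ?case .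
qed auto

lemma comm_ring_hom_const_fract: "comm_ring_hom (\<lambda>c. to_fract [:c :: 'a::field:])"
  by unfold_locales (simp_all flip: to_fract_add to_fract_mult to_fract_1 add: one_pCons)

lemma eval2_hom:
  assumes "comm_ring_hom h"
  shows "eval2 h (F - G) x y = eval2 h F x y - eval2 h G x y"
    "eval2 h (F * G) x y = eval2 h F x y * eval2 h G x y"
    "eval2 h 1 x y = 1"
proof -
  interpret h: comm_ring_hom h by fact
  interpret m: map_poly_comm_ring_hom h ..
  interpret mm: map_poly_comm_ring_hom "map_poly h" ..
  show "eval2 h (F - G) x y = eval2 h F x y - eval2 h G x y"
    "eval2 h (F * G) x y = eval2 h F x y * eval2 h G x y"
    "eval2 h 1 x y = 1"
    by (simp_all add: eval2_def mm.hom_minus mm.hom_mult mm.hom_one)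
qed

text \<open>The condition \<open>\<psi> w \<noteq> 0\<close> on a denominator implies \<open>\<phi> w \<noteq> 0\<close>.\<close>

lemma ring_graph_fractions:
  fixes \<phi> :: "'a::comm_ring_1 \<Rightarrow> 'e::field" and \<psi> :: "'a \<Rightarrow> 'k::field"
  assumes \<phi>: "comm_ring_hom \<phi>" and \<psi>: "comm_ring_hom \<psi>" and ker: "\<And>u. \<phi> u = 0 \<Longrightarrow> \<psi> u = 0"
  shows "ring_graph {(\<phi> u / \<phi> w, \<psi> u / \<psi> w) | u w. \<psi> w \<noteq> 0}" (is "ring_graph ?\<Phi>")
proof -
  interpret \<phi>: comm_ring_hom \<phi> by fact
  interpret \<psi>: comm_ring_hom \<psi> by fact
  have I: "(\<phi> u / \<phi> w, \<psi> u / \<psi> w) \<in> ?\<Phi>" if "\<psi> w \<noteq> 0" for u w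
    using that by blast
  show ?thesis
    unfolding ring_graph_def
  proof (intro conjI allI impI)
    show "(1, 1) \<in> ?\<Phi>" using I[of 1 1] by simp
  next
    fix x a y b assume "(x, a) \<in> ?\<Phi>" "(y, b) \<in> ?\<Phi>"
    then obtain u w u' w' where *: "\<psi> w \<noteq> 0" "\<psi> w' \<noteq> 0"
      "x = \<phi> u / \<phi> w" "a = \<psi> u / \<psi> w" "y = \<phi> u' / \<phi> w'" "b = \<psi> u' / \<psi> w'" by auto
    have nz: "\<phi> w \<noteq> 0" "\<phi> w' \<noteq> 0" using ker *(1,2) by blast+
    have "x - y = \<phi> (u * w' - u' * w) / \<phi> (w * w')" "x * y = \<phi> (u * u') / \<phi> (w * w')"
      "a - b = \<psi> (u * w' - u' * w) / \<psi> (w * w')" "a * b = \<psi> (u * u') / \<psi> (w * w')"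
      unfolding *(3-6) using *(1,2) nz
      by (simp_all add: \<phi>.hom_mult \<phi>.hom_minus \<psi>.hom_mult \<psi>.hom_minus diff_frac_eq)
    moreover have "\<psi> (w * w') \<noteq> 0" using * by (simp add: \<psi>.hom_mult)
    ultimately show "(x - y, a - b) \<in> ?\<Phi>" "(x * y, a * b) \<in> ?\<Phi>"
      using I[of "w * w'" "u * w' - u' * w"] I[of "w * w'" "u * u'"] by simp_all
  next
    fix a assume "(0, a) \<in> ?\<Phi>"
    then obtain u w where *: "\<psi> w \<noteq> 0" "0 = \<phi> u / \<phi> w" "a = \<psi> u / \<psi> w" by auto
    hence "\<phi> u = 0" using ker by auto
    thus "a = 0" using ker *(3) by simp
  qed
qed

text \<open>
  A point of the curve defines a place of \<open>k(t)\<close>; either \<open>t\<close> has a finite value there,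
  which is then a parameter of the point, or \<open>t\<close> is infinite, which determines the point.
\<close>

lemma point_at_place:
  fixes p q :: "'a::alg_closed_field poly"
  assumes "place R res" and const: "\<And>c. to_fract [:c:] \<in> R \<and> res (to_fract [:c:]) = c"
    and q: "q \<noteq> 0" "coprime p q"
    and x: "to_fract p / to_fract q \<in> R" "res (to_fract p / to_fract q) = x"
  shows "to_fract [:0, 1:] \<in> R \<Longrightarrow>
      poly q (res (to_fract [:0, 1:])) \<noteq> 0 \<and>
      x = poly p (res (to_fract [:0, 1:])) / poly q (res (to_fract [:0, 1:]))" (is "_ \<Longrightarrow> ?fin")
    and "to_fract [:0, 1:] \<notin> R \<Longrightarrow>
      x = coeff p (max (degree p) (degree q)) / coeff q (max (degree p) (degree q))" (is "_ \<Longrightarrow> ?inf")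
proof -
  interpret place R res by fact
  define T where "T = (to_fract [:0, 1:] :: 'a poly fract)"
  define em where "em = map_poly (\<lambda>c::'a. to_fract [:c:])"
  have em: "em a \<in> integral_polys" "red (em a) = a" for a
    by (auto simp: em_def integral_polys_def coeff_map_poly const poly_eq_iff)
  have emT: "poly (em a) T = to_fract a" for a
    by (simp add: em_def T_def poly_to_fract_X)
  {
    assume "to_fract [:0, 1:] \<in> R"
    hence T: "T \<in> R" by (simp add: T_def)
    have val: "to_fract a \<in> R" "res (to_fract a) = poly a (res T)" for a
      using integral_poly_mem[OF em(1) T, of a] em(2)[of a] by (simp_all add: emT)
    have "poly p (res T) = res (to_fract p / to_fract q * to_fract q)"
      using val(2)[of p] q(1) by simp
    also have "\<dots> = x * poly q (res T)"
      using res_mult[OF x(1) val(1)[of q]] val(2)[of q] x(2) by simp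
    finally have "poly p (res T) = x * poly q (res T)" .
    \<comment> \<open>By the equation just shown, a vanishing denominator would force the numerator
      to vanish too.\<close>
    moreover have "poly q (res T) \<noteq> 0 \<or> poly p (res T) \<noteq> 0"
      using coprime_poly_0[OF q(2)] by blast
    ultimately show ?fin by (auto simp flip: T_def)
  }
  {
    assume "to_fract [:0, 1:] \<notin> R"
    hence T: "inverse T \<in> R" "res (inverse T) = 0" using res_inverse_eq_0[of T] by (auto simp: T_def)
    have T_nz: "inverse T \<noteq> 0" by (simp add: T_def)
    \<comment> \<open>Since \<open>1/T\<close> has residue 0, a polynomial in \<open>T\<close> of
      degree at most \<open>n\<close>, divided by \<open>T ^ n\<close>, reduces to its coefficient
      of degree \<open>n\<close>. As \<open>n\<close> is the larger degree, this is nonzero for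
      \<open>p\<close> or for \<open>q\<close>.\<close>
    define n where "n = max (degree p) (degree q)"
    have val: "inverse T ^ n * to_fract a \<in> R \<and> res (inverse T ^ n * to_fract a) = coeff a n"
      if "degree a \<le> n" for a
    proof -
      have "degree (em a) \<le> n" using that unfolding em_def by (intro degree_le) (auto simp: coeff_map_poly coeff_eq_0)
      from poly_inverse_scaled[OF T_nz this]
      have *: "inverse T ^ n * to_fract a = (\<Sum>i\<le>n. coeff (em a) i * inverse T ^ (n - i))"
        by (simp add: emT)
      have R: "coeff (em a) i * inverse T ^ (n - i) \<in> R" for i
        using integral_polysD[OF em(1)] T by (intro mult_mem power_mem)
      have ca: "res (coeff (em a) i) = coeff a i" for i using em(2)[of a] by (metis coeff_red)
      have "res (coeff (em a) i * inverse T ^ (n - i)) = coeff a i * 0 ^ (n - i)" for i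
        using res_mult[OF integral_polysD[OF em(1)] power_mem[OF T(1)]] res_power[OF T(1)] T(2) ca
        by simp
      hence "res (\<Sum>i\<le>n. coeff (em a) i * inverse T ^ (n - i)) =
        (\<Sum>i\<le>n. coeff a i * 0 ^ (n - i))"
        using res_sum[of "{..n}" "\<lambda>i. coeff (em a) i * inverse T ^ (n - i)"] R by simp
      also have "\<dots> = (\<Sum>i\<le>n. if i = n then coeff a i else 0)"
        by (intro sum.cong) (auto simp: power_0_left)
      finally have "res (\<Sum>i\<le>n. coeff (em a) i * inverse T ^ (n - i)) = coeff a n"
        by simp
      thus ?thesis unfolding * using R by (blast intro: sum_mem)
    qed
    have n: "degree p \<le> n" "degree q \<le> n" by (simp_all add: n_def)
    have "inverse T ^ n * to_fract p = (to_fract p / to_fract q) * (inverse T ^ n * to_fract q)"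
      using q by simp
    hence "coeff p n = res ((to_fract p / to_fract q) * (inverse T ^ n * to_fract q))"
      using val[OF n(1)] by metis
    also have "\<dots> = x * coeff q n"
      using res_mult[OF x(1)] val[OF n(2)] x(2) by metis
    finally have "coeff p n = x * coeff q n" .
    moreover have "coeff q n \<noteq> 0 \<or> coeff p n \<noteq> 0"
      using q(1) by (cases "degree p \<le> degree q") (auto simp: n_def max_def)
    ultimately show ?inf by (auto simp flip: n_def)
  }
qed

text \<open>Evaluation at a point of the curve is a homomorphism on the coordinate ring, which the
  parametrization embeds into the rational functions in \<open>t\<close>. It extends to a place of
  that field, and the value of \<open>t\<close> there is a parameter of the point; only the point
  where \<open>t\<close> is infinite can be missed.\<close>

lemma rational_parametrizationI:
  fixes f :: "'a::{alg_closed_field,field_gcd,field_char_0} poly poly"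
  assumes f: "irreducible f" and q: "q1 \<noteq> 0" "q2 \<noteq> 0" "coprime p1 q1" "coprime p2 q2"
    and nonconst: "(degree p1 > 0 \<or> degree q1 > 0) \<or> (degree p2 > 0 \<or> degree q2 > 0)"
    and fin: "finite {t. poly q1 t \<noteq> 0 \<and> poly q2 t \<noteq> 0 \<and>
      eval2 id f (poly p1 t / poly q1 t) (poly p2 t / poly q2 t) \<noteq> 0}" (is "finite ?bad")
  shows "rational_parametrization f p1 q1 p2 q2"
proof -
  define T where "T = {t. poly q1 t \<noteq> 0 \<and> poly q2 t \<noteq> 0 \<and>
      eval2 id f (poly p1 t / poly q1 t) (poly p2 t / poly q2 t) = 0}"
  have "- T \<subseteq> ?bad \<union>
      {t. poly q1 t = 0} \<union> {t. poly q2 t = 0}"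
    by (auto simp: T_def)
  hence T: "finite (- T)"
    using fin poly_roots_finite[OF q(1)] poly_roots_finite[OF q(2)] finite_subset by blast
  define \<kappa> where "\<kappa> = (\<lambda>c::'a. to_fract [:c:])"
  interpret \<kappa>: comm_ring_hom \<kappa> unfolding \<kappa>_def by (rule comm_ring_hom_const_fract)
  have \<kappa>: "comm_ring_hom \<kappa>" by unfold_locales
  define Xf where "Xf = to_fract p1 / to_fract q1"
  define Yf where "Yf = to_fract p2 / to_fract q2"
  \<comment> \<open>The kernel of the map to rational functions is generated by \<open>f\<close>: an
    identity between rational functions holds at every \<open>t\<close> where the denominators do
    not vanish.\<close>
  have dvd: "f dvd g" if "eval2 \<kappa> g Xf Yf = 0" for g
  proof (rule dvd_of_vanishing_on_parametrization[OF f q nonconst T])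
    fix t assume t: "t \<in> T"
    show "poly q1 t \<noteq> 0 \<and> poly q2 t \<noteq> 0"
      "eval2 id f (poly p1 t / poly q1 t) (poly p2 t / poly q2 t) = 0"
      using t by (auto simp: T_def)
    define \<Psi> where "\<Psi> = {(to_fract a / to_fract b, poly a t / poly b t) | a b. poly b t \<noteq> 0}"
    have \<Psi>: "ring_graph \<Psi>"
      unfolding \<Psi>_def by (rule ring_graph_fractions) (unfold_locales, simp_all)
    have in_\<Psi>: "(to_fract a / to_fract b, poly a t / poly b t) \<in> \<Psi>" if "poly b t \<noteq> 0" for a b
      using that by (auto simp: \<Psi>_def)
    have c: "(\<kappa> c, id c) \<in> \<Psi>" for c using in_\<Psi>[of 1 "[:c:]"] by (simp add: \<kappa>_def)
    have "(Xf, poly p1 t / poly q1 t) \<in> \<Psi>" "(Yf, poly p2 t / poly q2 t) \<in> \<Psi>"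
      using t in_\<Psi> by (auto simp: Xf_def Yf_def T_def)
    from ring_graph_eval2[where h = \<kappa> and h' = id, OF \<Psi> c \<kappa>.hom_zero id_apply this, of g]
    show "eval2 id g (poly p1 t / poly q1 t) (poly p2 t / poly q2 t) = 0"
      using that ring_graph_zeroD[OF \<Psi>] by simp
  qed
  define n1 where "n1 = max (degree p1) (degree q1)"
  define n2 where "n2 = max (degree p2) (degree q2)"
  have missing: "(x, y) = (coeff p1 n1 / coeff q1 n1, coeff p2 n2 / coeff q2 n2)"
    if van: "eval2 id f x y = 0" and miss: "\<not> (\<exists>t. poly q1 t \<noteq> 0 \<and> poly q2 t \<noteq> 0 \<and>
      x = poly p1 t / poly q1 t \<and> y = poly p2 t / poly q2 t)" for x y
  proof -
    \<comment> \<open>Single-valued because of the kernel: if \<open>g\<close> vanishes as a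
      rational function, it is a multiple of \<open>f\<close> and vanishes at
      \<open>(x, y)\<close>.\<close>
    define \<Phi> where "\<Phi> = {(eval2 \<kappa> g Xf Yf, eval2 id g x y) | g. True}"
    have id: "comm_ring_hom (id :: 'a \<Rightarrow> 'a)" by unfold_locales auto
    have in_\<Phi>: "(eval2 \<kappa> g Xf Yf, eval2 id g x y) \<in> \<Phi>" for g by (auto simp: \<Phi>_def)
    have "ring_graph \<Phi>"
      unfolding ring_graph_def
    proof (intro conjI allI impI)
      show "(1, 1) \<in> \<Phi>" using in_\<Phi>[of 1] by (simp add: eval2_hom[OF \<kappa>] eval2_hom[OF id])
    next
      fix a b c d assume "(a, b) \<in> \<Phi>" "(c, d) \<in> \<Phi>"
      then obtain g h where "a = eval2 \<kappa> g Xf Yf" "b = eval2 id g x y"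
        "c = eval2 \<kappa> h Xf Yf" "d = eval2 id h x y" by (auto simp: \<Phi>_def)
      thus "(a - c, b - d) \<in> \<Phi>" "(a * c, b * d) \<in> \<Phi>"
        using in_\<Phi>[of "g - h"] in_\<Phi>[of "g * h"] by (simp_all add: eval2_hom[OF \<kappa>] eval2_hom[OF id])
    next
      fix b assume "(0, b) \<in> \<Phi>"
      then obtain g where g: "eval2 \<kappa> g Xf Yf = 0" "b = eval2 id g x y" by (auto simp: \<Phi>_def)
      then obtain w where "g = f * w" using dvd by blast
      thus "b = 0" using van g(2) by (simp add: eval2_hom[OF id])
    qed
    then obtain R and res :: "'a poly fract \<Rightarrow> 'a" where R: "place R res"
      and mem: "\<And>u a. (u, a) \<in> \<Phi> \<Longrightarrow> u \<in> R \<and> res u = a"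
      using place_extension by blast
    have mp: "map_poly (map_poly \<kappa>) [:[:c:]:] = [:[:\<kappa> c:]:]" "map_poly (map_poly \<kappa>) [:[:0, 1:]:] = [:[:0, 1:]:]"
      "map_poly (map_poly \<kappa>) [:0, 1:] = [:0, 1:]" for c
      by (auto simp: poly_eq_iff coeff_map_poly coeff_pCons one_pCons split: nat.splits)
    have c: "to_fract [:c:] \<in> R \<and> res (to_fract [:c:]) = c" for c
      using mem[OF in_\<Phi>[of "[:[:c:]:]"]] unfolding eval2_id by (simp add: eval2_def mp) (simp add: \<kappa>_def)
    have Xf: "Xf \<in> R" "res Xf = x"
      using mem[OF in_\<Phi>[of "[:[:0, 1:]:]"]] unfolding eval2_id by (simp_all add: eval2_def mp)
    have Yf: "Yf \<in> R" "res Yf = y"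
      using mem[OF in_\<Phi>[of "[:0, 1:]"]] unfolding eval2_id by (simp_all add: eval2_def mp)
    note x = point_at_place[OF R c q(1,3) Xf(1)[unfolded Xf_def] Xf(2)[unfolded Xf_def]]
    note y = point_at_place[OF R c q(2,4) Yf(1)[unfolded Yf_def] Yf(2)[unfolded Yf_def]]
    have "to_fract [:0, 1:] \<notin> R" using x(1) y(1) miss by blast
    thus ?thesis using x(2) y(2) by (simp add: n1_def n2_def)
  qed
  let ?missing = "{(x, y). eval2 id f x y = 0 \<and> \<not> (\<exists>t. poly q1 t \<noteq> 0 \<and> poly q2 t \<noteq> 0 \<and>
       x = poly p1 t / poly q1 t \<and> y = poly p2 t / poly q2 t)}"
  have "?missing \<subseteq>
     {(coeff p1 n1 / coeff q1 n1, coeff p2 n2 / coeff q2 n2)}"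
    using missing by auto
  hence "finite ?missing"
    using finite_subset by blast
  thus ?thesis unfolding rational_parametrization_def using q fin by blast
qed

text \<open>Allows fractions that are not reduced. The parameters where an original denominator
  vanishes are finitely many, and the reduced fractions may violate the equation only there.\<close>

lemma rational_curveI:
  fixes f :: "'a::{alg_closed_field,field_gcd,field_char_0} poly poly"
  assumes f: "irreducible f" and nz: "b \<noteq> 0" "d \<noteq> 0"
    and nonconst: "\<And>\<xi> \<eta>. \<not> (a = smult \<xi> b \<and> c = smult \<eta> d)"
    and van: "\<And>t. poly b t \<noteq> 0 \<Longrightarrow> poly d t \<noteq> 0 \<Longrightarrow>
      eval2 id f (poly a t / poly b t) (poly c t / poly d t) = 0"
  shows "rational_curve f"
proof -
  obtain p1 q1 where 1: "a = p1 * gcd a b" "b = q1 * gcd a b" "coprime p1 q1"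
    using gcd_coprime_exists[of a b] nz by auto
  obtain p2 q2 where 2: "c = p2 * gcd c d" "d = q2 * gcd c d" "coprime p2 q2"
    using gcd_coprime_exists[of c d] nz by auto
  have q: "q1 \<noteq> 0" "q2 \<noteq> 0" using 1(2) 2(2) nz by auto
  have "rational_parametrization f p1 q1 p2 q2"
  proof (rule rational_parametrizationI[OF f q 1(3) 2(3)])
    show "(degree p1 > 0 \<or> degree q1 > 0) \<or> (degree p2 > 0 \<or> degree q2 > 0)"
    proof (rule ccontr)
      assume "\<not> ?thesis"
      hence deg: "degree p1 = 0" "degree q1 = 0" "degree p2 = 0" "degree q2 = 0" by auto
      obtain \<alpha>1 where a1: "p1 = [:\<alpha>1:]" using deg(1) by (rule degree_eq_zeroE)
      obtain \<beta>1 where b1: "q1 = [:\<beta>1:]" using deg(2) by (rule degree_eq_zeroE)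
      obtain \<alpha>2 where a2: "p2 = [:\<alpha>2:]" using deg(3) by (rule degree_eq_zeroE)
      obtain \<beta>2 where b2: "q2 = [:\<beta>2:]" using deg(4) by (rule degree_eq_zeroE)
      have "a = smult (\<alpha>1 / \<beta>1) b"
        using q(1) 1(1) by (subst 1(2)) (simp add: a1 b1)
      moreover have "c = smult (\<alpha>2 / \<beta>2) d"
        using q(2) 2(1) by (subst 2(2)) (simp add: a2 b2)
      ultimately show False using nonconst by blast
    qed
  next
    have "{t. poly q1 t \<noteq> 0 \<and> poly q2 t \<noteq> 0 \<and>
      eval2 id f (poly p1 t / poly q1 t) (poly p2 t / poly q2 t) \<noteq> 0} \<subseteq>
      {t. poly b t = 0} \<union> {t. poly d t = 0}"
    proof (rule subsetI, rule ccontr)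
      fix t
      assume *: "t \<in> {t. poly q1 t \<noteq> 0 \<and> poly q2 t \<noteq> 0 \<and>
        eval2 id f (poly p1 t / poly q1 t) (poly p2 t / poly q2 t) \<noteq> 0}"
        "t \<notin> {t. poly b t = 0} \<union> {t. poly d t = 0}"
      have b: "poly a t = poly p1 t * poly (gcd a b) t" "poly b t = poly q1 t * poly (gcd a b) t"
        using arg_cong[OF 1(1), of "\<lambda>p. poly p t"] arg_cong[OF 1(2), of "\<lambda>p. poly p t"] by simp_all
      have d: "poly c t = poly p2 t * poly (gcd c d) t" "poly d t = poly q2 t * poly (gcd c d) t"
        using arg_cong[OF 2(1), of "\<lambda>p. poly p t"] arg_cong[OF 2(2), of "\<lambda>p. poly p t"] by simp_all
      have nz: "poly b t \<noteq> 0" "poly d t \<noteq> 0" using * by auto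
      have "poly a t / poly b t = poly p1 t / poly q1 t" using nz(1) unfolding b by auto
      moreover have "poly c t / poly d t = poly p2 t / poly q2 t" using nz(2) unfolding d by auto
      ultimately show False using van[OF nz] * by simp
    qed
    thus "finite {t. poly q1 t \<noteq> 0 \<and> poly q2 t \<noteq> 0 \<and>
      eval2 id f (poly p1 t / poly q1 t) (poly p2 t / poly q2 t) \<noteq> 0}"
      using poly_roots_finite[OF nz(1)] poly_roots_finite[OF nz(2)] finite_subset by blast
  qed
  thus ?thesis by (auto simp: rational_curve_def)
qed

section \<open>Degenerations of rational curves\<close>

text \<open>The homogenization of \<open>G\<close> to degree \<open>d\<close>, as a function of its
  three arguments. The number \<open>d\<close> is independent of the degree of \<open>G\<close>, so
  that it can be kept when the coefficients are changed by a homomorphism.\<close>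

definition form_eval ::
    "('a::zero \<Rightarrow> 'b::comm_ring_1) \<Rightarrow> nat \<Rightarrow> 'a poly poly \<Rightarrow> 'b \<Rightarrow> 'b \<Rightarrow> 'b \<Rightarrow> 'b" where
  "form_eval h d G x y z =
     (\<Sum>i\<le>d. \<Sum>j\<le>d - i. h (coeff (coeff G j) i) * x ^ i * y ^ j * z ^ (d - i - j))"

lemma form_eval_scale: "form_eval h d G (c * x) (c * y) (c * z) = c ^ d * form_eval h d G x y z"
proof -
  have "a * (c * x) ^ i * (c * y) ^ j * (c * z) ^ (d - i - j) = c ^ d * (a * x ^ i * y ^ j * z ^ (d - i - j))"
    if "i \<le> d" "j \<le> d - i" for a i j
  proof -
    have "c ^ d = c ^ i * c ^ j * c ^ (d - i - j)" using that by (simp flip: power_add)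
    thus ?thesis by (simp add: power_mult_distrib mult_ac)
  qed
  thus ?thesis unfolding form_eval_def sum_distrib_left by (intro sum.cong) auto
qed

lemma eval2_eq_form_eval:
  fixes G :: "'a::zero poly poly"
  assumes deg: "\<And>i j. d < i + j \<Longrightarrow> coeff (coeff G j) i = 0" and h: "h 0 = 0"
  shows "eval2 h G x y = form_eval h d G x y 1"
proof -
  define M where "M = map_poly (map_poly h) G"
  have cM: "coeff (coeff M j) i = h (coeff (coeff G j) i)" for i j
    by (simp add: M_def coeff_map_poly h)
  have dM: "degree M \<le> d"
    using deg by (intro degree_le allI impI poly_eqI) (simp add: cM h)
  have dM': "degree (coeff M j) \<le> d" for j
    using deg by (intro degree_le allI impI) (simp add: cM h)
  have "eval2 h G x y = (\<Sum>j\<le>d. \<Sum>i\<le>d. h (coeff (coeff G j) i) * x ^ i * y ^ j)"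
    unfolding eval2_def M_def[symmetric] poly_altdef_le[OF dM]
    by (simp add: poly_sum poly_altdef_le[OF dM'] cM sum_distrib_right)
  also have "\<dots> = (\<Sum>i\<le>d. \<Sum>j\<le>d. h (coeff (coeff G j) i) * x ^ i * y ^ j)"
    by (rule sum.swap)
  also have "\<dots> = form_eval h d G x y 1"
    unfolding form_eval_def
  proof (rule sum.cong[OF refl])
    fix i assume "i \<in> {..d}"
    have "(\<Sum>j\<le>d. h (coeff (coeff G j) i) * x ^ i * y ^ j) =
      (\<Sum>j\<le>d - i. h (coeff (coeff G j) i) * x ^ i * y ^ j)"
    proof (intro sum.mono_neutral_right ballI)
      fix j assume "j \<in> {..d} - {..d - i}"
      hence "d < i + j" using \<open>i \<in> {..d}\<close> by auto
      thus "h (coeff (coeff G j) i) * x ^ i * y ^ j = 0" using deg by (simp add: h)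
    qed auto
    thus "(\<Sum>j\<le>d. h (coeff (coeff G j) i) * x ^ i * y ^ j) =
      (\<Sum>j\<le>d - i. h (coeff (coeff G j) i) * x ^ i * y ^ j * 1 ^ (d - i - j))" by simp
  qed
  finally show ?thesis .
qed

lemma form_eval_eq_eval2:
  fixes G :: "'a::zero poly poly" and x y z :: "'b::field"
  assumes deg: "\<And>i j. d < i + j \<Longrightarrow> coeff (coeff G j) i = 0" and h: "h 0 = 0" and z: "z \<noteq> 0"
  shows "form_eval h d G x y z = z ^ d * eval2 h G (x / z) (y / z)"
proof -
  have "form_eval h d G x y z = form_eval h d G (z * (x / z)) (z * (y / z)) (z * 1)" using z by simp
  thus ?thesis unfolding form_eval_scale using eval2_eq_form_eval[of d G h, OF deg h] by simp
qed

lemma form_eval_z_0: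
  "form_eval h d G x y 0 = (\<Sum>i\<le>d. h (coeff (coeff G (d - i)) i) * x ^ i * y ^ (d - i))"
  unfolding form_eval_def
proof (intro sum.cong refl)
  fix i assume "i \<in> {..d}"
  have "(\<Sum>j\<le>d - i. h (coeff (coeff G j) i) * x ^ i * y ^ j * 0 ^ (d - i - j)) =
    (\<Sum>j\<le>d - i. if j = d - i then h (coeff (coeff G j) i) * x ^ i * y ^ j else 0)"
    by (intro sum.cong) (auto simp: power_0_left)
  thus "(\<Sum>j\<le>d - i. h (coeff (coeff G j) i) * x ^ i * y ^ j * 0 ^ (d - i - j)) =
    h (coeff (coeff G (d - i)) i) * x ^ i * y ^ (d - i)" by simp
qed

lemma poly_form_eval:
  "poly (form_eval (\<lambda>c. [:h c:]) d G p q r) t = form_eval h d G (poly p t) (poly q t) (poly r t)"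
  by (simp add: form_eval_def poly_sum mult.assoc)

lemma pcompose_form_eval:
  "pcompose (form_eval (\<lambda>c. [:h c:]) d G p q r) s =
     form_eval (\<lambda>c. [:h c:]) d G (pcompose p s) (pcompose q s) (pcompose r s)"
proof -
  have pw: "pcompose (u ^ n) s = pcompose u s ^ n" for u n
    by (induction n) (simp_all add: pcompose_mult pcompose_1)
  show ?thesis by (simp add: form_eval_def pcompose_sum pcompose_mult pcompose_smult pw)
qed

text \<open>On the line through \<open>(e, 0)\<close> with direction \<open>(c, 1)\<close>, the
  coefficient of degree \<open>d\<close> is the form of highest degree evaluated at the direction.
  If it is nonzero and \<open>d\<close> is positive, the line meets the affine curve over an
  algebraically closed field.\<close>

lemma coeff_top_form_eval_line:
  fixes G :: "'a::comm_ring_1 poly poly"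
  shows "coeff (form_eval (\<lambda>c. [:c:]) d G [:e, c:] [:0, 1:] 1) d = form_eval id d G c 1 0"
proof -
  have *: "coeff ([:a:] * [:e, c:] ^ i * [:0, 1:] ^ j * 1 ^ (d - i - j)) d = (if j = d - i then a * c ^ i else 0)"
    if "i \<le> d" "j \<le> d - i" for i j and a :: 'a
  proof -
    have "[:0, 1:] ^ j = monom (1::'a) j" by (simp add: monom_altdef)
    hence "coeff ([:a:] * [:e, c:] ^ i * [:0, 1:] ^ j * 1 ^ (d - i - j)) d = a * coeff ([:e, c:] ^ i) (d - j)"
      using that by (simp add: coeff_monom_mult mult.commute[of _ "monom _ _"])
    moreover have "degree ([:e, c:] ^ i) \<le> i"
      by (rule order.trans[OF degree_power_le]) (simp add: degree_pCons_le)
    hence "coeff ([:e, c:] ^ i) (d - j) = 0" if "j \<noteq> d - i"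
      using that \<open>j \<le> d - i\<close> \<open>i \<le> d\<close> by (intro coeff_eq_0) linarith
    moreover have "coeff ([:e, c:] ^ i) i = c ^ i"
      by (subst coeff_linear_poly_power) simp_all
    ultimately show ?thesis using that by auto
  qed
  show ?thesis
    unfolding form_eval_z_0 unfolding form_eval_def coeff_sum
  proof (intro sum.cong refl)
    fix i assume i: "i \<in> {..d}"
    have "(\<Sum>j\<le>d - i. coeff ([:coeff (coeff G j) i:] * [:e, c:] ^ i * [:0, 1:] ^ j * 1 ^ (d - i - j)) d) =
      (\<Sum>j\<le>d - i. if j = d - i then coeff (coeff G j) i * c ^ i else 0)"
      using i by (intro sum.cong refl *) auto
    thus "(\<Sum>j\<le>d - i. coeff ([:coeff (coeff G j) i:] * [:e, c:] ^ i * [:0, 1:] ^ j * 1 ^ (d - i - j)) d) =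
      id (coeff (coeff G (d - i)) i) * c ^ i * 1 ^ (d - i)" by simp
  qed
qed

lemma (in place) red_form_eval:
  assumes G: "\<And>i j. coeff (coeff G j) i \<in> R" "\<And>i j. coeff (coeff G' j) i = res (coeff (coeff G j) i)"
    and int: "p \<in> integral_polys" "q \<in> integral_polys" "r \<in> integral_polys"
  shows "red (form_eval (\<lambda>c. [:c:]) d G p q r) =
     form_eval (\<lambda>c. [:c:]) d G' (red p) (red q) (red r)"
proof -
  have c: "[:a:] \<in> integral_polys" if "a \<in> R" for a
    using that by (intro integral_polys_pCons integral_polys_0)
  have I: "[:coeff (coeff G j) i:] * p ^ i * q ^ j * r ^ (d - i - j) \<in> integral_polys" for i j
    using int by (intro integral_polys_mult integral_polys_power c G(1))
  have "red ([:coeff (coeff G j) i:] * p ^ i * q ^ j * r ^ (d - i - j)) =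
    [:coeff (coeff G' j) i:] * red p ^ i * red q ^ j * red r ^ (d - i - j)" for i j
    using int by (simp only: red_mult red_power integral_polys_mult integral_polys_power red_pCons red_0 c G)
  thus ?thesis
    unfolding form_eval_def using I by (simp add: red_sum integral_polys_sum del: mult_pCons_left)
qed

text \<open>The assumption \<open>top\<close> says that the reduction still has degree
  \<open>d\<close>. The parametrization is written in the coordinates \<open>x - c y\<close> and
  \<open>y\<close>. The first is kept nonconstant by a substitution in \<open>t\<close>; in the
  second, numerator and denominator are normalized separately and the ratio \<open>l\<close> of
  their contents is shown to be integral.\<close>

theorem degenerate_rational_curve:
  fixes G :: "'e::{alg_closed_field,field_gcd,field_char_0} poly poly"
    and res :: "'e \<Rightarrow> 'k::{alg_closed_field,field_gcd,field_char_0}"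
  assumes "place R res"
    and mem: "\<And>i j. coeff (coeff G j) i \<in> R"
    and deg: "\<And>i j. d < i + j \<Longrightarrow> coeff (coeff G j) i = 0"
    and top: "i0 \<le> d" "res (coeff (coeff G (d - i0)) i0) \<noteq> 0"
    and rat: "rational_curve G"
    and irr: "irreducible (map_poly (map_poly res) G)"
  shows "rational_curve (map_poly (map_poly res) G)"
proof -
  interpret alg_place R res using assms(1) by (simp add: alg_place_def)
  define G' where "G' = map_poly (map_poly res) G"
  have G': "coeff (coeff G' j) i = res (coeff (coeff G j) i)" for i j
    by (simp add: G'_def coeff_map_poly)
  have deg': "coeff (coeff G' j) i = 0" if "d < i + j" for i j using deg[OF that] by (simp add: G')
  \<comment> \<open>The reduced form of highest degree at \<open>(c, 1)\<close>, as a polynomial in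
    \<open>c\<close>. It is nonzero, so some natural number is not a root of it; natural numbers lie
    in \<open>R\<close> and are their own residues.\<close>
  define tau where "tau = (\<Sum>i\<le>d. monom (coeff (coeff G' (d - i)) i) i)"
  have tau_poly: "poly tau c = form_eval id d G' c 1 0" for c
    by (simp add: tau_def poly_sum poly_monom form_eval_z_0)
  have "coeff tau i0 \<noteq> 0"
    using top by (simp add: tau_def coeff_sum G')
  hence "finite {c. poly tau c = 0}" by (intro poly_roots_finite) auto
  moreover have "infinite (range (of_nat :: nat \<Rightarrow> 'k))"
    by (simp add: range_inj_infinite inj_of_nat)
  ultimately obtain n where n: "poly tau (of_nat n) \<noteq> 0"
    by (metis (mono_tags, lifting) finite_subset image_subsetI mem_Collect_eq)
  define c where "c = (of_nat n :: 'e)"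
  have c: "c \<in> R" "res c = of_nat n" by (simp_all add: c_def of_nat_mem res_of_nat)
  define e where "e = form_eval id d G c 1 0"
  have "res e = form_eval id d G' (res c) 1 0"
    unfolding e_def form_eval_z_0 using mem c
    by (subst res_sum) (auto simp: res_mult res_power power_mem mult_mem G')
  hence res_e: "res e \<noteq> 0" using n c by (simp add: tau_poly)
  have e: "e \<noteq> 0" using res_e by auto
  have d: "d > 0"
  proof (rule ccontr)
    assume "\<not> d > 0"
    hence d0: "d = 0" by simp
    have "G' = [:[:coeff (coeff G' 0) 0:]:]"
    proof (intro poly_eqI)
      fix i j
      show "coeff (coeff G' j) i = coeff (coeff [:[:coeff (coeff G' 0) 0:]:] j) i"
        using deg'[of i j] d0 by (cases i; cases j) (auto simp: coeff_pCons)
    qed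
    moreover have "coeff (coeff G' 0) 0 \<noteq> 0" using top d0 by (simp add: G')
    ultimately have "is_unit G'" by (metis dvd_field_iff is_unit_const_poly_iff)
    thus False using irr by (simp add: G'_def irreducible_def)
  qed
  obtain p1 q1 p2 q2 where rp: "rational_parametrization G p1 q1 p2 q2"
    using rat by (auto simp: rational_curve_def)
  let ?bad = "{t. poly q1 t \<noteq> 0 \<and> poly q2 t \<noteq> 0 \<and>
       eval2 id G (poly p1 t / poly q1 t) (poly p2 t / poly q2 t) \<noteq> 0}"
  let ?missing = "{(x, y). eval2 id G x y = 0 \<and>
       \<not> (\<exists>t. poly q1 t \<noteq> 0 \<and> poly q2 t \<noteq> 0 \<and>
             x = poly p1 t / poly q1 t \<and> y = poly p2 t / poly q2 t)}"
  have q: "q1 \<noteq> 0" "q2 \<noteq> 0" and fin1: "finite ?bad" and fin2: "finite ?missing"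
    using rp
    by (auto simp: rational_parametrization_def)
  define K where "K = (\<lambda>c::'e. [:c:])"
  define K' where "K' = (\<lambda>c::'k. [:c:])"
  \<comment> \<open>A common denominator: the moving point has the coordinates
    \<open>(a + c v0) / w\<close> and \<open>v0 / w\<close>, so that \<open>a / w\<close> is
    \<open>x - c y\<close>.\<close>
  define w where "w = q1 * q2"
  define v0 where "v0 = p2 * q1"
  define a where "a = p1 * q2 - smult c v0"
  have w: "w \<noteq> 0" using q by (simp add: w_def)
  have N: "form_eval K d G (a + smult c v0) v0 w = 0"
  proof (rule ccontr)
    assume nz: "form_eval K d G (a + smult c v0) v0 w \<noteq> 0"
    have "UNIV \<subseteq> ?bad \<union> {t. poly w t = 0} \<union>
       {t. poly (form_eval K d G (a + smult c v0) v0 w) t = 0}"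
    proof
      fix t
      have "poly (form_eval K d G (a + smult c v0) v0 w) t = 0"
        if "poly w t \<noteq> 0" "eval2 id G (poly p1 t / poly q1 t) (poly p2 t / poly q2 t) = 0"
      proof -
        have wt: "poly q1 t \<noteq> 0" "poly q2 t \<noteq> 0" using that(1) by (auto simp: w_def)
        have "poly (a + smult c v0) t / poly w t = poly p1 t / poly q1 t"
          "poly v0 t / poly w t = poly p2 t / poly q2 t"
          using wt by (simp_all add: a_def v0_def w_def)
        hence "form_eval id d G (poly (a + smult c v0) t) (poly v0 t) (poly w t) = 0"
          using form_eval_eq_eval2[of d G id "poly w t", OF deg _ that(1)] that(2) by simp
        thus ?thesis unfolding K_def by (subst poly_form_eval[where h = "\<lambda>c. c"]) (simp add: id_def)
      qed
      thus "t \<in> ?bad \<union> {t. poly w t = 0} \<union>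
       {t. poly (form_eval K d G (a + smult c v0) v0 w) t = 0}"
        by (auto simp: w_def)
    qed
    hence "finite (UNIV :: 'e set)"
      using fin1 poly_roots_finite[OF w] poly_roots_finite[OF nz] finite_subset by blast
    thus False using infinite_UNIV_char_0 by blast
  qed
  obtain g p r where g: "g \<noteq> 0" and pr: "a = p * g" "w = r * g" "coprime p r"
  proof -
    obtain p r where "a = p * gcd a w" "w = r * gcd a w" "coprime p r"
      using gcd_coprime_exists[of a w] w by auto
    thus ?thesis using that[of "gcd a w" p r] w by simp
  qed
  have r: "r \<noteq> 0" using pr(2) w by auto
  \<comment> \<open>If \<open>x - c y\<close> were a constant \<open>\<xi>\<close>, the
    parametrization would stay on one line. But each line \<open>x - c y = z\<close> contains a
    point of the curve, so infinitely many points would be missed.\<close>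
  have nonconst: "degree p > 0 \<or> degree r > 0"
  proof (rule ccontr)
    assume "\<not> ?thesis"
    hence deg0: "degree p = 0" "degree r = 0" by auto
    obtain \<alpha> where \<alpha>: "p = [:\<alpha>:]" using deg0(1) by (rule degree_eq_zeroE)
    obtain \<beta> where \<beta>: "r = [:\<beta>:]" using deg0(2) by (rule degree_eq_zeroE)
    define \<xi> where "\<xi> = \<alpha> / \<beta>"
    have "\<beta> \<noteq> 0" using r \<beta> by auto
    hence aw: "a = smult \<xi> w" unfolding \<xi>_def pr(1,2) by (simp add: \<alpha> \<beta>)
    have "\<exists>y. eval2 id G (z + c * y) y = 0" for z
    proof -
      define L where "L = form_eval K d G [:z, c:] [:0, 1:] 1"
      have "coeff L d = e" using coeff_top_form_eval_line[of d G z c] by (simp add: L_def K_def e_def)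
      hence "degree L \<ge> d" using e by (intro le_degree) auto
      then obtain y where "poly L y = 0" using alg_closed_imp_poly_has_root[of L] d by auto
      hence "form_eval id d G (z + c * y) y 1 = 0"
        unfolding L_def K_def by (subst (asm) poly_form_eval[where h = "\<lambda>c. c"]) (simp add: id_def mult.commute)
      thus ?thesis using eval2_eq_form_eval[of d G id "z + c * y" y, OF deg] by (intro exI[of _ y]) simp
    qed
    hence "\<exists>y. \<forall>z. eval2 id G (z + c * y z) (y z) = 0" by (intro choice) blast
    then obtain y where "\<forall>z. eval2 id G (z + c * y z) (y z) = 0" ..
    hence y: "eval2 id G (z + c * y z) (y z) = 0" for z by blast
    have "(\<lambda>z. (z + c * y z, y z)) ` (UNIV - {\<xi>}) \<subseteq> ?missing"
    proof (rule image_subsetI)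
      fix z assume z: "z \<in> UNIV - {\<xi>}"
      have no_t: False if t: "poly q1 t \<noteq> 0" "poly q2 t \<noteq> 0"
        "z + c * y z = poly p1 t / poly q1 t" "y z = poly p2 t / poly q2 t" for t
      proof -
        have "z = poly p1 t / poly q1 t - c * (poly p2 t / poly q2 t)" using t(3,4) by (simp add: algebra_simps)
        also have "\<dots> = poly a t / poly w t"
          using t(1,2) by (simp add: a_def v0_def w_def diff_divide_distrib)
        also have "\<dots> = \<xi>" using t(1,2) by (simp add: aw) (simp add: w_def)
        finally show False using z by simp
      qed
      thus "(z + c * y z, y z) \<in> ?missing"
        unfolding mem_Collect_eq case_prod_conv using y[of z] no_t by metis
    qed
    hence "finite ((\<lambda>z. (z + c * y z, y z)) ` (UNIV - {\<xi>}))" using fin2 by (rule finite_subset)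
    moreover have "inj_on (\<lambda>z. (z + c * y z, y z)) (UNIV - {\<xi>})" by (rule inj_onI) auto
    ultimately have "finite (UNIV - {\<xi>})" by (rule finite_imageD)
    hence "finite (UNIV :: 'e set)" by (rule finite_Diff2[THEN iffD1, rotated]) simp
    thus False using infinite_UNIV_char_0 by blast
  qed
  have common: "poly r t \<noteq> 0" if "poly p t = 0" for t
    using coprime_poly_0[OF pr(3), of t] that by blast
  obtain s b C where b: "b \<noteq> 0" "C \<noteq> 0"
    and int: "smult (inverse C) (pcompose p [:s, b:]) \<in> integral_polys"
      "smult (inverse C) (pcompose r [:s, b:]) \<in> integral_polys"
    and indep: "\<And>\<alpha> \<beta>. smult \<alpha> (red (smult (inverse C) (pcompose p [:s, b:]))) +
            smult \<beta> (red (smult (inverse C) (pcompose r [:s, b:]))) = 0 \<Longrightarrow> \<alpha> = 0 \<and> \<beta> = 0"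
  proof (rule nonconstant_reduction[OF common nonconst])
    fix s b C
    assume *: "b \<noteq> 0" "C \<noteq> 0" "smult (inverse C) (pcompose p [:s, b:]) \<in> integral_polys"
      "smult (inverse C) (pcompose r [:s, b:]) \<in> integral_polys"
      "\<And>\<alpha> \<beta>. smult \<alpha> (red (smult (inverse C) (pcompose p [:s, b:]))) +
            smult \<beta> (red (smult (inverse C) (pcompose r [:s, b:]))) = 0 \<Longrightarrow> \<alpha> = 0 \<and> \<beta> = 0"
    show thesis by (rule that[OF *])
  qed
  define \<sigma> where "\<sigma> f = pcompose f [:s, b:]" for f :: "'e poly"
  define p' where "p' = smult (inverse C) (\<sigma> p)"
  define r' where "r' = smult (inverse C) (\<sigma> r)"
  have p': "p' \<in> integral_polys" "\<sigma> p = smult C p'" and r': "r' \<in> integral_polys" "\<sigma> r = smult C r'"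
    using int b by (simp_all add: p'_def r'_def \<sigma>_def)
  have indep': "\<alpha> = 0 \<and> \<beta> = 0" if "smult \<alpha> (red p') + smult \<beta> (red r') = 0" for \<alpha> \<beta>
    using indep that by (simp add: p'_def r'_def \<sigma>_def)
  have red_r': "red r' \<noteq> 0" using indep'[of 0 1] by auto
  have \<sigma>0: "\<sigma> f \<noteq> 0" if "f \<noteq> 0" for f
    using that b(1) by (auto simp: \<sigma>_def pcompose_eq_0_iff)
  \<comment> \<open>Numerator and denominator of \<open>y\<close> are scaled separately, giving
    \<open>y = l u / v\<close> with nonzero reductions of \<open>u\<close> and \<open>v\<close>. For
    \<open>p2 = 0\<close> the choice is \<open>l = 0\<close> and \<open>u = 1\<close>.\<close>
  obtain \<kappa> v where v: "\<kappa> \<noteq> 0" "\<sigma> q2 = smult \<kappa> v" "v \<in> integral_polys" "red v \<noteq> 0"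
    using normalize_poly[OF \<sigma>0[OF q(2)]] .
  have "\<exists>l u. \<sigma> p2 = smult (l * \<kappa>) u \<and> u \<in> integral_polys \<and> red u \<noteq> 0"
  proof (cases "p2 = 0")
    case True
    thus ?thesis
      by (intro exI[of _ 0] exI[of _ 1]) (simp add: \<sigma>_def integral_polys_1 red_1)
  next
    case False
    obtain k u where "k \<noteq> 0" "\<sigma> p2 = smult k u" "u \<in> integral_polys" "red u \<noteq> 0"
      using normalize_poly[OF \<sigma>0[OF False]] .
    thus ?thesis using v(1) by (intro exI[of _ "k / \<kappa>"] exI[of _ u]) simp
  qed
  then obtain l u where u: "\<sigma> p2 = smult (l * \<kappa>) u" "u \<in> integral_polys" "red u \<noteq> 0" by blast
  \<comment> \<open>The equation for the point with \<open>x - c y = p' / r'\<close> and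
    \<open>y = l u / v\<close>, after clearing denominators. The factors \<open>q2\<close>,
    \<open>g\<close> and \<open>C * \<kappa>\<close> are common to the three homogeneous coordinates
    and are inserted or removed by homogeneity.\<close>
  have main: "form_eval K d G (p' * v + smult (c * l) (u * r')) (smult l (u * r')) (r' * v) = 0"
  proof -
    have gp: "a = g * p" "w = g * r" using pr by (simp_all add: mult.commute)
    have "g ^ d * form_eval K d G (p * q2 + smult c (p2 * r)) (p2 * r) (r * q2) =
      form_eval K d G (g * (p * q2 + smult c (p2 * r))) (g * (p2 * r)) (g * (r * q2))"
      by (simp only: form_eval_scale)
    also have "g * (p * q2 + smult c (p2 * r)) = q2 * (a + smult c v0)"
    proof -
      have "g * (p * q2 + smult c (p2 * r)) = (g * p) * q2 + smult c (p2 * (g * r))"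
        by (simp add: algebra_simps)
      also have "\<dots> = q2 * (a + smult c v0)"
        unfolding gp[symmetric] by (simp add: w_def v0_def algebra_simps)
      finally show ?thesis .
    qed
    also have "g * (p2 * r) = q2 * v0"
    proof -
      have "g * (p2 * r) = p2 * (g * r)" by (simp add: algebra_simps)
      thus ?thesis unfolding gp[symmetric] by (simp add: w_def v0_def algebra_simps)
    qed
    also have "g * (r * q2) = q2 * w" by (simp add: gp algebra_simps)
    also have "form_eval K d G (q2 * (a + smult c v0)) (q2 * v0) (q2 * w) = 0"
      unfolding form_eval_scale N by simp
    finally have "form_eval K d G (p * q2 + smult c (p2 * r)) (p2 * r) (r * q2) = 0"
      using g by simp
    from arg_cong[OF this, of \<sigma>]
    have "form_eval K d G (\<sigma> (p * q2 + smult c (p2 * r))) (\<sigma> (p2 * r)) (\<sigma> (r * q2)) = 0"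
      unfolding \<sigma>_def K_def by (subst (asm) pcompose_form_eval[where h = "\<lambda>c. c"]) simp
    also have "\<sigma> (p * q2 + smult c (p2 * r)) = [:C * \<kappa>:] * (p' * v + smult (c * l) (u * r'))"
    proof -
      have "\<sigma> (p * q2 + smult c (p2 * r)) = \<sigma> p * \<sigma> q2 + smult c (\<sigma> p2 * \<sigma> r)"
        by (simp add: \<sigma>_def pcompose_add pcompose_mult pcompose_smult)
      thus ?thesis unfolding p'(2) r'(2) v(2) u(1)
        by (simp add: smult_add_right mult_ac)
    qed
    also have "\<sigma> (p2 * r) = [:C * \<kappa>:] * smult l (u * r')"
    proof -
      have "\<sigma> (p2 * r) = \<sigma> p2 * \<sigma> r" by (simp add: \<sigma>_def pcompose_mult)
      thus ?thesis unfolding r'(2) u(1) by (simp add: mult_ac)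
    qed
    also have "\<sigma> (r * q2) = [:C * \<kappa>:] * (r' * v)"
    proof -
      have "\<sigma> (r * q2) = \<sigma> r * \<sigma> q2" by (simp add: \<sigma>_def pcompose_mult)
      thus ?thesis unfolding r'(2) v(2) by (simp add: mult_ac)
    qed
    finally show ?thesis unfolding form_eval_scale using b(2) v(1) by simp
  qed
  note ints = p'(1) r'(1) u(2) v(3)
  \<comment> \<open>If \<open>l\<close> were infinite, dividing the homogeneous coordinates by
    \<open>l\<close> and reducing would give a multiple of \<open>(c : 1 : 0)\<close>, which the
    choice of \<open>c\<close> keeps off the reduced curve.\<close>
  have "l \<in> R"
  proof (rule ccontr)
    assume l: "l \<notin> R"
    hence m: "inverse l \<in> R" "res (inverse l) = 0" "l \<noteq> 0" using res_inverse_eq_0[OF l] by auto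
    have "form_eval K d G ([:inverse l:] * (p' * v + smult (c * l) (u * r'))) ([:inverse l:] * smult l (u * r'))
      ([:inverse l:] * (r' * v)) = 0"
      unfolding form_eval_scale main by simp
    also have "[:inverse l:] * (p' * v + smult (c * l) (u * r')) = smult (inverse l) (p' * v) + smult c (u * r')"
      using m(3) by (simp add: smult_add_right mult.left_commute[of "inverse l" c l])
    also have "[:inverse l:] * smult l (u * r') = u * r'" using m(3) by simp
    also have "[:inverse l:] * (r' * v) = smult (inverse l) (r' * v)" by simp
    finally have "red (form_eval K d G (smult (inverse l) (p' * v) + smult c (u * r')) (u * r')
      (smult (inverse l) (r' * v))) = red 0" by simp
    hence "form_eval K' d G' (red (smult (inverse l) (p' * v) + smult c (u * r'))) (red (u * r'))
      (red (smult (inverse l) (r' * v))) = 0"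
      unfolding K_def K'_def
      by (subst (asm) red_form_eval[OF mem G'])
        (use ints m c in \<open>auto intro!: integral_polys_add integral_polys_smult integral_polys_mult\<close>)
    moreover have "red (smult (inverse l) (p' * v) + smult c (u * r')) = (red u * red r') * [:res c:]"
      using ints m c by (simp add: red_add red_smult red_mult integral_polys_add integral_polys_smult integral_polys_mult)
    moreover have "red (u * r') = (red u * red r') * 1" using ints by (simp add: red_mult)
    moreover have "red (smult (inverse l) (r' * v)) = (red u * red r') * 0"
      using ints m by (simp add: red_smult integral_polys_mult)
    ultimately have "(red u * red r') ^ d * form_eval K' d G' [:res c:] 1 0 = 0"
      by (simp only: form_eval_scale)
    hence "form_eval K' d G' [:res c:] 1 0 = 0" using u(3) red_r' by simp
    hence "poly (form_eval K' d G' [:res c:] 1 0) 0 = 0" by simp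
    hence "form_eval id d G' (res c) 1 0 = 0"
      unfolding K'_def by (subst (asm) poly_form_eval[where h = "\<lambda>c. c"]) (simp add: id_def)
    thus False using n c by (simp add: tau_poly)
  qed
  define x1 where "x1 = red p' * red v + smult (res c * res l) (red u * red r')"
  define y1 where "y1 = smult (res l) (red u)"
  have red_main: "form_eval K' d G' x1 (y1 * red r') (red r' * red v) = 0"
  proof -
    have "red (form_eval K d G (p' * v + smult (c * l) (u * r')) (smult l (u * r')) (r' * v)) = red 0"
      using main by simp
    hence "form_eval K' d G' (red (p' * v + smult (c * l) (u * r'))) (red (smult l (u * r'))) (red (r' * v)) = 0"
      unfolding K_def K'_def
      by (subst (asm) red_form_eval[OF mem G'])
        (use ints \<open>l \<in> R\<close> c in \<open>auto intro!: integral_polys_add integral_polys_smult integral_polys_mult mult_mem\<close>)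
    moreover have "red (p' * v + smult (c * l) (u * r')) = x1" "red (smult l (u * r')) = y1 * red r'"
      "red (r' * v) = red r' * red v"
      using ints \<open>l \<in> R\<close> c
      by (simp_all add: x1_def y1_def red_add red_smult red_mult res_mult integral_polys_add
          integral_polys_smult integral_polys_mult mult_mem)
    ultimately show ?thesis by simp
  qed
  show ?thesis
    unfolding G'_def[symmetric]
  proof (rule rational_curveI[of G' "red r' * red v" "red v" x1 y1])
    show "irreducible G'" using irr by (simp add: G'_def)
    show "red r' * red v \<noteq> 0" "red v \<noteq> 0" using red_r' v(4) by auto
  next
    fix \<xi> \<eta>
    show "\<not> (x1 = smult \<xi> (red r' * red v) \<and> y1 = smult \<eta> (red v))"
    proof
      \<comment> \<open>If both reduced coordinates were constant, so would be their combination
        \<open>x - c y\<close>, which reduces to \<open>red p' / red r'\<close>.\<close>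
      assume *: "x1 = smult \<xi> (red r' * red v) \<and> y1 = smult \<eta> (red v)"
      have "red v * red p' = x1 - smult (res c) (y1 * red r')"
        by (simp add: x1_def y1_def mult.commute)
      also have "\<dots> = red v * smult (\<xi> - res c * \<eta>) (red r')"
        using * by (simp add: smult_diff_left mult_ac right_diff_distrib)
      finally have "red p' = smult (\<xi> - res c * \<eta>) (red r')" using v(4) by (metis mult_left_cancel)
      hence "smult 1 (red p') + smult (- (\<xi> - res c * \<eta>)) (red r') = 0"
        by (simp only: smult_1_left smult_minus_left right_minus)
      from indep'[OF this] show False by simp
    qed
  next
    fix t assume t: "poly (red r' * red v) t \<noteq> 0" "poly (red v) t \<noteq> 0"
    have "form_eval id d G' (poly x1 t) (poly (y1 * red r') t) (poly (red r' * red v) t) = 0"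
      using arg_cong[OF red_main, of "\<lambda>f. poly f t"] unfolding K'_def
      by (subst (asm) poly_form_eval[where h = "\<lambda>c. c"]) (simp add: id_def)
    hence "eval2 id G' (poly x1 t / poly (red r' * red v) t) (poly (y1 * red r') t / poly (red r' * red v) t) = 0"
      using form_eval_eq_eval2[of d G' id, OF deg' _ t(1)] t(1) by simp
    moreover have "poly (y1 * red r') t / poly (red r' * red v) t = poly y1 t / poly (red v) t"
      using t by simp
    ultimately show "eval2 id G' (poly x1 t / poly (red r' * red v) t) (poly y1 t / poly (red v) t) = 0"
      by simp
  qed
qed

section \<open>Specialization of the parameters\<close>

instance fract :: ("{idom,ring_char_0}") field_char_0
proof
  have "(of_nat n :: 'a fract) = to_fract (of_nat n)" for n
    by (induction n) simp_all
  thus "inj (of_nat :: nat \<Rightarrow> 'a fract)"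
    by (auto simp: inj_on_def)
qed

text \<open>The map out of a monoid algebra given by a map on coefficients and a map on monomials.
  It covers both the evaluation at a point and the grading by total degree.\<close>

definition monoid_eval :: "('k \<Rightarrow> 'r) \<Rightarrow> ('m \<Rightarrow> 'r) \<Rightarrow> ('m \<Rightarrow>\<^sub>0 'k::zero) \<Rightarrow> 'r::comm_ring_1" where
  "monoid_eval h m P = (\<Sum>\<mu>\<in>Poly_Mapping.keys P. h (Poly_Mapping.lookup P \<mu>) * m \<mu>)"

lemma monoid_eval_superset:
  assumes "finite S" "Poly_Mapping.keys P \<subseteq> S" "h 0 = 0"
  shows "monoid_eval h m P = (\<Sum>\<mu>\<in>S. h (Poly_Mapping.lookup P \<mu>) * m \<mu>)"
  unfolding monoid_eval_def using assms
  by (intro sum.mono_neutral_left) (auto simp: in_keys_iff)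

lemma monoid_eval_comm_ring_hom:
  fixes h :: "'k::comm_ring_1 \<Rightarrow> 'r::comm_ring_1" and m :: "'m::comm_monoid_add \<Rightarrow> 'r"
  assumes h: "comm_ring_hom h" and m: "m 0 = 1" "\<And>\<mu> \<nu>. m (\<mu> + \<nu>) = m \<mu> * m \<nu>"
  shows "comm_ring_hom (monoid_eval h m)"
proof -
  interpret h: comm_ring_hom h by fact
  have add: "monoid_eval h m (P + Q) = monoid_eval h m P + monoid_eval h m Q" for P Q
  proof -
    define S where "S = Poly_Mapping.keys P \<union> Poly_Mapping.keys Q"
    have S: "finite S" "Poly_Mapping.keys P \<subseteq> S" "Poly_Mapping.keys Q \<subseteq> S" "Poly_Mapping.keys (P + Q) \<subseteq> S"
      using keys_add[of P Q] by (auto simp: S_def)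
    show ?thesis
      unfolding monoid_eval_superset[of S P h, OF S(1,2) h.hom_zero]
        monoid_eval_superset[of S Q h, OF S(1,3) h.hom_zero]
        monoid_eval_superset[of S "P + Q" h, OF S(1,4) h.hom_zero]
      by (simp add: lookup_add h.hom_add distrib_right sum.distrib)
  qed
  have single: "monoid_eval h m (Poly_Mapping.single \<mu> c) = h c * m \<mu>" for \<mu> c
    by (simp add: monoid_eval_def)
  have zero: "monoid_eval h m 0 = 0" by (simp add: monoid_eval_def)
  have sum: "monoid_eval h m (sum f A) = (\<Sum>x\<in>A. monoid_eval h m (f x))" for f and A :: "'x set"
    by (induction A rule: infinite_finite_induct) (simp_all add: zero add)
  have decomp: "P = (\<Sum>\<mu>\<in>Poly_Mapping.keys P. Poly_Mapping.single \<mu> (Poly_Mapping.lookup P \<mu>))" for P :: "'m \<Rightarrow>\<^sub>0 'k"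
  proof (rule poly_mapping_eqI)
    fix \<nu>
    have "Poly_Mapping.lookup (\<Sum>\<mu>\<in>Poly_Mapping.keys P. Poly_Mapping.single \<mu> (Poly_Mapping.lookup P \<mu>)) \<nu> =
      (\<Sum>\<mu>\<in>Poly_Mapping.keys P. if \<mu> = \<nu> then Poly_Mapping.lookup P \<mu> else 0)"
      by (simp add: lookup_sum lookup_single when_def)
    also have "\<dots> = Poly_Mapping.lookup P \<nu>"
      by (simp add: in_keys_iff)
    finally show "Poly_Mapping.lookup P \<nu> = Poly_Mapping.lookup (\<Sum>\<mu>\<in>Poly_Mapping.keys P. Poly_Mapping.single \<mu> (Poly_Mapping.lookup P \<mu>)) \<nu>" ..
  qed
  have mult: "monoid_eval h m (P * Q) = monoid_eval h m P * monoid_eval h m Q" for P Q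
  proof -
    have "P * Q = (\<Sum>\<mu>\<in>Poly_Mapping.keys P. \<Sum>\<nu>\<in>Poly_Mapping.keys Q.
      Poly_Mapping.single (\<mu> + \<nu>) (Poly_Mapping.lookup P \<mu> * Poly_Mapping.lookup Q \<nu>))"
      by (subst decomp[of P], subst decomp[of Q]) (simp add: sum_product mult_single)
    hence "monoid_eval h m (P * Q) = (\<Sum>\<mu>\<in>Poly_Mapping.keys P. \<Sum>\<nu>\<in>Poly_Mapping.keys Q.
      h (Poly_Mapping.lookup P \<mu> * Poly_Mapping.lookup Q \<nu>) * m (\<mu> + \<nu>))"
      by (simp add: sum single)
    also have "\<dots> = monoid_eval h m P * monoid_eval h m Q"
      unfolding monoid_eval_def sum_product by (simp add: h.hom_mult m mult_ac)
    finally show ?thesis .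
  qed
  have "monoid_eval h m 1 = 1"
    using single[of 0 1] by (simp add: m)
  with add mult zero show ?thesis by unfold_locales
qed

lemma par_eval_hom:
  fixes a :: "'n::finite \<Rightarrow> 'k::field alg_closure"
  shows "comm_ring_hom (par_eval a)"
proof -
  have "par_eval a = monoid_eval to_ac (\<lambda>\<mu>. \<Prod>i\<in>UNIV. a i ^ Poly_Mapping.lookup \<mu> i)"
    by (rule ext) (simp add: par_eval_def monoid_eval_def)
  moreover have "comm_ring_hom (to_ac :: 'k \<Rightarrow> 'k alg_closure)" by unfold_locales simp_all
  ultimately show ?thesis
    by (simp add: monoid_eval_comm_ring_hom lookup_add power_add prod.distrib)
qed

text \<open>Multiplies each parameter by a new variable \<open>s\<close> and reads the result as a
  polynomial in \<open>s\<close>. The total degree becomes the degree in one variable over a domain,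
  where it is additive under multiplication.\<close>

definition grading :: "('n::{finite,linorder}, 'k::field) par \<Rightarrow> ('n, 'k) par poly" where
  "grading = monoid_eval (\<lambda>c. [:Poly_Mapping.single 0 c:])
     (\<lambda>\<mu>. monom (Poly_Mapping.single \<mu> 1) (\<Sum>i\<in>UNIV. Poly_Mapping.lookup \<mu> i))"

lemma grading_hom: "comm_ring_hom (grading :: ('n::{finite,linorder}, 'k::field) par \<Rightarrow> _)"
  unfolding grading_def
proof (rule monoid_eval_comm_ring_hom)
  show "comm_ring_hom (\<lambda>c::'k. [:Poly_Mapping.single (0 :: 'n \<Rightarrow>\<^sub>0 nat) c:])"
    by unfold_locales (simp_all add: single_add mult_single one_pCons mult.commute)
qed (simp_all add: mult_monom mult_single lookup_add sum.distrib one_pCons monom_0)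

lemma lookup_coeff_grading:
  "Poly_Mapping.lookup (coeff (grading P) n) \<mu> =
     (if (\<Sum>i\<in>UNIV. Poly_Mapping.lookup \<mu> i) = n then Poly_Mapping.lookup P \<mu> else 0)"
proof -
  have "coeff (grading P) n = (\<Sum>\<nu>\<in>Poly_Mapping.keys P.
    if (\<Sum>i\<in>UNIV. Poly_Mapping.lookup \<nu> i) = n then Poly_Mapping.single \<nu> (Poly_Mapping.lookup P \<nu>) else 0)"
    unfolding grading_def monoid_eval_def coeff_sum
    by (intro sum.cong refl) (simp add: mult_single)
  hence "Poly_Mapping.lookup (coeff (grading P) n) \<mu> = (\<Sum>\<nu>\<in>Poly_Mapping.keys P.
    if \<nu> = \<mu> then (if (\<Sum>i\<in>UNIV. Poly_Mapping.lookup \<mu> i) = n then Poly_Mapping.lookup P \<mu> else 0) else 0)"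
    by (simp only: lookup_sum) (rule sum.cong[OF refl], auto simp: lookup_single when_def)
  thus ?thesis by (simp add: in_keys_iff)
qed

lemma grading_eq_0_iff: "grading P = 0 \<longleftrightarrow> P = 0"
proof
  assume 0: "grading P = 0"
  show "P = 0"
  proof (rule poly_mapping_eqI)
    fix \<mu>
    show "Poly_Mapping.lookup P \<mu> = Poly_Mapping.lookup 0 \<mu>"
      using lookup_coeff_grading[of P "\<Sum>i\<in>UNIV. Poly_Mapping.lookup \<mu> i" \<mu>] by (simp add: 0)
  qed
qed (simp add: grading_def monoid_eval_def)

lemma is_unit_of_degree_grading:
  fixes P :: "('n::{finite,linorder}, 'k::field) par"
  assumes "degree (grading P) = 0" "P \<noteq> 0"
  shows "P dvd 1"
proof -
  define c where "c = Poly_Mapping.lookup P 0"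
  have "P = Poly_Mapping.single 0 c"
  proof (rule poly_mapping_eqI)
    fix \<mu> :: "'n \<Rightarrow>\<^sub>0 nat"
    show "Poly_Mapping.lookup P \<mu> = Poly_Mapping.lookup (Poly_Mapping.single 0 c) \<mu>"
    proof (cases "\<mu> = 0")
      case True
      thus ?thesis by (simp add: c_def)
    next
      case False
      then obtain i where "Poly_Mapping.lookup \<mu> i \<noteq> 0" by (metis lookup_zero poly_mapping_eqI)
      hence "(\<Sum>i\<in>UNIV. Poly_Mapping.lookup \<mu> i) > 0" by (simp add: sum_pos2[of UNIV i])
      hence "coeff (grading P) (\<Sum>i\<in>UNIV. Poly_Mapping.lookup \<mu> i) = 0"
        using assms(1) by (intro coeff_eq_0) simp
      hence "Poly_Mapping.lookup P \<mu> = 0"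
        using lookup_coeff_grading[of P "\<Sum>i\<in>UNIV. Poly_Mapping.lookup \<mu> i" \<mu>] by simp
      thus ?thesis using False by (simp add: lookup_single)
    qed
  qed
  moreover from this have "c \<noteq> 0" using assms(2) by auto
  ultimately have "P * Poly_Mapping.single 0 (inverse c) = 1" by (simp add: mult_single)
  thus ?thesis by (metis dvd_triv_left)
qed

text \<open>Descent on the total degree of \<open>W\<close>: a common divisor that is not a unit has
  positive degree, because nonzero polynomials of degree 0 are constants and hence units.\<close>

lemma cancel_common_factors:
  fixes W :: "('n::{finite,linorder}, 'k::field) par"
  assumes "W \<noteq> 0"
  obtains c W' U' where "W = c * W'" "U = smult c U'" "trivial_gcd (insert W' (set (coeffs U')))"
  using assms
proof (induction "degree (grading W)" arbitrary: W U thesis rule: less_induct)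
  case less
  interpret grading: comm_ring_hom "grading :: ('n, 'k) par \<Rightarrow> _" by (rule grading_hom)
  show ?case
  proof (cases "trivial_gcd (insert W (set (coeffs U)))")
    case True
    thus ?thesis using less.prems(1)[of 1 W U] by simp
  next
    case False
    then obtain c where c: "c dvd W" "\<And>P. P \<in> set (coeffs U) \<Longrightarrow> c dvd P" "\<not> c dvd 1"
      by (auto simp: trivial_gcd_def)
    obtain W1 where W1: "W = c * W1" using c(1) by (elim dvdE)
    have "c dvd coeff U i" for i using c(2)[of "coeff U i"] by (metis coeff_in_coeffs dvd_0_right le_degree coeff_0)
    hence "[:c:] dvd U" by (simp add: const_poly_dvd_iff)
    then obtain U1 where U1: "U = smult c U1" by (auto elim: dvdE)
    have nz: "c \<noteq> 0" "W1 \<noteq> 0" using W1 less.prems(2) by auto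
    have "degree (grading c) \<noteq> 0" using is_unit_of_degree_grading[of c] nz c(3) by blast
    hence "degree (grading W1) < degree (grading W)"
      using nz by (simp add: W1 grading.hom_mult degree_mult_eq grading_eq_0_iff)
    then obtain c' W' U' where "W1 = c' * W'" "U1 = smult c' U'" "trivial_gcd (insert W' (set (coeffs U')))"
      using less.hyps[of W1 U1] nz(2) by blast
    thus ?thesis using less.prems(1)[of "c * c'" W' U'] W1 U1 by (simp add: mult.assoc)
  qed
qed

text \<open>Shows that the choice in \<open>lowest_terms\<close> can be met: the numerator is
  treated as a constant polynomial in the cancellation of common factors.\<close>

lemma lowest_terms:
  fixes q :: "('n::{finite,linorder}, 'k::field) parfrac"
  shows "frac_den q \<noteq> 0" "q = Fract (frac_num q) (frac_den q)" "trivial_gcd {frac_num q, frac_den q}"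
proof -
  obtain N D where ND: "q = Fract N D" "D \<noteq> 0" by (cases q)
  obtain c D' U' where *: "D = c * D'" "[:N:] = smult c U'" "trivial_gcd (insert D' (set (coeffs U')))"
    using cancel_common_factors[OF ND(2), of "[:N:]"] by blast
  have nz: "c \<noteq> 0" "D' \<noteq> 0" using * ND(2) by auto
  have "degree (smult c U') = 0" unfolding *(2)[symmetric] by simp
  hence "degree U' = 0" using nz by simp
  then obtain N' where N': "U' = [:N':]" by (elim degree_eq_zeroE)
  \<comment> \<open>The list \<open>coeffs [:0:]\<close> is empty, hence the case distinction;
    adding 0 to a set does not change its common divisors.\<close>
  have "trivial_gcd {N', D'}" using *(3) N' by (cases "N' = 0") (auto simp: trivial_gcd_def)
  moreover have "q = Fract N' D'" using *(1,2) nz N' by (simp add: ND(1) eq_fract)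
  ultimately have "\<exists>x. case x of (N, D) \<Rightarrow> D \<noteq> 0 \<and> q = Fract N D \<and> trivial_gcd {N, D}" using nz by blast
  hence "case lowest_terms q of (N, D) \<Rightarrow> D \<noteq> 0 \<and> q = Fract N D \<and> trivial_gcd {N, D}"
    unfolding lowest_terms_def by (rule someI_ex)
  thus "frac_den q \<noteq> 0" "q = Fract (frac_num q) (frac_den q)" "trivial_gcd {frac_num q, frac_den q}"
    by (auto simp: frac_num_def frac_den_def split: prod.splits)
qed

section \<open>Minimal polynomials and canonical representations\<close>

definition ac_eval :: "'l::field alg_closure \<Rightarrow> 'l poly \<Rightarrow> 'l alg_closure" where
  "ac_eval x P = poly (map_poly to_ac P) x"

lemma to_ac_hom: "comm_ring_hom (to_ac :: 'l::field \<Rightarrow> 'l alg_closure)"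
  by unfold_locales simp_all

lemma ac_eval_hom: "comm_ring_hom (ac_eval x)"
proof -
  interpret h: comm_ring_hom "to_ac :: 'a \<Rightarrow> 'a alg_closure" by (rule to_ac_hom)
  interpret m: map_poly_comm_ring_hom "to_ac :: 'a \<Rightarrow> 'a alg_closure" ..
  show ?thesis
    by unfold_locales (simp_all add: ac_eval_def m.hom_add m.hom_mult)
qed

lemma ac_eval_simps [simp]:
  "ac_eval x 0 = 0" "ac_eval x 1 = 1" "ac_eval x (P + Q) = ac_eval x P + ac_eval x Q"
  "ac_eval x (P - Q) = ac_eval x P - ac_eval x Q" "ac_eval x (P * Q) = ac_eval x P * ac_eval x Q"
  "ac_eval x [:c:] = to_ac c" "ac_eval x (pCons c P) = to_ac c + x * ac_eval x P"
  "ac_eval x (smult c P) = to_ac c * ac_eval x P" "ac_eval x (- P) = - ac_eval x P"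
proof -
  interpret h: comm_ring_hom "ac_eval x" by (rule ac_eval_hom)
  show c: "ac_eval x (pCons c P) = to_ac c + x * ac_eval x P" for c P
    by (simp add: ac_eval_def Polynomial.map_poly_pCons)
  show "ac_eval x [:c:] = to_ac c" by (simp add: ac_eval_def Polynomial.map_poly_pCons)
  hence "ac_eval x ([:c:] * P) = to_ac c * ac_eval x P" unfolding h.hom_mult by simp
  thus "ac_eval x (smult c P) = to_ac c * ac_eval x P" by simp
  show "ac_eval x 0 = 0" "ac_eval x 1 = 1" "ac_eval x (P + Q) = ac_eval x P + ac_eval x Q"
  "ac_eval x (P - Q) = ac_eval x P - ac_eval x Q" "ac_eval x (P * Q) = ac_eval x P * ac_eval x Q"
  "ac_eval x (- P) = - ac_eval x P"
    by (simp_all add: h.hom_add h.hom_mult h.hom_minus h.hom_uminus)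
qed

lemma ac_eval_pcompose: "ac_eval x (pcompose P Q) = ac_eval (ac_eval x Q) P"
  by (induction P) (simp_all add: pcompose_pCons)

definition is_min_poly :: "'l::field alg_closure \<Rightarrow> 'l poly \<Rightarrow> bool" where
  "is_min_poly x p \<longleftrightarrow> lead_coeff p = 1 \<and> ac_eval x p = 0 \<and>
     (\<forall>q. q \<noteq> 0 \<and> ac_eval x q = 0 \<longrightarrow> degree p \<le> degree q)"

lemma is_min_poly_dvd:
  assumes p: "is_min_poly x p" and q: "ac_eval x q = 0"
  shows "p dvd q"
proof -
  have nz: "p \<noteq> 0" using p by (auto simp: is_min_poly_def)
  have "q mod p = q - q div p * p" by (simp add: minus_div_mult_eq_mod)
  hence "ac_eval x (q mod p) = 0" using p q by (simp add: is_min_poly_def)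
  moreover have "q mod p = 0 \<or> degree (q mod p) < degree p" using degree_mod_less[OF nz] .
  ultimately have "q mod p = 0" using p by (fastforce simp: is_min_poly_def)
  thus ?thesis by (simp add: dvd_eq_mod_eq_0)
qed

lemma is_min_poly_ex1: "\<exists>!p. is_min_poly x p"
proof -
  obtain q where q: "q \<noteq> 0" "ac_eval x q = 0"
    unfolding ac_eval_def by (rule alg_closure_algebraic)
  define p where "p = arg_min degree (\<lambda>q. q \<noteq> 0 \<and> ac_eval x q = 0)"
  have p: "p \<noteq> 0" "ac_eval x p = 0" "\<And>q. q \<noteq> 0 \<Longrightarrow> ac_eval x q = 0 \<Longrightarrow> degree p \<le> degree q"
    using arg_min_nat_lemma[of "\<lambda>q. q \<noteq> 0 \<and> ac_eval x q = 0" q degree] q by (auto simp: p_def)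
  have m: "is_min_poly x (smult (inverse (lead_coeff p)) p)"
    using p by (simp add: is_min_poly_def)
  moreover have "p1 = p2" if "is_min_poly x p1" "is_min_poly x p2" for p1 p2
  proof -
    have "p1 dvd p2" "p2 dvd p1"
      using that by (auto intro: is_min_poly_dvd simp: is_min_poly_def)
    moreover have "p1 \<noteq> 0" "p2 \<noteq> 0" using that by (auto simp: is_min_poly_def)
    ultimately obtain a where "p2 = p1 * a" "degree p1 = degree p2"
      by (metis dvdE dvd_imp_degree_le dual_order.antisym)
    moreover from this have "degree a = 0" using \<open>p1 \<noteq> 0\<close> \<open>p2 \<noteq> 0\<close>
      by (metis add_cancel_left_right degree_mult_eq mult_zero_right)
    then obtain c where "a = [:c:]" by (elim degree_eq_zeroE)
    ultimately have "p2 = smult c p1" by simp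
    moreover have "lead_coeff p1 = 1" "lead_coeff p2 = 1" using that by (auto simp: is_min_poly_def)
    ultimately have "c = 1" using \<open>p2 = smult c p1\<close> by (cases "c = 0") auto
    thus ?thesis using \<open>p2 = smult c p1\<close> by simp
  qed
  ultimately show ?thesis by blast
qed

lemma min_poly: "is_min_poly \<gamma> (min_poly \<gamma>)"
proof -
  have "min_poly \<gamma> = (THE p. is_min_poly \<gamma> p)"
    by (simp add: min_poly_def is_min_poly_def ac_eval_def)
  thus ?thesis using theI'[OF is_min_poly_ex1[of \<gamma>]] by simp
qed

lemma is_min_poly_degree_pos: "is_min_poly x p \<Longrightarrow> degree p > 0"
proof (rule ccontr)
  assume p: "is_min_poly x p" and "\<not> degree p > 0"
  then obtain c where "p = [:c:]" by (auto elim: degree_eq_zeroE)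
  thus False using p by (auto simp: is_min_poly_def)
qed

lemma ac_eval_eq_0_degree:
  "is_min_poly x p \<Longrightarrow> ac_eval x q = 0 \<Longrightarrow> degree q < degree p \<Longrightarrow> q = 0"
  by (force simp: is_min_poly_def)

lemma ac_eval_mod: "is_min_poly x p \<Longrightarrow> ac_eval x (q mod p) = ac_eval x q"
proof -
  assume p: "is_min_poly x p"
  have "ac_eval x q = ac_eval x (q div p * p + q mod p)" by simp
  thus ?thesis using p unfolding ac_eval_simps by (simp add: is_min_poly_def)
qed

text \<open>The inverse of a nonzero \<open>\<beta> = Q(x)\<close> is read off its minimal
  polynomial: the constant term \<open>r0\<close> is nonzero and
  \<open>\<beta> * r1(\<beta>) = - r0\<close>. So the inverse is a polynomial in
  \<open>\<beta>\<close>, and hence in \<open>x\<close>.\<close>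

lemma ac_eval_inverse: "\<exists>P. inverse (ac_eval x Q) = ac_eval x P"
proof (cases "ac_eval x Q = 0")
  case True
  thus ?thesis by (intro exI[of _ 0]) simp
next
  case False
  define \<beta> where "\<beta> = ac_eval x Q"
  obtain r where r: "is_min_poly \<beta> r" using is_min_poly_ex1 by blast
  obtain r0 r1 where r01: "r = pCons r0 r1" by (cases r)
  have eq: "to_ac r0 + \<beta> * ac_eval \<beta> r1 = 0" using r by (simp add: is_min_poly_def r01)
  have "r0 \<noteq> 0"
  proof
    assume "r0 = 0"
    hence "ac_eval \<beta> r1 = 0" using eq False by (simp add: \<beta>_def)
    moreover have "r1 \<noteq> 0" using r is_min_poly_degree_pos[OF r] by (auto simp: r01)
    ultimately have "degree r \<le> degree r1" using r by (simp add: is_min_poly_def)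
    thus False using \<open>r1 \<noteq> 0\<close> by (simp add: r01)
  qed
  have "\<beta> * ac_eval \<beta> r1 = - to_ac r0" using eq by (simp add: add_eq_0_iff)
  hence "\<beta> * ac_eval \<beta> (smult (- inverse r0) r1) = 1"
    using \<open>r0 \<noteq> 0\<close> by (simp add: mult.left_commute[of \<beta> "inverse (to_ac r0)"])
  hence "inverse \<beta> = ac_eval \<beta> (smult (- inverse r0) r1)"
    by (rule inverse_unique)
  thus ?thesis unfolding \<beta>_def ac_eval_pcompose[symmetric] by blast
qed

lemma clear_denominators:
  fixes P :: "'a::idom fract poly"
  shows "\<exists>W U. W \<noteq> 0 \<and> smult (to_fract W) P = map_poly to_fract U"
proof (induction P)
  case 0
  show ?case by (intro exI[of _ 1] exI[of _ 0]) simp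
next
  case (pCons q P)
  then obtain W U where WU: "W \<noteq> 0" "smult (to_fract W) P = map_poly to_fract U" by blast
  obtain N D where ND: "q = Fract N D" "D \<noteq> 0" by (cases q)
  have "to_fract (D * W) * q = to_fract (W * N)"
    unfolding ND(1) to_fract_def using ND(2) by (simp add: eq_fract)
  moreover have "smult (to_fract (D * W)) P = smult (to_fract D) (smult (to_fract W) P)" by simp
  moreover have "smult (to_fract D) (map_poly to_fract U) = map_poly to_fract (smult D U)"
    by (rule poly_eqI) (simp add: coeff_map_poly)
  ultimately have "smult (to_fract (D * W)) (pCons q P) = map_poly to_fract (pCons (W * N) (smult D U))"
    by (simp only: smult_pCons WU(2) Polynomial.map_poly_pCons[of to_fract, OF to_fract_0])
  moreover have "D * W \<noteq> 0" using WU(1) ND(2) by simp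
  ultimately show ?case by blast
qed

lemma of_par_eq: "of_par P = to_ac (to_fract P)"
  by (simp add: of_par_def to_fract_def)

lemma of_par_hom: "comm_ring_hom of_par"
  by unfold_locales (simp_all add: of_par_eq)

lemma of_par_eq_0_iff [simp]: "of_par P = 0 \<longleftrightarrow> P = 0"
  by (simp add: of_par_eq)

lemma poly_of_par: "poly (map_poly of_par U) x = ac_eval x (map_poly to_fract U)"
proof -
  have "map_poly of_par U = map_poly to_ac (map_poly to_fract U)"
    by (rule poly_eqI) (simp add: coeff_map_poly of_par_eq)
  thus ?thesis by (simp add: ac_eval_def)
qed

lemma ext_field_ac_eval: "f \<in> ext_field \<gamma> \<longleftrightarrow> (\<exists>P. f = ac_eval \<gamma> P)"
proof
  assume "f \<in> ext_field \<gamma>"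
  then obtain P Q where "f = ac_eval \<gamma> P / ac_eval \<gamma> Q"
    by (auto simp: ext_field_def ac_eval_def)
  moreover obtain Q' where "inverse (ac_eval \<gamma> Q) = ac_eval \<gamma> Q'" using ac_eval_inverse by blast
  ultimately have "f = ac_eval \<gamma> (P * Q')" by (simp add: divide_inverse)
  thus "\<exists>P. f = ac_eval \<gamma> P" by blast
next
  assume "\<exists>P. f = ac_eval \<gamma> P"
  then obtain P where "f = ac_eval \<gamma> P / ac_eval \<gamma> 1" by auto
  thus "f \<in> ext_field \<gamma>"
    unfolding ext_field_def ac_eval_def[symmetric] mem_Collect_eq by (intro exI[of _ P] exI[of _ 1]) auto
qed

text \<open>Makes the choice behind \<open>canon_num\<close> and \<open>denom\<close> meaningful:
  reduce modulo the minimal polynomial, clear denominators and cancel common factors. Scaling by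
  nonzero factors keeps the degree below that of the minimal polynomial.\<close>

lemma canonical_exists:
  assumes "f \<in> ext_field \<gamma>"
  shows "canonical \<gamma> f (canon_num \<gamma> f) (denom \<gamma> f)"
proof -
  obtain P0 where P0: "f = ac_eval \<gamma> P0" using assms by (auto simp: ext_field_ac_eval)
  define P where "P = P0 mod min_poly \<gamma>"
  have P: "f = ac_eval \<gamma> P" by (simp add: P_def ac_eval_mod[OF min_poly] P0)
  have pos: "degree (min_poly \<gamma>) > 0" by (rule is_min_poly_degree_pos[OF min_poly])
  have "degree P < degree (min_poly \<gamma>)"
  proof -
    have "min_poly \<gamma> \<noteq> 0" using pos by auto
    from degree_mod_less[OF this, of P0] show ?thesis using pos by (auto simp: P_def)
  qed
  obtain W U where WU: "W \<noteq> 0" "smult (to_fract W) P = map_poly to_fract U"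
    using clear_denominators by blast
  obtain c W' U' where *: "W = c * W'" "U = smult c U'" "trivial_gcd (insert W' (set (coeffs U')))"
    using cancel_common_factors[OF WU(1)] by blast
  have nz: "c \<noteq> 0" "W' \<noteq> 0" using * WU by auto
  have "smult (to_fract c) (smult (to_fract W') P) = smult (to_fract c) (map_poly to_fract U')"
    using WU(2) by (auto simp: * poly_eq_iff coeff_map_poly)
  hence "to_fract c * coeff (smult (to_fract W') P) i = to_fract c * coeff (map_poly to_fract U') i" for i
    by (metis coeff_smult)
  hence eq: "smult (to_fract W') P = map_poly to_fract U'" using nz(1) by (intro poly_eqI) simp
  have "degree (map_poly to_fract U') = degree U'" by (intro degree_map_poly) simp
  moreover have "degree (map_poly to_fract U') = degree P" using nz(2) by (simp flip: eq)
  ultimately have "degree U' < degree (min_poly \<gamma>)" using \<open>degree P < _\<close> by simp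
  moreover have "f = poly (map_poly of_par U') \<gamma> / of_par W'"
    using nz(2) by (simp add: poly_of_par P flip: eq) (simp add: of_par_eq)
  ultimately have "canonical \<gamma> f U' W'" using * nz by (simp add: canonical_def)
  hence "\<exists>x. case x of (U, W) \<Rightarrow> canonical \<gamma> f U W" by blast
  hence "case SOME (U, W). canonical \<gamma> f U W of (U, W) \<Rightarrow> canonical \<gamma> f U W" by (rule someI_ex)
  thus ?thesis by (simp add: canon_num_def denom_def case_prod_beta)
qed

lemma par_ring_subset: "par_ring \<gamma> \<subseteq> ext_field \<gamma>"
  by (auto simp: par_ring_def ext_field_ac_eval poly_of_par)

section \<open>Specialization as a homomorphism on a local ring\<close>

lemma is_lcm_nonvanishing:
  assumes "a \<notin> zero_locus {D. is_lcm S D}" "P \<in> S"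
  shows "par_eval a P \<noteq> 0"
proof -
  interpret par_eval: comm_ring_hom "par_eval a" by (rule par_eval_hom)
  obtain D where "is_lcm S D" "par_eval a D \<noteq> 0" using assms(1) by (auto simp: zero_locus_def)
  moreover from this have "P dvd D" using assms(2) by (simp add: is_lcm_def)
  then obtain E where "D = P * E" by (elim dvdE)
  ultimately show ?thesis by (auto simp: par_eval.hom_mult)
qed

lemma par_eval_unit: "P dvd 1 \<Longrightarrow> par_eval a P \<noteq> 0"
proof -
  interpret par_eval: comm_ring_hom "par_eval a" by (rule par_eval_hom)
  assume "P dvd 1"
  then obtain Q where "1 = P * Q" by (elim dvdE)
  hence "1 = par_eval a P * par_eval a Q" by (metis par_eval.hom_mult par_eval.hom_one)
  thus ?thesis by auto
qed

lemma Fract_eq_divide: "D \<noteq> 0 \<Longrightarrow> Fract N D = to_fract N / to_fract D"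
  by (simp add: to_fract_def)

lemma to_fract_hom: "comm_ring_hom to_fract"
  by unfold_locales simp_all

text \<open>Long division by a monic polynomial never divides coefficients, so the quotient stays
  over the domain of the partial homomorphism.\<close>

lemma poly_graph_quotient:
  fixes p :: "'e::field poly" and pb :: "'k::field poly"
  assumes \<Phi>: "ring_graph \<Phi>" and p: "poly_graph \<Phi> p pb" "lead_coeff p = 1"
  shows "poly_graph \<Phi> (p * q) ub \<Longrightarrow> \<exists>qb. poly_graph \<Phi> q qb"
proof (induction "degree q" arbitrary: q ub rule: less_induct)
  case less
  show ?case
  proof (cases "q = 0")
    case True
    thus ?thesis using poly_graph_0[OF \<Phi>] by blast
  next
    case False
    define n where "n = degree q"
    have "coeff (p * q) (degree p + n) = lead_coeff q"
      using p(2) by (simp add: n_def coeff_mult_degree_sum)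
    hence l: "(lead_coeff q, coeff ub (degree p + n)) \<in> \<Phi>"
      using less.prems by (metis poly_graph_def)
    define s where "s = monom (lead_coeff q) n"
    note m = poly_graph_monom[OF \<Phi> l, of n, folded s_def]
    have "poly_graph \<Phi> (p * (q - s)) (ub - pb * monom (coeff ub (degree p + n)) n)"
      unfolding right_diff_distrib
      by (rule poly_graph_diff[OF \<Phi> less.prems poly_graph_mult[OF \<Phi> p(1) m]])
    moreover have "q - s = 0 \<or> degree (q - s) < degree q"
    proof -
      have "degree (q - s) \<le> degree q" by (intro degree_diff_le) (auto simp: s_def n_def degree_monom_le)
      moreover have "coeff (q - s) (degree q) = 0" by (simp add: s_def n_def)
      ultimately show ?thesis using leading_coeff_0_iff[of "q - s"]
        by (cases "degree (q - s) = degree q") auto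
    qed
    ultimately have "\<exists>qb. poly_graph \<Phi> (q - s) qb"
      using less.hyps[of "q - s"] poly_graph_0[OF \<Phi>] by metis
    then obtain qb where qb: "poly_graph \<Phi> (q - s) qb" by blast
    have "poly_graph \<Phi> ((q - s) - (0 - s)) (qb - (0 - monom (coeff ub (degree p + n)) n))"
      by (intro poly_graph_diff[OF \<Phi>] qb m poly_graph_0[OF \<Phi>])
    thus ?thesis by auto
  qed
qed

text \<open>On \<open>Omega_gen \<gamma>\<close> the denominators of the minimal polynomial do not
  vanish at \<open>a\<close>, so its coefficients lie in the local ring of the point.\<close>

lemma min_poly_graph:
  fixes \<gamma> :: "('n::{finite,linorder}, 'k::field) acl"
  assumes a: "a \<in> Omega_gen \<gamma>"
  shows "poly_graph {(to_fract N / to_fract D, par_eval a N / par_eval a D) | N D. par_eval a D \<noteq> 0}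
     (min_poly \<gamma>) (min_poly_at \<gamma> a)" (is "poly_graph ?\<Phi> _ _")
  unfolding poly_graph_def
proof
  fix i
  interpret par_eval: comm_ring_hom "par_eval a" by (rule par_eval_hom)
  let ?p = "min_poly \<gamma>"
  have frac: "q = to_fract (frac_num q) / to_fract (frac_den q)" for q :: "('n, 'k) parfrac"
    using lowest_terms(1,2)[of q] Fract_eq_divide by metis
  have num_0: "frac_num (0 :: ('n, 'k) parfrac) = 0"
    using frac[of 0] lowest_terms(1)[of "0 :: ('n, 'k) parfrac"] by simp
  have "coeff (min_poly_at \<gamma> a) i = par_eval a (frac_num (coeff ?p i)) / par_eval a (frac_den (coeff ?p i))"
    unfolding min_poly_at_def by (rule coeff_map_poly) (simp add: num_0)
  moreover have "(coeff ?p i, par_eval a (frac_num (coeff ?p i)) / par_eval a (frac_den (coeff ?p i))) \<in> ?\<Phi>"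
  proof (cases "coeff ?p i = 0")
    case True
    have "(to_fract 0 / to_fract 1, par_eval a 0 / par_eval a 1) \<in> ?\<Phi>"
      by (intro CollectI exI[of _ 0] exI[of _ 1]) simp
    thus ?thesis using True by (simp add: num_0)
  next
    case False
    have "par_eval a (frac_den (coeff ?p i)) \<noteq> 0"
    proof (cases "i < degree ?p")
      case True
      have "a \<notin> zero_locus {D. is_lcm ((\<lambda>i. frac_den (coeff ?p i)) ` {..<degree ?p}) D}"
        using a by (simp add: Omega_gen_def)
      thus ?thesis by (rule is_lcm_nonvanishing) (use True in simp)
    next
      \<comment> \<open>The leading coefficient is not covered by the least common multiple. It is
        1, and in lowest terms the denominator of 1 is a unit.\<close>
      case i: False
      with False have "i = degree ?p" by (meson le_degree le_antisym leI)
      hence c1: "coeff ?p i = 1" using min_poly[of \<gamma>] by (simp add: is_min_poly_def)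
      have "to_fract (frac_num (1 :: ('n, 'k) parfrac)) = to_fract (frac_den (1 :: ('n, 'k) parfrac))"
        using frac[of 1] lowest_terms(1)[of "1 :: ('n, 'k) parfrac"] by (simp add: field_simps)
      hence "frac_den (1 :: ('n, 'k) parfrac) dvd 1"
        using lowest_terms(3)[of "1 :: ('n, 'k) parfrac"] by (auto simp: trivial_gcd_def)
      thus ?thesis unfolding c1 by (rule par_eval_unit)
    qed
    thus ?thesis by (intro CollectI exI conjI) (rule prod_eqI, simp_all flip: frac)
  qed
  ultimately show "(coeff ?p i, coeff (min_poly_at \<gamma> a) i) \<in> ?\<Phi>" by simp
qed

text \<open>A polynomial \<open>U\<close> with root \<open>\<gamma>\<close> is a multiple of the
  minimal polynomial, which is monic over the local ring of \<open>a\<close>. The cofactor is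
  therefore defined at \<open>a\<close>, and substituting the root \<open>\<gamma>0\<close> gives
  0.\<close>

lemma specialization_welldefined:
  fixes \<gamma> :: "('n::{finite,linorder}, 'k::field) acl"
  assumes a: "a \<in> Omega_gen \<gamma>" and \<gamma>0: "poly (min_poly_at \<gamma> a) \<gamma>0 = 0"
    and U: "poly (map_poly of_par U) \<gamma> = 0"
  shows "poly (map_poly (par_eval a) U) \<gamma>0 = 0"
proof -
  interpret par_eval: comm_ring_hom "par_eval a" by (rule par_eval_hom)
  define \<Phi> where "\<Phi> = {(to_fract N / to_fract D, par_eval a N / par_eval a D) | N D. par_eval a D \<noteq> 0}"
  have \<Phi>: "ring_graph \<Phi>"
    unfolding \<Phi>_def by (rule ring_graph_fractions[OF to_fract_hom par_eval_hom]) simp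
  note pg = min_poly_graph[OF a, folded \<Phi>_def]
  have ug: "poly_graph \<Phi> (map_poly to_fract U) (map_poly (par_eval a) U)"
    unfolding poly_graph_def
  proof
    fix i
    have "(to_fract (coeff U i) / to_fract 1, par_eval a (coeff U i) / par_eval a 1) \<in> \<Phi>"
      unfolding \<Phi>_def by (intro CollectI exI[of _ "coeff U i"] exI[of _ 1]) simp
    thus "(coeff (map_poly to_fract U) i, coeff (map_poly (par_eval a) U) i) \<in> \<Phi>"
      by (simp add: coeff_map_poly)
  qed
  have "min_poly \<gamma> dvd map_poly to_fract U"
    using U by (intro is_min_poly_dvd[OF min_poly]) (simp add: poly_of_par)
  then obtain q where q: "map_poly to_fract U = min_poly \<gamma> * q" by (elim dvdE)
  have "lead_coeff (min_poly \<gamma>) = 1" using min_poly[of \<gamma>] by (simp add: is_min_poly_def)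
  then obtain qb where "poly_graph \<Phi> q qb"
    using poly_graph_quotient[OF \<Phi> pg _ ug[unfolded q]] by blast
  from poly_graph_mult[OF \<Phi> pg this] have "poly_graph \<Phi> (map_poly to_fract U) (min_poly_at \<gamma> a * qb)"
    by (simp add: q)
  hence "map_poly (par_eval a) U = min_poly_at \<gamma> a * qb"
    using ug ring_graph_unique[OF \<Phi>] by (metis poly_eqI poly_graph_def)
  thus ?thesis using \<gamma>0 by simp
qed

lemma ring_graph_specialization:
  fixes \<gamma> :: "('n::{finite,linorder}, 'k::field) acl"
  assumes "a \<in> Omega_gen \<gamma>" "poly (min_poly_at \<gamma> a) \<gamma>0 = 0"
  shows "ring_graph {(poly (map_poly of_par U) \<gamma> / poly (map_poly of_par V) \<gamma>,
       poly (map_poly (par_eval a) U) \<gamma>0 / poly (map_poly (par_eval a) V) \<gamma>0) |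
       U V. poly (map_poly (par_eval a) V) \<gamma>0 \<noteq> 0}"
proof (rule ring_graph_fractions)
  have eval: "comm_ring_hom (\<lambda>U. poly (map_poly f U) x)" if "comm_ring_hom f"
    for f :: "('n, 'k) par \<Rightarrow> 'r::comm_ring_1" and x
  proof -
    interpret comm_ring_hom f by fact
    interpret m: map_poly_comm_ring_hom f ..
    show ?thesis by unfold_locales (simp_all add: m.hom_add m.hom_mult)
  qed
  show "comm_ring_hom (\<lambda>U. poly (map_poly of_par U) \<gamma>)" by (rule eval[OF of_par_hom])
  show "comm_ring_hom (\<lambda>U. poly (map_poly (par_eval a) U) \<gamma>0)" by (rule eval[OF par_eval_hom])
qed (rule specialization_welldefined[OF assms])

section \<open>Products over conjugates and norms\<close>

lemma range_to_ac_mult: "u \<in> range to_ac \<Longrightarrow> v \<in> range to_ac \<Longrightarrow> u * v \<in> range to_ac"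
  by (metis (no_types, opaque_lifting) imageE range_eqI to_ac_mult)

lemma range_to_ac_divide: "u \<in> range to_ac \<Longrightarrow> v \<in> range to_ac \<Longrightarrow> u / v \<in> range to_ac"
  by (metis (no_types, opaque_lifting) imageE range_eqI to_ac_divide)

lemma range_to_ac_power: "u \<in> range to_ac \<Longrightarrow> u ^ n \<in> range to_ac"
  by (metis (no_types, opaque_lifting) imageE range_eqI to_ac_power)

lemma poly_prod_linear:
  fixes A :: "'a::comm_ring_1 multiset"
  shows "poly (\<Prod>x\<in>#A. [:- x, 1:]) y = (\<Prod>x\<in>#A. y - x)"
  by (induction A) (simp_all add: algebra_simps)

lemma degree_prod_linear:
  fixes A :: "'a::idom multiset"
  shows "degree (\<Prod>x\<in>#A. [:- x, 1:]) = size A" "(\<Prod>x\<in>#A. [:- x, 1:]) \<noteq> 0"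
proof (induction A)
  case (add x A)
  {
    case 1
    show ?case using add by (simp add: degree_mult_eq del: mult_pCons_left)
  next
    case 2
    show ?case using add by (simp del: mult_pCons_left)
  }
qed simp_all

lemma degree_map_to_ac [simp]: "degree (map_poly to_ac p) = degree p"
  by (intro degree_map_poly) simp

text \<open>
  The product is a resultant up to a constant factor; the Euclidean algorithm and the
  reciprocity of resultants show that it lies in the base field.
\<close>

lemma prod_roots_in_base_field:
  fixes p q :: "'l::field poly"
  assumes "map_poly to_ac p = smult (to_ac c) (\<Prod>x\<in>#A. [:- x, 1:])" "c \<noteq> 0"
  shows "(\<Prod>x\<in>#A. ac_eval x q) \<in> range to_ac"
  using assms
proof (induction "degree p" arbitrary: p q c A rule: less_induct)
  case less
  have p_nz: "p \<noteq> 0"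
    using less.prems degree_prod_linear(2)[of A] by auto
  have eval_p: "ac_eval y p = to_ac c * (\<Prod>x\<in>#A. y - x)" for y
    by (simp add: ac_eval_def less.prems(1) poly_prod_linear)
  show ?case
  proof (cases "A = {#}")
    case True
    thus ?thesis by (metis image_mset_empty prod_mset_empty rangeI to_ac_1)
  next
    case False
    define r where "r = q mod p"
    have root: "ac_eval x p = 0" if "x \<in># A" for x
      using that unfolding eval_p by (simp add: prod_mset_zero_iff image_iff)
    have "ac_eval x q = ac_eval x r" if "x \<in># A" for x
    proof -
      have "ac_eval x q = ac_eval x (q div p * p + r)" by (simp add: r_def)
      thus ?thesis using root[OF that] unfolding ac_eval_simps by simp
    qed
    hence eq: "(\<Prod>x\<in>#A. ac_eval x q) = (\<Prod>x\<in>#A. ac_eval x r)"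
      by (metis (no_types, lifting) image_mset_cong)
    show ?thesis
    proof (cases "r = 0")
      case True
      have "size A > 0" using False by (simp add: nonempty_has_size)
      hence "(\<Prod>x\<in>#A. ac_eval x r) = 0" using True by simp
      thus ?thesis unfolding eq by (metis rangeI to_ac_0)
    next
      case r_nz: False
      hence deg: "degree r < degree p" using degree_mod_less[OF p_nz, of q] by (simp add: r_def)
      define e where "e = lead_coeff r"
      have e: "e \<noteq> 0" using r_nz by (simp add: e_def)
      have lead: "lead_coeff (map_poly to_ac r) = to_ac e" by (simp add: coeff_map_poly e_def)
      have "map_poly to_ac r \<noteq> 0" using r_nz by simp
      then obtain B where B: "map_poly to_ac r = smult (to_ac e) (\<Prod>x\<in>#B. [:- x, 1:])"
        using alg_closed_imp_factorization[of "map_poly to_ac r"] unfolding lead by blast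
      have eval_r: "ac_eval y r = to_ac e * (\<Prod>x\<in>#B. y - x)" for y
        by (simp add: ac_eval_def B poly_prod_linear)
      \<comment> \<open>The roles are exchanged: the remainder \<open>r\<close> has smaller degree
        than \<open>p\<close>, so the induction hypothesis applies to the product of the values of
        \<open>p\<close> over the roots of \<open>r\<close>.\<close>
      have "(\<Prod>y\<in>#B. ac_eval y p) \<in> range to_ac"
        using less.hyps[OF deg B e] .
      also have "(\<Prod>y\<in>#B. ac_eval y p) = to_ac c ^ size B * (\<Prod>y\<in>#B. \<Prod>x\<in>#A. y - x)"
        unfolding eval_p by (simp add: prod_mset.distrib prod_mset_constant)
      finally have "to_ac c ^ size B * (\<Prod>y\<in>#B. \<Prod>x\<in>#A. y - x) / to_ac c ^ size B \<in> range to_ac"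
        by (rule range_to_ac_divide) (simp add: range_to_ac_power)
      hence 1: "(\<Prod>y\<in>#B. \<Prod>x\<in>#A. y - x) \<in> range to_ac" using less.prems(2) by simp
      \<comment> \<open>The two double products consist of the same differences up to sign, one sign
        for each pair of roots.\<close>
      have "(\<Prod>x\<in>#A. \<Prod>y\<in>#B. x - y) = (\<Prod>y\<in>#B. \<Prod>x\<in>#A. x - y)" by (rule prod_mset.swap)
      also have "\<dots> = (\<Prod>y\<in>#B. \<Prod>x\<in>#A. (- 1) * (y - x))" by simp
      also have "\<dots> = ((- 1) ^ size A) ^ size B * (\<Prod>y\<in>#B. \<Prod>x\<in>#A. y - x)"
        unfolding prod_mset.distrib by (simp add: prod_mset_constant)
      finally have 2: "(\<Prod>x\<in>#A. \<Prod>y\<in>#B. x - y) = ((- 1) ^ size A) ^ size B * (\<Prod>y\<in>#B. \<Prod>x\<in>#A. y - x)" .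
      have m1: "(- 1 :: 'l alg_closure) \<in> range to_ac" by (rule range_eqI[of _ _ "- 1"]) simp
      have "(\<Prod>x\<in>#A. ac_eval x r) = to_ac e ^ size A * (\<Prod>x\<in>#A. \<Prod>y\<in>#B. x - y)"
        unfolding eval_r by (simp add: prod_mset.distrib prod_mset_constant)
      thus ?thesis unfolding eq 2 using 1 m1
        by (simp add: range_to_ac_mult range_to_ac_power)
    qed
  qed
qed

lemma is_min_poly_conjugate:
  assumes p: "is_min_poly x p" and y: "ac_eval y p = 0"
  shows "is_min_poly y p"
proof -
  obtain m where m: "is_min_poly y m" using is_min_poly_ex1 by blast
  obtain q where q: "p = m * q" using is_min_poly_dvd[OF m y] by (elim dvdE)
  have nz: "p \<noteq> 0" "m \<noteq> 0" "q \<noteq> 0" using p q by (auto simp: is_min_poly_def)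
  have deg: "degree p = degree m + degree q" using nz by (simp add: q degree_mult_eq)
  have "ac_eval x m * ac_eval x q = 0" using p by (simp add: is_min_poly_def q)
  moreover have "ac_eval x q \<noteq> 0"
    using is_min_poly_degree_pos[OF m] deg nz p by (fastforce simp: is_min_poly_def)
  ultimately have "ac_eval x m = 0" by simp
  hence "degree p \<le> degree m" using p nz by (simp add: is_min_poly_def)
  thus ?thesis using p m y by (auto simp: is_min_poly_def)
qed

text \<open>The norm runs over the set of conjugates, whereas
  \<open>prod_roots_in_base_field\<close> counts roots with multiplicity. In characteristic zero the
  roots of a minimal polynomial are simple, since its derivative has smaller degree and is not zero;
  so the two products agree.\<close>

lemma prod_conjugates_in_base_field:
  fixes p q :: "'l::field_char_0 poly"
  assumes p: "is_min_poly x p"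
  shows "(\<Prod>y\<in>{y. poly (map_poly to_ac p) y = 0}. ac_eval y q) \<in> range to_ac"
proof -
  define P where "P = map_poly to_ac p"
  have lead: "lead_coeff p = 1" using p by (simp add: is_min_poly_def)
  hence leadP: "lead_coeff P = to_ac 1" by (simp add: P_def coeff_map_poly)
  have P_nz: "P \<noteq> 0" using leadP by auto
  then obtain A where A: "P = smult (to_ac 1) (\<Prod>x\<in>#A. [:- x, 1:])"
    using alg_closed_imp_factorization[OF P_nz] unfolding leadP by blast
  have roots: "{y. poly P y = 0} = set_mset A"
    by (auto simp: A poly_prod_linear prod_mset_zero_iff)
  have "count A y \<le> 1" for y
  proof (rule ccontr)
    assume "\<not> count A y \<le> 1"
    hence "{#y, y#} \<subseteq># A" by (intro mset_subset_eqI) auto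
    then obtain B where B: "A = {#y, y#} + B" by (auto simp: subset_mset.le_iff_add)
    define g where "g = (\<Prod>x\<in>#B. [:- x, 1:])"
    have Pg: "P = [:- y, 1:] * ([:- y, 1:] * g)" by (simp add: A B g_def)
    hence "poly (pderiv P) y = 0" unfolding Pg pderiv_mult by (simp del: mult_pCons_left)
    moreover have "pderiv P = map_poly to_ac (pderiv p)"
      by (rule poly_eqI) (simp add: P_def coeff_pderiv coeff_map_poly)
    ultimately have "ac_eval y (pderiv p) = 0" by (simp add: ac_eval_def)
    moreover have "ac_eval y p = 0" unfolding ac_eval_def P_def[symmetric] Pg by simp
    hence mp: "is_min_poly y p" by (rule is_min_poly_conjugate[OF p])
    moreover have "degree (pderiv p) < degree p"
      using is_min_poly_degree_pos[OF p] by (simp add: degree_pderiv)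
    ultimately have "pderiv p = 0" using ac_eval_eq_0_degree by blast
    thus False using is_min_poly_degree_pos[OF p] by (simp add: pderiv_eq_0_iff)
  qed
  hence "A = mset_set (set_mset A)"
    by (intro multiset_eqI) (metis count_greater_zero_iff count_mset_set(1,3) finite_set_mset
        le_antisym less_one linorder_not_less count_eq_zero_iff)
  hence "(\<Prod>y\<in>set_mset A. ac_eval y q) = (\<Prod>y\<in>#A. ac_eval y q)"
    by (metis prod_unfold_prod_mset)
  moreover have "(\<Prod>y\<in>#A. ac_eval y q) \<in> range to_ac"
    by (rule prod_roots_in_base_field[OF A[unfolded P_def]]) simp
  ultimately show ?thesis unfolding P_def[symmetric] roots by simp
qed

text \<open>A valuation ring is integrally closed. If \<open>1/x\<close> had residue 0, dividing the
  equation by \<open>x ^ n\<close> and reducing would leave the leading coefficient 1 alone.\<close>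

lemma (in place) integral_root_mem:
  assumes f: "f \<in> integral_polys" "lead_coeff f = 1" and x: "poly f x = 0"
  shows "x \<in> R"
proof (rule ccontr)
  assume "x \<notin> R"
  hence y: "inverse x \<in> R" "res (inverse x) = 0" "inverse x \<noteq> 0" using res_inverse_eq_0 by auto
  define n where "n = degree f"
  have m: "coeff f i * inverse x ^ (n - i) \<in> R" for i
    using f y by (auto intro!: mult_mem power_mem integral_polysD)
  have "(\<Sum>i\<le>n. coeff f i * inverse x ^ (n - i)) = 0"
    using poly_inverse_scaled[OF y(3), of f n] x by (simp add: n_def)
  hence "0 = res (\<Sum>i\<le>n. coeff f i * inverse x ^ (n - i))" by simp
  also have "\<dots> = (\<Sum>i\<le>n. res (coeff f i * inverse x ^ (n - i)))" using m by (intro res_sum)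
  also have "\<dots> = (\<Sum>i\<le>n. if i = n then res (coeff f n) else 0)"
  proof (rule sum.cong[OF refl])
    fix i assume "i \<in> {..n}"
    have "res (coeff f i * inverse x ^ (n - i)) = res (coeff f i) * 0 ^ (n - i)"
      using res_mult[OF integral_polysD[OF f(1)] power_mem[OF y(1)]] res_power[OF y(1)] y(2) by simp
    thus "res (coeff f i * inverse x ^ (n - i)) = (if i = n then res (coeff f n) else 0)"
      using \<open>i \<in> {..n}\<close> by (auto simp: power_0_left)
  qed
  also have "\<dots> = 1" using f(2) by (simp add: n_def)
  finally show False by simp
qed

text \<open>
  If the specialization of \<open>f\<close> vanishes, then so does the residue of the product of the
  conjugates of its numerator, all of which are integral at the place.
\<close>

lemma numer_Norm_vanishes:
  fixes \<gamma> :: "('n::{finite,linorder}, 'k::field_char_0) acl"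
  assumes R: "place R res" and a: "a \<in> Omega_gen \<gamma>"
    and spec: "\<And>U W. par_eval a W \<noteq> 0 \<Longrightarrow> poly (map_poly of_par U) \<gamma> / of_par W \<in> R \<and>
       res (poly (map_poly of_par U) \<gamma> / of_par W) = poly (map_poly (par_eval a) U) \<gamma>0 / par_eval a W"
    and f: "f \<in> ext_field \<gamma>" "par_eval a (denom \<gamma> f) \<noteq> 0" "special \<gamma> a \<gamma>0 f = 0"
  shows "par_eval a (coeff (canon_num \<gamma> (Norm \<gamma> (numer \<gamma> f))) 0) = 0"
proof -
  interpret place R res by fact
  interpret par_eval: comm_ring_hom "par_eval a" by (rule par_eval_hom)
  interpret of_par: comm_ring_hom "of_par :: ('n, 'k) par \<Rightarrow> ('n, 'k) acl" by (rule of_par_hom)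
  have par: "of_par P \<in> R" "res (of_par P) = par_eval a P" for P
    using spec[of 1 "[:P:]"] by (simp_all add: Polynomial.map_poly_pCons)
  define p where "p = min_poly \<gamma>"
  have mp: "is_min_poly \<gamma> p" unfolding p_def by (rule min_poly)
  define U where "U = canon_num \<gamma> f"
  define n0 where "n0 = numer \<gamma> f"
  have n0: "n0 = ac_eval \<gamma> (map_poly to_fract U)" by (simp add: n0_def numer_def poly_of_par U_def)
  hence n0_ext: "n0 \<in> ext_field \<gamma>" by (auto simp: ext_field_ac_eval)
  have degU: "degree (map_poly to_fract U) < degree p"
    using canonical_exists[OF f(1)] by (simp add: canonical_def U_def p_def degree_map_poly)
  have res_n0: "res n0 = 0" "n0 \<in> R"
  proof -
    have "poly (map_poly (par_eval a) U) \<gamma>0 = 0"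
      using f(2,3) by (simp add: special_def U_def)
    thus "res n0 = 0" "n0 \<in> R" using spec[of 1 U] by (simp_all add: n0 poly_of_par)
  qed
  define U' where "U' = canon_num \<gamma> n0"
  define W' where "W' = denom \<gamma> n0"
  have can: "canonical \<gamma> n0 U' W'" unfolding U'_def W'_def by (rule canonical_exists[OF n0_ext])
  \<comment> \<open>\<open>n0\<close> is a polynomial in \<open>\<gamma>\<close> without
    denominator. Comparing its two representations of degree below that of \<open>p\<close> gives
    \<open>U' = W' U\<close>, so \<open>W'\<close> divides itself and all coefficients of
    \<open>U'\<close>, which have only trivial common divisors.\<close>
  have "W' dvd 1"
  proof -
    have W': "W' \<noteq> 0" using can by (simp add: canonical_def)
    have "degree (map_poly to_fract U') < degree p"
      using can by (simp add: canonical_def p_def degree_map_poly)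
    moreover have "degree (smult (to_fract W') (map_poly to_fract U)) < degree p"
      using degU W' by simp
    ultimately have "degree (map_poly to_fract U' - smult (to_fract W') (map_poly to_fract U)) < degree p"
      by (rule degree_diff_less)
    moreover have "ac_eval \<gamma> (map_poly to_fract U' - smult (to_fract W') (map_poly to_fract U)) = 0"
      using can W' n0 by (simp add: canonical_def poly_of_par of_par_eq field_simps)
    ultimately have eq: "map_poly to_fract U' - smult (to_fract W') (map_poly to_fract U) = 0"
      by (intro ac_eval_eq_0_degree[OF mp])
    have "coeff U' i = W' * coeff U i" for i
    proof -
      have "to_fract (coeff U' i) = to_fract (W' * coeff U i)"
        using arg_cong[OF eq, of "\<lambda>p. coeff p i"] by (simp add: coeff_map_poly)
      thus ?thesis by (simp only: to_fract_eq_iff)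
    qed
    hence "W' dvd P" if "P \<in> set (coeffs U')" for P
      using that by (auto simp: coeffs_def split: if_splits)
    thus ?thesis using can by (auto simp: canonical_def trivial_gcd_def)
  qed
  hence W'a: "par_eval a W' \<noteq> 0" by (rule par_eval_unit)
  hence W': "W' \<noteq> 0" by auto
  define \<nu> where "\<nu> = Norm \<gamma> n0"
  define Z where "Z = {\<gamma>'. poly (map_poly to_ac p) \<gamma>' = 0}"
  have \<nu>: "\<nu> = (\<Prod>\<gamma>'\<in>Z. poly (map_poly of_par U') \<gamma>' / of_par W')"
    by (simp add: \<nu>_def Norm_def Z_def U'_def W'_def p_def)
  have "map_poly to_ac p \<noteq> 0" using is_min_poly_degree_pos[OF mp] by auto
  hence finZ: "finite Z" unfolding Z_def by (rule poly_roots_finite)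
  have \<gamma>Z: "\<gamma> \<in> Z" using mp by (simp add: Z_def is_min_poly_def ac_eval_def)
  have invW': "inverse (of_par W') \<in> R" using par[of W'] W'a by (intro inverse_mem) simp_all
  \<comment> \<open>The minimal polynomial is monic with coefficients integral at the place. This
    makes every conjugate of \<open>\<gamma>\<close> integral there.\<close>
  have intp: "map_poly to_ac p \<in> integral_polys"
    unfolding integral_polys_def
  proof (intro CollectI allI)
    fix i
    obtain N D where ND: "coeff p i = to_fract N / to_fract D" "par_eval a D \<noteq> 0"
      using min_poly_graph[OF a] unfolding poly_graph_def p_def by blast
    have "inverse (of_par D) \<in> R" using par[of D] ND(2) by (intro inverse_mem) simp_all
    hence "of_par N * inverse (of_par D) \<in> R" using par by (intro mult_mem)
    thus "coeff (map_poly to_ac p) i \<in> R" by (simp add: coeff_map_poly ND(1) of_par_eq divide_inverse)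
  qed
  have leadp: "lead_coeff (map_poly to_ac p) = 1" using mp by (simp add: is_min_poly_def coeff_map_poly)
  have ZR: "z \<in> R" if "z \<in> Z" for z
    using integral_root_mem[OF intp leadp] that by (simp add: Z_def)
  have intU': "map_poly of_par U' \<in> integral_polys"
    using par by (simp add: integral_polys_def coeff_map_poly)
  have facR: "poly (map_poly of_par U') z / of_par W' \<in> R" if "z \<in> Z" for z
    unfolding divide_inverse using integral_poly_mem(1)[OF intU' ZR[OF that]] invW' by (intro mult_mem)
  have \<nu>R: "\<nu> \<in> R" unfolding \<nu> by (rule prod_mem) (rule facR)
  have "res (poly (map_poly of_par U') \<gamma> / of_par W') = 0"
    using can res_n0 by (simp add: canonical_def)
  \<comment> \<open>The factor belonging to \<open>\<gamma>\<close> itself has residue 0, and the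
    other factors are integral.\<close>
  hence res_\<nu>: "res \<nu> = 0"
    unfolding \<nu> using finZ \<gamma>Z facR by (subst res_prod) auto
  have "\<nu> \<in> range to_ac"
  proof -
    have "\<nu> = (\<Prod>z\<in>Z. ac_eval z (map_poly to_fract U')) / of_par W' ^ card Z"
      unfolding \<nu> by (simp add: prod_dividef poly_of_par)
    moreover have "(\<Prod>z\<in>Z. ac_eval z (map_poly to_fract U')) \<in> range to_ac"
      unfolding Z_def by (rule prod_conjugates_in_base_field[OF mp])
    ultimately show ?thesis
      by (auto simp: of_par_eq intro!: range_to_ac_divide range_to_ac_power)
  qed
  then obtain b where b: "\<nu> = to_ac b" by blast
  hence \<nu>_ext: "\<nu> \<in> ext_field \<gamma>" unfolding ext_field_ac_eval by (intro exI[of _ "[:b:]"]) simp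
  define V where "V = canon_num \<gamma> \<nu>"
  define Wn where "Wn = denom \<gamma> \<nu>"
  have canV: "canonical \<gamma> \<nu> V Wn" unfolding V_def Wn_def by (rule canonical_exists[OF \<nu>_ext])
  have Wn: "Wn \<noteq> 0" using canV by (simp add: canonical_def)
  have eqV: "ac_eval \<gamma> (map_poly to_fract V) = to_ac (b * to_fract Wn)"
    using canV Wn b by (simp add: canonical_def poly_of_par of_par_eq field_simps)
  \<comment> \<open>As \<open>\<nu>\<close> lies in the base field, its canonical numerator is
    constant in \<open>\<gamma>\<close>, so that coefficient 0 is all of
    \<open>\<nu> * Wn\<close>.\<close>
  have "degree (map_poly to_fract V - [:b * to_fract Wn:]) < degree p"
    using canV is_min_poly_degree_pos[OF mp]
    by (intro degree_diff_less) (simp_all add: canonical_def p_def degree_map_poly)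
  hence "map_poly to_fract V - [:b * to_fract Wn:] = 0"
    using eqV by (intro ac_eval_eq_0_degree[OF mp]) simp_all
  hence "coeff (map_poly to_fract V) 0 = b * to_fract Wn" by simp
  hence "to_fract (coeff V 0) = b * to_fract Wn" by (simp add: coeff_map_poly)
  hence "of_par (coeff V 0) = \<nu> * of_par Wn" unfolding of_par_eq b by (metis to_ac_mult)
  hence "par_eval a (coeff V 0) = res (\<nu> * of_par Wn)" by (metis par(2))
  also have "\<dots> = 0" using res_mult[OF \<nu>R par(1)] res_\<nu> by simp
  finally show ?thesis by (simp add: V_def \<nu>_def n0_def)
qed

text \<open>\<open>special\<close> passes through a chosen representation; the value at 0 has to be
  0 for \<open>map_poly\<close> to act on every coefficient.\<close>

lemma special_0 [simp]: "special \<gamma> a \<gamma>0 0 = 0"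
proof -
  have "0 \<in> ext_field \<gamma>" unfolding ext_field_ac_eval by (intro exI[of _ 0]) simp
  hence can: "canonical \<gamma> 0 (canon_num \<gamma> 0) (denom \<gamma> 0)" by (rule canonical_exists)
  hence "ac_eval \<gamma> (map_poly to_fract (canon_num \<gamma> 0)) = 0"
    by (auto simp: canonical_def poly_of_par)
  moreover have "degree (map_poly to_fract (canon_num \<gamma> 0)) < degree (min_poly \<gamma>)"
    using can by (simp add: canonical_def degree_map_poly)
  ultimately have "map_poly to_fract (canon_num \<gamma> 0) = 0"
    by (intro ac_eval_eq_0_degree[OF min_poly])
  hence "coeff (map_poly to_fract (canon_num \<gamma> 0)) i = 0" for i by simp
  hence "canon_num \<gamma> 0 = 0" by (intro poly_eqI) (simp add: coeff_map_poly)
  thus ?thesis by (simp add: special_def)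
qed

section \<open>Coefficients, total degree and the specialized curve\<close>

lemma cset2_iff: "c \<in> cset2 G \<longleftrightarrow> c \<noteq> 0 \<and> (\<exists>i j. c = coeff (coeff G j) i)"
proof
  assume "c \<in> cset2 G"
  thus "c \<noteq> 0 \<and> (\<exists>i j. c = coeff (coeff G j) i)"
    by (auto simp: cset2_def cset1_def coeffs_def split: if_splits)
next
  assume "c \<noteq> 0 \<and> (\<exists>i j. c = coeff (coeff G j) i)"
  then obtain i j where *: "c = coeff (coeff G j) i" "c \<noteq> 0" by blast
  hence "coeff G j \<noteq> 0" by auto
  hence "coeff G j \<in> set (coeffs G)" by (rule in_set_coeffs)
  moreover have "c \<in> set (coeffs (coeff G j)) - {0}"
    using in_set_coeffs[of "coeff G j" i] * by simp
  ultimately show "c \<in> cset2 G" unfolding cset2_def cset1_def by blast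
qed

lemma polys2_iff: "0 \<in> S \<Longrightarrow> G \<in> polys2 S \<longleftrightarrow> (\<forall>i j. coeff (coeff G j) i \<in> S)"
proof -
  assume 0: "0 \<in> S"
  have "set (coeffs p) \<subseteq> T \<longleftrightarrow> (\<forall>i. coeff p i \<in> T)" if "0 \<in> T" for T and p :: "'b::zero poly"
  proof
    assume "set (coeffs p) \<subseteq> T"
    thus "\<forall>i. coeff p i \<in> T" using that in_set_coeffs[of p] by (metis subsetD)
  next
    assume "\<forall>i. coeff p i \<in> T"
    thus "set (coeffs p) \<subseteq> T" by (auto simp: coeffs_def split: if_splits)
  qed
  note * = this
  have "0 \<in> polys1 S" by (simp add: polys1_def)
  thus ?thesis using *[of "polys1 S" G] *[OF 0] by (simp add: polys2_def polys1_def) blast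
qed

lemma total_degree_le: "coeff (coeff G j) i \<noteq> 0 \<Longrightarrow> i + j \<le> total_degree G"
  and total_degree_attained:
    "G \<noteq> 0 \<Longrightarrow> \<exists>i j. i + j = total_degree G \<and> coeff (coeff G j) i \<noteq> 0"
proof -
  define S where "S = {i + j | i j. coeff (coeff G j) i \<noteq> 0}"
  have "S \<subseteq> (\<Union>j\<le>degree G. (\<lambda>i. i + j) ` {..degree (coeff G j)})"
  proof
    fix n assume "n \<in> S"
    then obtain i j where *: "n = i + j" "coeff (coeff G j) i \<noteq> 0" by (auto simp: S_def)
    hence "coeff G j \<noteq> 0" by auto
    hence "j \<le> degree G" "i \<le> degree (coeff G j)" using *(2) le_degree by blast+
    thus "n \<in> (\<Union>j\<le>degree G. (\<lambda>i. i + j) ` {..degree (coeff G j)})" using *(1) by blast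
  qed
  hence fin: "finite S" by (rule finite_subset) simp
  have td: "total_degree G = Max S" by (simp add: total_degree_def S_def)
  show "i + j \<le> total_degree G" if "coeff (coeff G j) i \<noteq> 0"
    unfolding td using that by (intro Max_ge[OF fin]) (auto simp: S_def)
  show "\<exists>i j. i + j = total_degree G \<and> coeff (coeff G j) i \<noteq> 0" if "G \<noteq> 0"
  proof -
    have "coeff (lead_coeff G) (degree (lead_coeff G)) \<noteq> 0" using that by simp
    hence "degree (lead_coeff G) + degree G \<in> S" unfolding S_def by blast
    hence "S \<noteq> {}" by blast
    from Max_in[OF fin this] obtain i j where "Max S = i + j" "coeff (coeff G j) i \<noteq> 0"
      unfolding S_def by blast
    thus ?thesis unfolding td by metis
  qed
qed

lemma coeff_top_form:
  "coeff (coeff (top_form G) j) i = (if i + j = total_degree G then coeff (coeff G j) i else 0)"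
proof -
  define d where "d = total_degree G"
  have "coeff (coeff (top_form G) j) i =
    (\<Sum>k\<le>d. if k = i then (if i + j = d then coeff (coeff G j) i else 0) else 0)"
    unfolding top_form_def Let_def d_def[symmetric] coeff_sum
    by (rule sum.cong) auto
  thus ?thesis by (simp add: d_def)
qed

text \<open>\<open>Omega_curve\<close> supplies two facts: all coefficients of \<open>F\<close> are
  defined at \<open>a\<close>, and some coefficient of its form of highest degree has a norm whose
  numerator does not vanish at \<open>a\<close>. By \<open>numer_Norm_vanishes\<close> that
  coefficient then has a nonzero specialization, so the degree is preserved.\<close>

theorem rational_curve_special:
  fixes \<gamma> :: "('n::{finite,linorder}, 'k::field_char_0) acl"
  assumes F: "F \<in> polys2 (par_ring \<gamma>)" and rat: "rational_curve F"
    and a: "a \<in> Omega_curve \<gamma> F" and \<gamma>0: "poly (min_poly_at \<gamma> a) \<gamma>0 = 0"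
    and irr: "irreducible (special_curve \<gamma> a \<gamma>0 F)"
  shows "rational_curve (special_curve \<gamma> a \<gamma>0 F)"
proof -
  have adef: "a \<in> Omega_gen \<gamma>" "a \<notin> zero_locus {D. is_lcm (denom \<gamma> ` cset2 F) D}"
    and anz: "a \<notin> zero_locus ((\<lambda>c. coeff (canon_num \<gamma> (Norm \<gamma> (numer \<gamma> c))) 0) ` cset2 (top_form F))"
    using a by (auto simp: Omega_curve_def Omega_def_def Omega_nonZ_def)
  obtain R and res :: "('n, 'k) acl \<Rightarrow> 'k alg_closure" where R: "place R res"
    and ext: "\<And>x b. (x, b) \<in> {(poly (map_poly of_par U) \<gamma> / poly (map_poly of_par V) \<gamma>,
       poly (map_poly (par_eval a) U) \<gamma>0 / poly (map_poly (par_eval a) V) \<gamma>0) |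
       U V. poly (map_poly (par_eval a) V) \<gamma>0 \<noteq> 0} \<Longrightarrow> x \<in> R \<and> res x = b"
    using place_extension[OF ring_graph_specialization[OF adef(1) \<gamma>0]] by blast
  interpret place R res by fact
  have spec: "poly (map_poly of_par U) \<gamma> / of_par W \<in> R \<and>
       res (poly (map_poly of_par U) \<gamma> / of_par W) = poly (map_poly (par_eval a) U) \<gamma>0 / par_eval a W"
    if "par_eval a W \<noteq> 0" for U W
  proof (rule ext, intro CollectI exI conjI)
    interpret par_eval: comm_ring_hom "par_eval a" by (rule par_eval_hom)
    interpret of_par: comm_ring_hom "of_par :: ('n, 'k) par \<Rightarrow> ('n, 'k) acl" by (rule of_par_hom)
    show "(poly (map_poly of_par U) \<gamma> / of_par W, poly (map_poly (par_eval a) U) \<gamma>0 / par_eval a W) =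
      (poly (map_poly of_par U) \<gamma> / poly (map_poly of_par [:W:]) \<gamma>,
       poly (map_poly (par_eval a) U) \<gamma>0 / poly (map_poly (par_eval a) [:W:]) \<gamma>0)"
      "poly (map_poly (par_eval a) [:W:]) \<gamma>0 \<noteq> 0"
      using that by (simp_all add: Polynomial.map_poly_pCons)
  qed
  have "(0 :: ('n, 'k) acl) \<in> par_ring \<gamma>"
    unfolding par_ring_def by (rule range_eqI[of _ _ 0]) simp
  from polys2_iff[OF this] F have F_ext: "coeff (coeff F j) i \<in> ext_field \<gamma>" for i j
    using par_ring_subset by blast
  have den: "par_eval a (denom \<gamma> c) \<noteq> 0" if "c \<in> cset2 F" for c
    using is_lcm_nonvanishing[OF adef(2)] that by blast
  have val: "coeff (coeff F j) i \<in> R \<and> res (coeff (coeff F j) i) = special \<gamma> a \<gamma>0 (coeff (coeff F j) i)" for i j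
  proof (cases "coeff (coeff F j) i = 0")
    case True
    thus ?thesis by simp
  next
    case False
    define c where "c = coeff (coeff F j) i"
    have "c \<in> cset2 F" unfolding cset2_iff using False by (auto simp: c_def)
    note den = den[OF this]
    have "canonical \<gamma> c (canon_num \<gamma> c) (denom \<gamma> c)" unfolding c_def by (rule canonical_exists[OF F_ext])
    hence "c = poly (map_poly of_par (canon_num \<gamma> c)) \<gamma> / of_par (denom \<gamma> c)" by (simp add: canonical_def)
    thus ?thesis using spec[OF den, of "canon_num \<gamma> c"] unfolding c_def[symmetric] special_def by metis
  qed
  have eq: "map_poly (map_poly res) F = special_curve \<gamma> a \<gamma>0 F"
    by (intro poly_eqI) (simp add: special_curve_def coeff_map_poly val)
  obtain c where c: "c \<in> cset2 (top_form F)" "par_eval a (coeff (canon_num \<gamma> (Norm \<gamma> (numer \<gamma> c))) 0) \<noteq> 0"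
    using anz by (auto simp: zero_locus_def)
  then obtain i j where ij: "c = coeff (coeff F j) i" "i + j = total_degree F" "c \<noteq> 0"
    by (auto simp: cset2_iff coeff_top_form split: if_splits)
  have cF: "c \<in> cset2 F" unfolding cset2_iff using ij by blast
  have "special \<gamma> a \<gamma>0 c \<noteq> 0"
    using numer_Norm_vanishes[OF R adef(1) spec, of c] F_ext den[OF cF] c(2) ij(1) by blast
  hence "res (coeff (coeff F (total_degree F - i)) i) \<noteq> 0"
    using ij(1,2) val by (metis add_diff_cancel_left')
  moreover have "coeff (coeff F j) i = 0" if "total_degree F < i + j" for i j
    using total_degree_le[of F j i] that by linarith
  ultimately show ?thesis
    using degenerate_rational_curve[OF R _ _ _ _ rat, of "total_degree F" i] val ij(2) irr
    unfolding eq by simp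
qed

section \<open>Singular points and the standard decomposition\<close>

lemma comm_ring_hom_const: "comm_ring_hom (\<lambda>c::'a::comm_ring_1. [:c:])"
  by unfold_locales (simp_all add: one_pCons)

lemma comm_ring_hom_const3: "comm_ring_hom (\<lambda>c::'a::comm_ring_1. [:[:[:c:]:]:])"
  by unfold_locales (simp_all add: one_pCons)

lemma comm_ring_hom_id: "comm_ring_hom (id :: 'a::comm_ring_1 \<Rightarrow> 'a)"
  by unfold_locales simp_all

lemma hom_form_eval:
  assumes "comm_ring_hom \<phi>"
  shows "\<phi> (form_eval h d G x y z) = form_eval (\<lambda>c. \<phi> (h c)) d G (\<phi> x) (\<phi> y) (\<phi> z)"
proof -
  interpret comm_ring_hom \<phi> by fact
  show ?thesis by (simp add: form_eval_def hom_sum hom_mult hom_power)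
qed

lemma eval2_pCons:
  assumes "h 0 = 0"
  shows "eval2 h (pCons f g) x y = poly (map_poly h f) x + y * eval2 h g x y"
proof -
  have "map_poly (map_poly h) (pCons f g) = pCons (map_poly h f) (map_poly (map_poly h) g)"
    by (rule Polynomial.map_poly_pCons) simp
  thus ?thesis by (simp add: eval2_def)
qed

lemma eval2_0 [simp]: "eval2 h 0 x y = 0"
  by (simp add: eval2_def)

lemma eval3_pCons:
  assumes "h 0 = 0"
  shows "eval3 h (pCons g H) x y z = eval2 h g x y + z * eval3 h H x y z"
proof -
  have "map_poly (map_poly (map_poly h)) (pCons g H) =
    pCons (map_poly (map_poly h) g) (map_poly (map_poly (map_poly h)) H)"
    by (rule Polynomial.map_poly_pCons) simp
  thus ?thesis by (simp add: eval3_def eval2_def)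
qed

lemma eval3_0 [simp]: "eval3 h 0 x y z = 0"
  by (simp add: eval3_def)

lemma eval2_add:
  assumes "comm_ring_hom h"
  shows "eval2 h (F + G) x y = eval2 h F x y + eval2 h G x y"
proof -
  interpret h: comm_ring_hom h by fact
  have h0: "h 0 = 0" by simp
  show ?thesis
    using eval2_hom(1)[OF assms, of "F + G" G x y] by simp
qed

lemma eval3_add:
  assumes "comm_ring_hom h"
  shows "eval3 h (H + H') x y z = eval3 h H x y z + eval3 h H' x y z"
proof -
  interpret h: comm_ring_hom h by fact
  have h0: "h 0 = 0" by simp
  show ?thesis
  proof (induction H arbitrary: H')
    case (pCons g H)
    obtain g' H'' where "H' = pCons g' H''" by (cases H')
    thus ?case using pCons.IH by (simp add: eval3_pCons[of h, OF h0] eval2_add[OF assms] algebra_simps)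
  qed simp
qed

lemma eval3_sum:
  assumes "comm_ring_hom h"
  shows "eval3 h (sum f A) x y z = (\<Sum>a\<in>A. eval3 h (f a) x y z)"
  by (induction A rule: infinite_finite_induct) (simp_all add: eval3_add[OF assms])

lemma eval3_monom:
  assumes "comm_ring_hom h"
  shows "eval3 h (monom (monom (monom c i) j) k) x y z = h c * x ^ i * y ^ j * z ^ k"
proof -
  interpret h: comm_ring_hom h by fact
  have "map_poly (map_poly (map_poly h)) (monom (monom (monom c i) j) k) = monom (monom (monom (h c) i) j) k"
    by (simp add: map_poly_monom)
  thus ?thesis by (simp add: eval3_def poly_monom)
qed

lemma eval3_homogenize:
  assumes "comm_ring_hom h"
  shows "eval3 h (homogenize G) x y z = form_eval h (total_degree G) G x y z"
  by (simp add: homogenize_def Let_def form_eval_def eval3_sum[OF assms] eval3_monom[OF assms])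

text \<open>First-order Taylor expansion along a line: coefficient 0 is the value, coefficient 1 the
  derivative in the direction of the line.\<close>

lemma line_poly:
  fixes f :: "'a::idom poly"
  shows "coeff (poly (map_poly (\<lambda>c. [:c:]) f) [:x, u:]) 0 = poly f x"
    "coeff (poly (map_poly (\<lambda>c. [:c:]) f) [:x, u:]) 1 = u * poly (pderiv f) x"
  by (induction f) (simp_all add: Polynomial.map_poly_pCons pderiv_pCons algebra_simps)

lemma line_eval2:
  fixes g :: "'a::idom poly poly"
  shows "coeff (eval2 (\<lambda>c. [:c:]) g [:x, u:] [:y, v:]) 0 = eval2 id g x y"
    "coeff (eval2 (\<lambda>c. [:c:]) g [:x, u:] [:y, v:]) 1 =
      u * eval2 id (map_poly pderiv g) x y + v * eval2 id (pderiv g) x y"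
proof (induction g)
  case (pCons f g)
  have 0: "map_poly pderiv (pCons f g) = pCons (pderiv f) (map_poly pderiv g)"
    by (rule Polynomial.map_poly_pCons) simp
  have e: "eval2 (\<lambda>c. [:c:]) (pCons f g) [:x, u:] [:y, v:] =
    poly (map_poly (\<lambda>c. [:c:]) f) [:x, u:] + [:y, v:] * eval2 (\<lambda>c. [:c:]) g [:x, u:] [:y, v:]"
    by (rule eval2_pCons) simp
  have ei: "eval2 (\<lambda>a. a) (pCons f' g') x y = poly f' x + y * eval2 (\<lambda>a. a) g' x y" for f' g'
    using eval2_pCons[of id f' g' x y] by (simp add: id_def)
  {
    case 1
    show ?case using pCons.IH(1) line_poly(1)[of f x u] unfolding id_def by (simp add: e ei)
  next
    case 2
    show ?case using pCons.IH line_poly[of f x u]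
      unfolding 0 pderiv_pCons e id_def ei eval2_add[OF comm_ring_hom_id[unfolded id_def]] coeff_add
      by (simp add: ei algebra_simps)
  }
qed simp_all

lemma line_eval3:
  fixes H :: "'a::idom poly poly poly"
  shows "coeff (eval3 (\<lambda>c. [:c:]) H [:x, u:] [:y, v:] [:z, w:]) 0 = eval3 id H x y z"
    "coeff (eval3 (\<lambda>c. [:c:]) H [:x, u:] [:y, v:] [:z, w:]) 1 =
      u * eval3 id (partial3 1 0 0 H) x y z + v * eval3 id (partial3 0 1 0 H) x y z +
      w * eval3 id (partial3 0 0 1 H) x y z"
proof (induction H)
  case (pCons g H)
  have 0: "map_poly (map_poly pderiv) (pCons g H) = pCons (map_poly pderiv g) (map_poly (map_poly pderiv) H)"
    "map_poly pderiv (pCons g H) = pCons (pderiv g) (map_poly pderiv H)"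
    by (rule Polynomial.map_poly_pCons, simp)+
  have e: "eval3 (\<lambda>c. [:c:]) (pCons g H) [:x, u:] [:y, v:] [:z, w:] =
    eval2 (\<lambda>c. [:c:]) g [:x, u:] [:y, v:] + [:z, w:] * eval3 (\<lambda>c. [:c:]) H [:x, u:] [:y, v:] [:z, w:]"
    by (rule eval3_pCons) simp
  have ei: "eval3 (\<lambda>a. a) (pCons g' H') x y z = eval2 (\<lambda>a. a) g' x y + z * eval3 (\<lambda>a. a) H' x y z" for g' H'
    using eval3_pCons[of id g' H' x y z] by (simp add: id_def)
  {
    case 1
    show ?case using pCons.IH(1) line_eval2(1)[of g x u y v] unfolding id_def by (simp add: e ei)
  next
    case 2
    have p: "partial3 1 0 0 K = map_poly (map_poly pderiv) K" "partial3 0 1 0 K = map_poly pderiv K"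
      "partial3 0 0 1 K = pderiv K" for K :: "'a poly poly poly"
      by (simp_all add: partial3_def)
    show ?case
      using pCons.IH line_eval2[of g x u y v]
      unfolding p 0 pderiv_pCons e id_def ei eval3_add[OF comm_ring_hom_id[unfolded id_def]] coeff_add
      by (simp add: ei algebra_simps)
  }
qed (simp_all add: partial3_def)

text \<open>The form vanishes to order at least 2 at the point along the line in direction
  \<open>(u, v, w)\<close>. For all directions together this is singularity. Unlike conditions on
  partial derivatives, it is transported by a linear substitution without the chain rule.\<close>

definition singular_at :: "nat \<Rightarrow> 'a::idom poly poly \<Rightarrow> 'a \<Rightarrow> 'a \<Rightarrow> 'a \<Rightarrow> 'a \<Rightarrow> 'a \<Rightarrow> 'a \<Rightarrow> bool" where
  "singular_at d G x y z u v w \<longleftrightarrow>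
     (\<forall>i<2. coeff (form_eval (\<lambda>c. [:c:]) d G [:x, u:] [:y, v:] [:z, w:]) i = 0)"

lemma all_less_2: "(\<forall>i<2::nat. P i) \<longleftrightarrow> P 0 \<and> P 1"
  by (auto simp: less_2_cases_iff)

lemma singular_at_scale:
  assumes "s \<noteq> (0::'a::idom)"
  shows "singular_at d G (s * x) (s * y) (s * z) (s * u) (s * v) (s * w) \<longleftrightarrow> singular_at d G x y z u v w"
proof -
  have "form_eval (\<lambda>c. [:c:]) d G [:s * x, s * u:] [:s * y, s * v:] [:s * z, s * w:] =
    [:s:] ^ d * form_eval (\<lambda>c. [:c:]) d G [:x, u:] [:y, v:] [:z, w:]"
    by (subst form_eval_scale[symmetric]) (simp add: mult.commute)
  thus ?thesis using assms by (simp add: singular_at_def poly_const_pow)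
qed

lemma fold_point_singular_at:
  assumes "fold_point (homogenize G) x y z r" "2 \<le> r"
  shows "singular_at (total_degree G) G x y z u v w"
proof -
  have 0: "eval3 id (partial3 i j k (homogenize G)) x y z = 0" if "i + j + k \<le> 1" for i j k
    using assms that by (simp add: fold_point_def)
  have "eval3 id (homogenize G) x y z = 0" using 0[of 0 0 0] by (simp add: partial3_def)
  thus ?thesis
    unfolding singular_at_def all_less_2 eval3_homogenize[OF comm_ring_hom_const, symmetric] line_eval3
    using 0[of 1 0 0] 0[of 0 1 0] 0[of 0 0 1] by simp
qed

lemma poly_eq_cofinite:
  fixes p q :: "'a::{idom,ring_char_0} poly"
  assumes "r \<noteq> 0" "\<And>e. poly r e \<noteq> 0 \<Longrightarrow> poly p e = poly q e"
  shows "p = q"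
proof -
  have "poly (r * (p - q)) e = 0" for e using assms(2)[of e] by auto
  hence "r * (p - q) = 0" using poly_all_0_iff_0 by blast
  thus ?thesis using assms(1) by simp
qed

definition degree_bounded :: "nat \<Rightarrow> 'a::zero poly poly \<Rightarrow> bool" where
  "degree_bounded n A \<longleftrightarrow> (\<forall>i j. n < i + j \<longrightarrow> coeff (coeff A j) i = 0)"

lemma degree_bounded_mult:
  fixes A B :: "'a::comm_ring_1 poly poly"
  assumes "degree_bounded m A" "degree_bounded n B"
  shows "degree_bounded (m + n) (A * B)"
  unfolding degree_bounded_def
proof (intro allI impI)
  fix i j assume ij: "m + n < i + j"
  have "coeff (coeff A j') i' * coeff (coeff B (j - j')) (i - i') = 0" if "j' \<le> j" "i' \<le> i" for i' j'
  proof (cases "m < i' + j'")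
    case False
    hence "n < (i - i') + (j - j')" using ij that by linarith
    thus ?thesis using assms(2) by (simp add: degree_bounded_def)
  qed (use assms(1) in \<open>simp add: degree_bounded_def\<close>)
  thus "coeff (coeff (A * B) j) i = 0" by (simp add: coeff_mult coeff_sum)
qed

lemma degree_bounded_power:
  fixes A :: "'a::comm_ring_1 poly poly"
  assumes "degree_bounded m A"
  shows "degree_bounded (k * m) (A ^ k)"
proof (induction k)
  case 0
  show ?case by (auto simp: degree_bounded_def coeff_1 coeff_pCons split: nat.splits)
next
  case (Suc k)
  show ?case using degree_bounded_mult[OF assms Suc] by simp
qed

lemma degree_bounded_form_eval:
  fixes A B :: "'a::comm_ring_1 poly poly"
  assumes "degree_bounded 1 A" "degree_bounded 1 B"
  shows "degree_bounded d (form_eval (\<lambda>c. [:[:c:]:]) d G A B 1)"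
proof -
  have "degree_bounded d ([:[:c:]:] * A ^ i * B ^ j * 1 ^ k)" if "i \<le> d" "j \<le> d - i" for c i j k
  proof -
    have "degree_bounded 0 [:[:c:]:]" by (auto simp: degree_bounded_def coeff_pCons split: nat.splits)
    from degree_bounded_mult[OF degree_bounded_mult[OF this degree_bounded_power[OF assms(1)]]
      degree_bounded_power[OF assms(2)]]
    have "degree_bounded (i + j) ([:[:c:]:] * A ^ i * B ^ j)" by simp
    thus ?thesis using that by (simp add: degree_bounded_def)
  qed
  thus ?thesis
    unfolding form_eval_def degree_bounded_def coeff_sum by (intro allI impI sum.neutral ballI) simp
qed

lemma of_base_hom: "comm_ring_hom (of_base :: 'k::field \<Rightarrow> ('n::{finite,linorder}, 'k) acl)"
proof -
  interpret of_par: comm_ring_hom "of_par :: ('n, 'k) par \<Rightarrow> ('n, 'k) acl" by (rule of_par_hom)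
  show ?thesis
  proof unfold_locales
    fix x y :: 'k
    show "of_base (x + y) = (of_base x + of_base y :: ('n, 'k) acl)"
      by (simp add: of_base_def single_add of_par.hom_add)
    show "of_base (x * y) = (of_base x * of_base y :: ('n, 'k) acl)"
      by (simp add: of_base_def mult_single flip: of_par.hom_mult)
  qed (simp_all add: of_base_def)
qed

section \<open>Affine changes of coordinates\<close>

context
  fixes F G :: "('n::{finite,linorder}, 'k::field_char_0) acl poly poly"
    and m00 m01 m10 m11 c1 c2 :: "('n, 'k) acl"
    and d :: nat
  assumes F_nz: "F \<noteq> 0"
    and det: "m00 * m11 - m01 * m10 \<noteq> 0"
    and G: "G = eval2 (\<lambda>c. [:[:c:]:]) F [:[:c1, m00:], [:m01:]:] [:[:c2, m10:], [:m11:]:]"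
    and d: "d = total_degree F"
begin

private lemma degF: "d < i + j \<Longrightarrow> coeff (coeff F j) i = 0"
  using total_degree_le[of F j i] d by fastforce

private lemma G_form: "G = form_eval (\<lambda>c. [:[:c:]:]) d F [:[:c1, m00:], [:m01:]:] [:[:c2, m10:], [:m11:]:] 1"
  unfolding G by (rule eval2_eq_form_eval[OF degF]) simp_all

private lemma degG: "d < i + j \<Longrightarrow> coeff (coeff G j) i = 0"
proof -
  have "degree_bounded 1 [:[:c1, m00:], [:m01:]:]" "degree_bounded 1 [:[:c2, m10:], [:m11:]:]"
    by (auto simp: degree_bounded_def coeff_pCons split: nat.splits)
  from degree_bounded_form_eval[OF this, of d F] show "d < i + j \<Longrightarrow> coeff (coeff G j) i = 0"
    unfolding G_form[symmetric] by (simp add: degree_bounded_def)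
qed

private lemma eval_G: "eval2 id G x y = eval2 id F (c1 + m00 * x + m01 * y) (c2 + m10 * x + m11 * y)"
proof -
  define \<phi> where "\<phi> = (\<lambda>A::('n, 'k) acl poly poly. poly (poly A [:y:]) x)"
  have "comm_ring_hom \<phi>" by unfold_locales (simp_all add: \<phi>_def)
  hence "\<phi> G = form_eval (\<lambda>c. \<phi> [:[:c:]:]) d F (\<phi> [:[:c1, m00:], [:m01:]:]) (\<phi> [:[:c2, m10:], [:m11:]:]) (\<phi> 1)"
    unfolding G_form by (rule hom_form_eval)
  also have "\<dots> = form_eval id d F (c1 + m00 * x + m01 * y) (c2 + m10 * x + m11 * y) 1"
    by (simp add: \<phi>_def algebra_simps id_def)
  also have "\<dots> = eval2 id F (c1 + m00 * x + m01 * y) (c2 + m10 * x + m11 * y)"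
    by (rule eval2_eq_form_eval[OF degF, symmetric]) simp_all
  finally show ?thesis by (simp add: \<phi>_def eval2_id)
qed

private lemma total_degree_G_le: "total_degree G \<le> d" if "G \<noteq> 0"
  using total_degree_attained[OF that] degG by (metis not_le_imp_less)

text \<open>An affine change is a linear substitution in homogeneous coordinates. \<open>D\<close>
  may be any bound at most \<open>d\<close> for the degree of \<open>G\<close>, and
  \<open>r ^ (d - D)\<close> accounts for the difference. The identity is checked where
  \<open>r\<close> does not vanish and becomes the affine one there.\<close>

private lemma change_form_eval:
  assumes "D \<le> d" "\<And>i j. D < i + j \<Longrightarrow> coeff (coeff G j) i = 0" "r \<noteq> 0"
  shows "r ^ (d - D) * form_eval (\<lambda>c. [:c:]) D G p q r =
    form_eval (\<lambda>c. [:c:]) d F ([:m00:] * p + [:m01:] * q + [:c1:] * r) ([:m10:] * p + [:m11:] * q + [:c2:] * r) r"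
proof (rule poly_eq_cofinite[OF assms(3)])
  fix e assume e: "poly r e \<noteq> 0"
  have "poly r e ^ (d - D) * form_eval id D G (poly p e) (poly q e) (poly r e) =
    poly r e ^ d * eval2 id G (poly p e / poly r e) (poly q e / poly r e)"
    using form_eval_eq_eval2[of D G id, OF assms(2) _ e] assms(1) by (simp flip: power_add mult.assoc)
  also have "\<dots> = form_eval id d F (m00 * poly p e + m01 * poly q e + c1 * poly r e)
      (m10 * poly p e + m11 * poly q e + c2 * poly r e) (poly r e)"
  proof -
    have R: "form_eval id d F A B (poly r e) = poly r e ^ d * eval2 id F (A / poly r e) (B / poly r e)" for A B
      by (rule form_eval_eq_eval2[OF degF _ e]) simp_all
    have "(m00 * poly p e + m01 * poly q e + c1 * poly r e) / poly r e =
        c1 + m00 * (poly p e / poly r e) + m01 * (poly q e / poly r e)"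
      "(m10 * poly p e + m11 * poly q e + c2 * poly r e) / poly r e =
        c2 + m10 * (poly p e / poly r e) + m11 * (poly q e / poly r e)"
      using e by (simp_all add: add_divide_distrib)
    thus ?thesis unfolding R eval_G by simp
  qed
  finally show "poly (r ^ (d - D) * form_eval (\<lambda>c. [:c:]) D G p q r) e =
    poly (form_eval (\<lambda>c. [:c:]) d F ([:m00:] * p + [:m01:] * q + [:c1:] * r)
      ([:m10:] * p + [:m11:] * q + [:c2:] * r) r) e"
    by (simp add: poly_form_eval[where h = "\<lambda>c. c"] id_def)
qed

private lemma solve: "\<exists>px py. m00 * px + m01 * py = x \<and> m10 * px + m11 * py = y"
proof (intro exI conjI)
  define \<delta> where "\<delta> = m00 * m11 - m01 * m10"
  have \<delta>: "\<delta> \<noteq> 0" using det by (simp add: \<delta>_def)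
  have "m00 * ((m11 * x - m01 * y) / \<delta>) + m01 * ((m00 * y - m10 * x) / \<delta>) = (\<delta> * x) / \<delta>"
    by (simp add: \<delta>_def add_divide_distrib[symmetric] algebra_simps)
  thus "m00 * ((m11 * x - m01 * y) / \<delta>) + m01 * ((m00 * y - m10 * x) / \<delta>) = x" using \<delta> by simp
  have "m10 * ((m11 * x - m01 * y) / \<delta>) + m11 * ((m00 * y - m10 * x) / \<delta>) = (\<delta> * y) / \<delta>"
    by (simp add: \<delta>_def add_divide_distrib[symmetric] algebra_simps)
  thus "m10 * ((m11 * x - m01 * y) / \<delta>) + m11 * ((m00 * y - m10 * x) / \<delta>) = y" using \<delta> by simp
qed

text \<open>If the degree dropped, the factor \<open>r ^ (d - D)\<close> would vanish on the line at
  infinity, and with it the form of highest degree of \<open>F\<close>, since the matrix is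
  invertible.\<close>

lemma total_degree_change: "total_degree G = d" "G \<noteq> 0"
proof -
  have no_drop: False
    if D: "D < d" "\<And>i j. D < i + j \<Longrightarrow> coeff (coeff G j) i = 0" for D
  proof -
    have "form_eval id d F x y 0 = 0" for x y
    proof -
      obtain px py where xy: "m00 * px + m01 * py = x" "m10 * px + m11 * py = y" using solve by blast
      have "poly ([:0, 1:] ^ (d - D) * form_eval (\<lambda>c. [:c:]) D G [:px:] [:py:] [:0, 1:]) 0 =
        poly (form_eval (\<lambda>c. [:c:]) d F ([:m00:] * [:px:] + [:m01:] * [:py:] + [:c1:] * [:0, 1:])
          ([:m10:] * [:px:] + [:m11:] * [:py:] + [:c2:] * [:0, 1:]) [:0, 1:]) 0"
        by (subst change_form_eval[OF less_imp_le[OF D(1)] D(2)]) simp_all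
      thus ?thesis using D(1) unfolding xy[symmetric]
        by (simp add: poly_form_eval[where h = "\<lambda>c. c"] id_def mult.commute power_0_left)
    qed
    hence "poly (\<Sum>i\<le>d. monom (coeff (coeff F (d - i)) i) i) x = 0" for x
      using form_eval_z_0[of id d F x 1] by (simp add: poly_sum poly_monom)
    hence "(\<Sum>i\<le>d. monom (coeff (coeff F (d - i)) i) i) = 0" using poly_all_0_iff_0 by blast
    hence z: "coeff (\<Sum>i\<le>d. monom (coeff (coeff F (d - i)) i) i) i = 0" for i by simp
    obtain i j where ij: "i + j = d" "coeff (coeff F j) i \<noteq> 0" using total_degree_attained[OF F_nz] d by blast
    thus False using z[of i] by (auto simp: coeff_sum)
  qed
  show "G \<noteq> 0"
  proof
    assume "G = 0"
    hence z: "eval2 id F (c1 + m00 * x + m01 * y) (c2 + m10 * x + m11 * y) = 0" for x y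
      using eval_G[of x y] by simp
    have zz: "eval2 id F x y = 0" for x y
    proof -
      obtain px py where "m00 * px + m01 * py = x - c1" "m10 * px + m11 * py = y - c2" using solve by blast
      thus ?thesis using z[of px py] by (simp add: add.assoc)
    qed
    have "poly F [:y:] = 0" for y
      using zz unfolding eval2_id by (metis poly_all_0_iff_0)
    hence "infinite {p. poly F p = 0}"
    proof -
      have "range (\<lambda>y. [:y:]) \<subseteq> {p. poly F p = 0}" using \<open>\<And>y. poly F [:y:] = 0\<close> by auto
      moreover have "infinite (range (\<lambda>y::('n, 'k) acl. [:y:]))"
        by (simp add: finite_image_iff inj_on_def infinite_UNIV_char_0)
      ultimately show ?thesis using finite_subset by blast
    qed
    thus False using F_nz poly_roots_finite by blast
  qed
  note le = total_degree_G_le[OF this]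
  have "\<not> total_degree G < d"
  proof
    assume "total_degree G < d"
    moreover have "coeff (coeff G j) i = 0" if "total_degree G < i + j" for i j
      using total_degree_le[of G j i] that by fastforce
    ultimately show False by (rule no_drop)
  qed
  with le show "total_degree G = d" by simp
qed

text \<open>The point is transported by the inverse projective transformation, which fixes the last
  coordinate. The restriction on \<open>z\<close> and \<open>w\<close> comes from the nonzero third
  argument in \<open>change_form_eval\<close>; at infinity, directions with \<open>w = 1\<close>
  will be enough.\<close>

lemma singular_at_change:
  assumes sing: "\<And>u v w. singular_at d F x y z u v w" and nz: "(x, y, z) \<noteq> (0, 0, 0)"
  obtains px py where "(px, py, z) \<noteq> (0, 0, 0)"
    "\<And>u v w. z \<noteq> 0 \<or> w \<noteq> 0 \<Longrightarrow> singular_at d G px py z u v w"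
proof -
  obtain px py where pxy: "m00 * px + m01 * py = x - c1 * z" "m10 * px + m11 * py = y - c2 * z"
    using solve by blast
  have "singular_at d G px py z u v w" if "z \<noteq> 0 \<or> w \<noteq> 0" for u v w
  proof -
    have nzp: "[:z, w:] \<noteq> 0" using that by simp
    have "form_eval (\<lambda>c. [:c:]) d G [:px, u:] [:py, v:] [:z, w:] =
      form_eval (\<lambda>c. [:c:]) d F ([:m00:] * [:px, u:] + [:m01:] * [:py, v:] + [:c1:] * [:z, w:])
        ([:m10:] * [:px, u:] + [:m11:] * [:py, v:] + [:c2:] * [:z, w:]) [:z, w:]"
      using change_form_eval[OF order.refl degG nzp, of "[:px, u:]" "[:py, v:]"] by simp
    also have "[:m00:] * [:px, u:] + [:m01:] * [:py, v:] + [:c1:] * [:z, w:] =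
      [:x, m00 * u + m01 * v + c1 * w:]" using pxy(1) by (simp add: algebra_simps)
    also have "[:m10:] * [:px, u:] + [:m11:] * [:py, v:] + [:c2:] * [:z, w:] =
      [:y, m10 * u + m11 * v + c2 * w:]" using pxy(2) by (simp add: algebra_simps)
    finally show ?thesis using sing unfolding singular_at_def by simp
  qed
  moreover have "(px, py, z) \<noteq> (0, 0, 0)" using pxy nz by auto
  ultimately show ?thesis using that by blast
qed

end

lemma singular_at_affine:
  assumes deg: "\<And>i j. d < i + j \<Longrightarrow> coeff (coeff G j) i = 0"
    and sing: "\<And>u v w. singular_at d G x y z u v w" and z: "z \<noteq> (0 :: 'a::field)"
  shows "eval2 id G (x / z) (y / z) = 0" "eval2 id (partial2 1 0 G) (x / z) (y / z) = 0"
    "eval2 id (partial2 0 1 G) (x / z) (y / z) = 0"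
proof -
  have s: "singular_at d G (x / z) (y / z) 1 u v 0" for u v
    using singular_at_scale[OF z, of d G "x / z" "y / z" 1 u v 0] sing[of "z * u" "z * v" 0] z by simp
  have "form_eval (\<lambda>c. [:c:]) d G [:x / z, u:] [:y / z, v:] [:1, 0:] = eval2 (\<lambda>c. [:c:]) G [:x / z, u:] [:y / z, v:]" for u v
    using eval2_eq_form_eval[of d G "\<lambda>c. [:c:]", OF deg] by (simp add: one_pCons)
  hence *: "eval2 id G (x / z) (y / z) = 0 \<and>
    u * eval2 id (map_poly pderiv G) (x / z) (y / z) + v * eval2 id (pderiv G) (x / z) (y / z) = 0" for u v
    using s[of u v] unfolding singular_at_def all_less_2 by (simp only: line_eval2)
  show "eval2 id G (x / z) (y / z) = 0" "eval2 id (partial2 1 0 G) (x / z) (y / z) = 0"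
    "eval2 id (partial2 0 1 G) (x / z) (y / z) = 0"
    using *[of 0 0] *[of 1 0] *[of 0 1] by (simp_all add: partial2_def)
qed

text \<open>The derivative in direction \<open>(u, v, 1)\<close> is an affine-linear expression in
  \<open>u\<close> and \<open>v\<close> whose coefficients are the three partial derivatives. It
  vanishes identically, hence so do they.\<close>

lemma singular_at_infinity:
  fixes G :: "'a::field poly poly"
  assumes sing: "\<And>u v. singular_at (total_degree G) G x y 0 u v 1" and x: "x \<noteq> 0" and ijk: "i + j + k = 1"
  shows "eval3 id (partial3 i j k (homogenize G)) 1 (y / x) 0 = 0"
proof -
  define d where "d = total_degree G"
  have "singular_at d G (x * 1) (x * (y / x)) (x * 0) (x * (u / x)) (x * (v / x)) (x * (1 / x))" for u v
    using sing[of u v] x by (simp add: d_def)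
  hence s: "singular_at d G 1 (y / x) 0 (u / x) (v / x) (1 / x)" for u v
    unfolding singular_at_scale[OF x] .
  define Hx where "Hx = eval3 id (partial3 1 0 0 (homogenize G)) 1 (y / x) 0"
  define Hy where "Hy = eval3 id (partial3 0 1 0 (homogenize G)) 1 (y / x) 0"
  define Hz where "Hz = eval3 id (partial3 0 0 1 (homogenize G)) 1 (y / x) 0"
  have "u / x * Hx + v / x * Hy + 1 / x * Hz = 0" for u v
    using s[of u v] unfolding singular_at_def all_less_2 d_def
      eval3_homogenize[OF comm_ring_hom_const, symmetric] line_eval3 Hx_def Hy_def Hz_def by simp
  note * = this
  have "Hz = 0" using *[of 0 0] x by simp
  moreover from this have "Hx = 0" "Hy = 0" using *[of 1 0] *[of 0 1] x by simp_all
  moreover have "(i, j, k) \<in> {(1, 0, 0), (0, 1, 0), (0, 0, 1)}" using ijk by auto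
  ultimately show ?thesis by (auto simp: Hx_def Hy_def Hz_def)
qed

subsection \<open>Subfields and homogeneous factors\<close>

definition subring_set :: "'a::comm_ring_1 set \<Rightarrow> bool" where
  "subring_set S \<longleftrightarrow> 1 \<in> S \<and> (\<forall>x\<in>S. \<forall>y\<in>S. x - y \<in> S \<and> x * y \<in> S)"

lemma subring_setD:
  assumes "subring_set S"
  shows "1 \<in> S" "0 \<in> S" "x \<in> S \<Longrightarrow> y \<in> S \<Longrightarrow> x - y \<in> S" "x \<in> S \<Longrightarrow> y \<in> S \<Longrightarrow> x * y \<in> S"
    "x \<in> S \<Longrightarrow> y \<in> S \<Longrightarrow> x + y \<in> S" "x \<in> S \<Longrightarrow> x ^ n \<in> S" "of_nat n \<in> S"
proof -
  note * = assms[unfolded subring_set_def]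
  show 1: "1 \<in> S" and d: "x \<in> S \<Longrightarrow> y \<in> S \<Longrightarrow> x - y \<in> S" and m: "x \<in> S \<Longrightarrow> y \<in> S \<Longrightarrow> x * y \<in> S" for x y
    using * by blast+
  show 0: "0 \<in> S" using d[OF 1 1] by simp
  show a: "x \<in> S \<Longrightarrow> y \<in> S \<Longrightarrow> x + y \<in> S" for x y
    using d[of x "0 - y"] d[OF 0, of y] by simp
  show "x \<in> S \<Longrightarrow> x ^ n \<in> S" by (induction n) (auto intro: 1 m)
  show "of_nat n \<in> S" by (induction n) (auto intro: 0 1 a)
qed

lemma subring_set_sum: "subring_set S \<Longrightarrow> (\<And>i. i \<in> A \<Longrightarrow> f i \<in> S) \<Longrightarrow> sum f A \<in> S"
  by (induction A rule: infinite_finite_induct) (auto intro: subring_setD)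

lemma polys1_iff: "0 \<in> S \<Longrightarrow> p \<in> polys1 S \<longleftrightarrow> (\<forall>i. coeff p i \<in> S)"
proof -
  assume 0: "0 \<in> S"
  show ?thesis
  proof
    assume "p \<in> polys1 S"
    thus "\<forall>i. coeff p i \<in> S" using 0 in_set_coeffs[of p] unfolding polys1_def by (metis mem_Collect_eq subsetD)
  next
    assume "\<forall>i. coeff p i \<in> S"
    thus "p \<in> polys1 S" by (auto simp: polys1_def coeffs_def split: if_splits)
  qed
qed

lemma subring_set_polys1: "subring_set S \<Longrightarrow> subring_set (polys1 S)"
  unfolding subring_set_def[of "polys1 S"]
  by (auto simp: polys1_iff subring_setD coeff_mult coeff_1 intro!: subring_set_sum subring_setD)

lemma subring_set_polys2: "subring_set S \<Longrightarrow> subring_set (polys2 S)"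
  unfolding polys2_def by (intro subring_set_polys1)

lemma subring_set_ext_field: "subring_set (ext_field \<gamma>)"
  unfolding subring_set_def
proof (intro conjI ballI)
  show "1 \<in> ext_field \<gamma>" unfolding ext_field_ac_eval by (intro exI[of _ 1]) simp
  fix x y assume "x \<in> ext_field \<gamma>" "y \<in> ext_field \<gamma>"
  then obtain P Q where "x = ac_eval \<gamma> P" "y = ac_eval \<gamma> Q" by (auto simp: ext_field_ac_eval)
  hence "x - y = ac_eval \<gamma> (P - Q)" "x * y = ac_eval \<gamma> (P * Q)" by simp_all
  thus "x - y \<in> ext_field \<gamma>" "x * y \<in> ext_field \<gamma>" unfolding ext_field_ac_eval by blast+
qed

lemma inverse_ext_field: "x \<in> ext_field \<gamma> \<Longrightarrow> inverse x \<in> ext_field \<gamma>"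
  using ac_eval_inverse by (auto simp: ext_field_ac_eval)

lemma of_base_ext_field: "of_base c \<in> ext_field \<gamma>"
  unfolding ext_field_ac_eval of_base_def of_par_eq
  by (intro exI[of _ "[:to_fract (Poly_Mapping.single 0 c):]"]) simp

lemma form_eval_mem:
  assumes "subring_set S" "\<And>i j. h (coeff (coeff G j) i) \<in> S" "x \<in> S" "y \<in> S" "z \<in> S"
  shows "form_eval h d G x y z \<in> S"
  unfolding form_eval_def using assms
  by (intro subring_set_sum subring_setD(4) subring_setD(6)) auto

text \<open>Quotient and remainder stay over the subfield \<open>S\<close>, because the only inverse
  taken is that of the leading coefficient of \<open>q\<close>.\<close>

lemma division_in_subfield:
  fixes p q :: "'a::field poly"
  assumes S: "subring_set S" "\<And>x. x \<in> S \<Longrightarrow> inverse x \<in> S"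
    and q: "q \<in> polys1 S" "q \<noteq> 0"
  shows "p \<in> polys1 S \<Longrightarrow> \<exists>a\<in>polys1 S. \<exists>r\<in>polys1 S. p = q * a + r \<and> (r = 0 \<or> degree r < degree q)"
proof (induction "degree p" arbitrary: p rule: less_induct)
  case less
  note S1 = subring_set_polys1[OF S(1)]
  have S0: "0 \<in> S" by (rule subring_setD(2)[OF S(1)])
  show ?case
  proof (cases "p = 0 \<or> degree p < degree q")
    case True
    thus ?thesis using less.prems subring_setD(2)[OF S1]
      by (intro bexI[of _ 0] bexI[of _ p]) auto
  next
    case False
    define s where "s = monom (lead_coeff p * inverse (lead_coeff q)) (degree p - degree q)"
    have "lead_coeff p * inverse (lead_coeff q) \<in> S"
      using less.prems q(1) S by (intro subring_setD(4)) (auto simp: polys1_iff[OF S0])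
    hence s: "s \<in> polys1 S" using S0 by (simp add: s_def polys1_iff)
    define p' where "p' = p - q * s"
    have p': "p' \<in> polys1 S" unfolding p'_def
      using less.prems q(1) s by (intro subring_setD(3,4)[OF S1])
    have deg: "degree p' \<le> degree p"
    proof -
      have "degree (q * s) \<le> degree q + (degree p - degree q)"
        using degree_monom_le by (intro order.trans[OF degree_mult_le] add_mono) (auto simp: s_def)
      thus ?thesis unfolding p'_def using False by (intro degree_diff_le) auto
    qed
    have "coeff (q * s) (degree p) = lead_coeff p"
    proof -
      have "coeff (q * s) (degree q + (degree p - degree q)) = lead_coeff p"
        unfolding s_def by (subst mult.commute) (simp add: coeff_monom_mult q(2))
      thus ?thesis using False by simp
    qed
    hence "coeff p' (degree p) = 0" by (simp add: p'_def)
    hence "p' = 0 \<or> degree p' < degree p"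
      using deg leading_coeff_0_iff[of p'] by (cases "degree p' = degree p") auto
    hence "\<exists>a\<in>polys1 S. \<exists>r\<in>polys1 S. p' = q * a + r \<and> (r = 0 \<or> degree r < degree q)"
    proof
      assume "p' = 0"
      thus ?thesis using subring_setD(2)[OF S1] by (intro bexI[of _ 0]) auto
    next
      assume "degree p' < degree p"
      thus ?thesis using less.hyps p' by blast
    qed
    then obtain a r where ar: "a \<in> polys1 S" "r \<in> polys1 S" "p' = q * a + r" "r = 0 \<or> degree r < degree q" by blast
    have "p = q * (a + s) + r" using ar(3) by (simp add: p'_def algebra_simps)
    thus ?thesis using ar s subring_setD(5)[OF S1] by blast
  qed
qed

text \<open>Over a domain both the lowest and the highest exponent are additive under
  multiplication. They agree for the product, so they agree for each factor.\<close>

lemma factor_of_monom: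
  fixes A B :: "'a::idom poly"
  assumes AB: "A * B = monom c d" and c: "c \<noteq> 0"
  shows "\<exists>n. \<forall>i. i \<noteq> n \<longrightarrow> coeff A i = 0"
proof -
  have nz: "A \<noteq> 0" "B \<noteq> 0" using assms by auto
  define i where "i = (LEAST i. coeff A i \<noteq> 0)"
  define j where "j = (LEAST j. coeff B j \<noteq> 0)"
  have "coeff A (degree A) \<noteq> 0" "coeff B (degree B) \<noteq> 0" using nz by simp_all
  hence i: "coeff A i \<noteq> 0" "i \<le> degree A" and j: "coeff B j \<noteq> 0" "j \<le> degree B"
    unfolding i_def j_def using LeastI[of "\<lambda>i. coeff A i \<noteq> 0" "degree A"] LeastI[of "\<lambda>i. coeff B i \<noteq> 0" "degree B"]
    by (auto intro: Least_le)
  have low: "coeff A k = 0" if "k < i" for k using not_less_Least[of k "\<lambda>i. coeff A i \<noteq> 0"] that by (auto simp: i_def)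
  have low': "coeff B k = 0" if "k < j" for k using not_less_Least[of k "\<lambda>i. coeff B i \<noteq> 0"] that by (auto simp: j_def)
  have "coeff (A * B) (i + j) = (\<Sum>k\<le>i + j. if k = i then coeff A i * coeff B j else 0)"
    unfolding coeff_mult
  proof (rule sum.cong[OF refl])
    fix k assume "k \<in> {..i + j}"
    thus "coeff A k * coeff B (i + j - k) = (if k = i then coeff A i * coeff B j else 0)"
      using low[of k] low'[of "i + j - k"] by (cases k i rule: linorder_cases) auto
  qed
  hence "coeff (monom c d) (i + j) \<noteq> 0" using i j by (simp add: AB)
  hence "i + j = d" by (auto split: if_splits)
  moreover have "degree A + degree B = d"
    using arg_cong[OF AB, of degree] nz c by (simp add: degree_mult_eq degree_monom_eq)
  ultimately have "i = degree A" using i(2) j(2) by linarith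
  hence "coeff A k = 0" if "k \<noteq> i" for k
    using that low[of k] coeff_eq_0[of A k] by (cases k i rule: linorder_cases) auto
  thus ?thesis by blast
qed

definition homogeneous :: "nat \<Rightarrow> 'a::zero poly poly \<Rightarrow> bool" where
  "homogeneous n A \<longleftrightarrow> (\<forall>i j. i + j \<noteq> n \<longrightarrow> coeff (coeff A j) i = 0)"

text \<open>\<open>\<Theta> A\<close> is \<open>A(s x, s y)\<close> with a new outermost variable
  \<open>s\<close>; its coefficient of degree \<open>n\<close> is the component of \<open>A\<close>
  of degree \<open>n\<close>. Homogeneous polynomials become monomials in \<open>s\<close>, and
  factors of monomials are monomials.\<close>

lemma homogeneous_factor:
  fixes A B :: "'a::idom poly poly"
  assumes hom: "homogeneous d (A * B)" and nz: "A * B \<noteq> 0"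
  shows "\<exists>n. homogeneous n A"
proof -
  define K where "K = (\<lambda>c::'a. [:[:[:c:]:]:])"
  define px where "px = (monom [:[:0, 1:]:] 1 :: 'a poly poly poly)"
  define py where "py = (monom [:0, 1:] 1 :: 'a poly poly poly)"
  define \<Theta> where "\<Theta> A = eval2 K A px py" for A
  have coeff_\<Theta>: "coeff (coeff (coeff (\<Theta> A) n) j) i = (if i + j = n then coeff (coeff A j) i else 0)" for A n i j
  proof -
    define e where "e = total_degree A"
    have deg: "coeff (coeff A j) i = 0" if "e < i + j" for i j
      using total_degree_le[of A j i] that by (fastforce simp: e_def)
    have \<Theta>1: "\<Theta> A = form_eval K e A px py 1"
      unfolding \<Theta>_def by (rule eval2_eq_form_eval[OF deg]) (simp_all add: K_def)
    have \<Theta>2: "\<Theta> A = (\<Sum>i\<le>e. \<Sum>j\<le>e - i. monom (monom (monom (coeff (coeff A j) i) i) j) (i + j))"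
      unfolding \<Theta>1 form_eval_def
    proof (intro sum.cong refl)
      fix i j
      have x: "[:[:0, 1:]:] ^ i = ([:monom 1 i:] :: 'a poly poly)" by (simp add: poly_const_pow monom_altdef)
      have y: "[:0, 1:] ^ j = (monom 1 j :: 'a poly poly)" by (simp add: monom_altdef)
      have K: "K c = monom (monom (monom c 0) 0) 0" for c by (simp add: K_def monom_0)
      show "K (coeff (coeff A j) i) * px ^ i * py ^ j * 1 ^ (e - i - j) =
        monom (monom (monom (coeff (coeff A j) i) i) j) (i + j)"
        unfolding px_def py_def monom_power K x y by (simp add: mult_monom flip: monom_0)
    qed
    have "coeff (coeff (coeff (\<Theta> A) n) j) i = (\<Sum>i'\<le>e. \<Sum>j'\<le>e - i'.
      if j' = j then if i' = i then if i + j = n then coeff (coeff A j) i else 0 else 0 else 0)"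
      unfolding \<Theta>2 coeff_sum by (intro sum.cong refl) auto
    also have "\<dots> = (\<Sum>i'\<le>e. if i' = i then if j \<le> e - i \<and> i + j = n then coeff (coeff A j) i else 0 else 0)"
      by (intro sum.cong refl) auto
    also have "\<dots> = (if i \<le> e \<and> j \<le> e - i \<and> i + j = n then coeff (coeff A j) i else 0)" by simp
    also have "\<dots> = (if i + j = n then coeff (coeff A j) i else 0)"
      using deg[of i j] by auto
    finally show ?thesis .
  qed
  have "\<Theta> A * \<Theta> B = \<Theta> (A * B)"
    unfolding \<Theta>_def K_def by (rule eval2_hom(2)[OF comm_ring_hom_const3, symmetric])
  also have "\<dots> = monom (A * B) d"
  proof (intro poly_eqI)
    fix n j i
    show "coeff (coeff (coeff (\<Theta> (A * B)) n) j) i = coeff (coeff (coeff (monom (A * B) d) n) j) i"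
      unfolding coeff_\<Theta> using hom by (auto simp: homogeneous_def)
  qed
  finally have "\<exists>n. \<forall>k. k \<noteq> n \<longrightarrow> coeff (\<Theta> A) k = 0" using nz by (rule factor_of_monom)
  then obtain n where "\<forall>k. k \<noteq> n \<longrightarrow> coeff (\<Theta> A) k = 0" ..
  hence n: "coeff (\<Theta> A) k = 0" if "k \<noteq> n" for k using that by simp
  have "homogeneous n A"
    unfolding homogeneous_def
  proof (intro allI impI)
    fix i j assume "i + j \<noteq> n"
    from n[OF this] show "coeff (coeff A j) i = 0" using coeff_\<Theta>[of A "i + j" j i] by simp
  qed
  thus ?thesis ..
qed

text \<open>The term in \<open>y ^ j\<close> receives the factor \<open>x ^ (k - j)\<close>. The
  degree \<open>k\<close> may exceed that of \<open>f\<close>, the surplus being a power of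
  \<open>x\<close>; in this way forms divisible by \<open>x\<close> are covered as well.\<close>

definition homog :: "nat \<Rightarrow> 'a::comm_ring_1 poly \<Rightarrow> 'a poly poly" where
  "homog k f = (\<Sum>j\<le>k. monom (monom (coeff f j) (k - j)) j)"

lemma coeff_homog:
  assumes "degree f \<le> k"
  shows "coeff (homog k f) j = monom (coeff f j) (k - j)"
proof -
  have "coeff (homog k f) j = (\<Sum>j'\<le>k. if j' = j then monom (coeff f j) (k - j) else 0)"
    unfolding homog_def coeff_sum by (intro sum.cong refl) auto
  thus ?thesis using assms by (auto simp: coeff_eq_0)
qed

lemma homog_mult:
  assumes "degree f \<le> k" "degree g \<le> l"
  shows "homog (k + l) (f * g) = homog k f * homog l g"
proof (rule poly_eqI)
  fix j
  have "degree (f * g) \<le> k + l" using assms by (intro order.trans[OF degree_mult_le] add_mono)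
  hence "coeff (homog (k + l) (f * g)) j = monom (\<Sum>i\<le>j. coeff f i * coeff g (j - i)) (k + l - j)"
    by (simp add: coeff_homog coeff_mult)
  also have "\<dots> = (\<Sum>i\<le>j. monom (coeff f i * coeff g (j - i)) (k + l - j))"
    by (rule poly_eqI) (simp add: coeff_sum)
  also have "\<dots> = (\<Sum>i\<le>j. monom (coeff f i) (k - i) * monom (coeff g (j - i)) (l - (j - i)))"
  proof (rule sum.cong[OF refl])
    fix i assume i: "i \<in> {..j}"
    show "monom (coeff f i * coeff g (j - i)) (k + l - j) =
      monom (coeff f i) (k - i) * monom (coeff g (j - i)) (l - (j - i))"
    proof (cases "i \<le> k \<and> j - i \<le> l")
      case True
      hence "k + l - j = (k - i) + (l - (j - i))" using i by auto
      thus ?thesis by (simp add: mult_monom)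
    next
      case False
      hence "coeff f i = 0 \<or> coeff g (j - i) = 0" using assms by (auto simp: coeff_eq_0)
      thus ?thesis by auto
    qed
  qed
  also have "\<dots> = coeff (homog k f * homog l g) j"
    using assms by (simp add: coeff_mult coeff_homog)
  finally show "coeff (homog (k + l) (f * g)) j = coeff (homog k f * homog l g) j" .
qed

definition set_x_1 :: "'a::comm_ring_1 poly poly \<Rightarrow> 'a poly" where
  "set_x_1 = map_poly (\<lambda>q. poly q 1)"

lemma coeff_set_x_1: "coeff (set_x_1 g) j = poly (coeff g j) 1"
  by (simp add: set_x_1_def coeff_map_poly)

lemma set_x_1_hom: "comm_ring_hom (set_x_1 :: 'a::comm_ring_1 poly poly \<Rightarrow> 'a poly)"
proof -
  interpret h: comm_ring_hom "\<lambda>q::'a poly. poly q 1" by unfold_locales simp_all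
  interpret m: map_poly_comm_ring_hom "\<lambda>q::'a poly. poly q 1" ..
  show ?thesis unfolding set_x_1_def by unfold_locales
qed

lemma poly_set_x_1: "poly (set_x_1 g) y = eval2 id g 1 y"
  unfolding eval2_id
  by (induction g) (simp_all add: set_x_1_def Polynomial.map_poly_pCons)

lemma homogeneous_eq_homog:
  fixes g :: "'a::comm_ring_1 poly poly"
  assumes "homogeneous a g"
  shows "g = homog a (set_x_1 g)" "degree (set_x_1 g) \<le> a"
proof -
  have val: "poly (coeff g j) 1 = (if j \<le> a then coeff (coeff g j) (a - j) else 0)" for j
  proof (cases "j \<le> a")
    case True
    have "coeff g j = monom (coeff (coeff g j) (a - j)) (a - j)"
    proof (rule poly_eqI)
      fix i
      show "coeff (coeff g j) i = coeff (monom (coeff (coeff g j) (a - j)) (a - j)) i"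
        using assms True by (cases "i = a - j") (auto simp: homogeneous_def)
    qed
    hence "poly (coeff g j) 1 = poly (monom (coeff (coeff g j) (a - j)) (a - j)) 1"
      by (rule arg_cong)
    thus ?thesis using True by (simp add: poly_monom)
  next
    case False
    have "coeff g j = 0"
    proof (rule poly_eqI)
      fix i
      show "coeff (coeff g j) i = coeff 0 i" using assms False by (auto simp: homogeneous_def)
    qed
    thus ?thesis using False by simp
  qed
  show deg: "degree (set_x_1 g) \<le> a"
    by (rule degree_le) (auto simp: coeff_set_x_1 val)
  show "g = homog a (set_x_1 g)"
  proof (intro poly_eqI)
    fix j i
    show "coeff (coeff g j) i = coeff (coeff (homog a (set_x_1 g)) j) i"
      unfolding coeff_homog[OF deg] coeff_set_x_1 val
      using assms by (cases "i + j = a") (auto simp: homogeneous_def)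
  qed
qed

lemma set_x_1_homog: "degree f \<le> k \<Longrightarrow> set_x_1 (homog k f) = f"
  by (rule poly_eqI) (simp add: coeff_set_x_1 coeff_homog poly_monom)

text \<open>
  The dehomogenization of an irreducible form is, up to a constant, the minimal polynomial over
  the subfield \<open>S\<close> of each of its roots.
\<close>

lemma irreducible_form_dvd:
  fixes g :: "'a::field poly poly"
  assumes S: "subring_set S" "\<And>x. x \<in> S \<Longrightarrow> inverse x \<in> S"
    and g: "irreducible_in (polys2 S) g" "homogeneous a g"
    and \<beta>: "poly (set_x_1 g) \<beta> = 0"
    and h: "h \<in> polys1 S" "poly h \<beta> = 0"
  shows "set_x_1 g dvd h"
proof -
  note S1 = subring_set_polys1[OF S(1)]
  have S0: "0 \<in> S" by (rule subring_setD(2)[OF S(1)])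
  interpret set_x_1: comm_ring_hom "set_x_1 :: 'a poly poly \<Rightarrow> 'a poly" by (rule set_x_1_hom)
  define m where "m = set_x_1 g"
  note gm = homogeneous_eq_homog[OF g(2), folded m_def]
  have gS: "coeff (coeff g j) i \<in> S" for i j
    using g(1) polys2_iff[OF S0] by (auto simp: irreducible_in_def)
  have mS: "m \<in> polys1 S"
    unfolding polys1_iff[OF S0] m_def coeff_set_x_1 poly_altdef
    using gS by (auto intro!: subring_set_sum[OF S(1)])
  have "g \<noteq> 0" using g(1) by (simp add: irreducible_in_def)
  have "m \<noteq> 0"
  proof
    assume "m = 0"
    moreover have "homog a 0 = (0 :: 'a poly poly)" by (simp add: homog_def)
    ultimately show False using gm(1) \<open>g \<noteq> 0\<close> by metis
  qed
  define Q where "Q = (\<lambda>p. p \<in> polys1 S \<and> p \<noteq> 0 \<and> poly p \<beta> = 0)"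
  have Qm: "Q m" using mS \<open>m \<noteq> 0\<close> \<beta> by (simp add: Q_def m_def)
  \<comment> \<open>Up to a constant, the minimal polynomial of \<open>\<beta>\<close> over
    \<open>S\<close>.\<close>
  define \<mu> where "\<mu> = arg_min degree Q"
  have \<mu>: "Q \<mu>" and min: "\<And>p. Q p \<Longrightarrow> degree \<mu> \<le> degree p"
    using arg_min_nat_lemma[of Q m degree] Qm by (auto simp: \<mu>_def)
  have div: "\<exists>b\<in>polys1 S. p = \<mu> * b" if p: "p \<in> polys1 S" "poly p \<beta> = 0" for p
  proof -
    obtain b r where br: "b \<in> polys1 S" "r \<in> polys1 S" "p = \<mu> * b + r" "r = 0 \<or> degree r < degree \<mu>"
      using division_in_subfield[OF S _ _ p(1), of \<mu>] \<mu> by (auto simp: Q_def)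
    have "poly r \<beta> = 0" using br(3) p(2) \<mu> by (simp add: Q_def)
    hence "r = 0" using br(2,4) min[of r] by (force simp: Q_def)
    thus ?thesis using br by auto
  qed
  obtain q where q: "q \<in> polys1 S" "m = \<mu> * q" using div[OF mS] Qm by (auto simp: Q_def)
  have nz: "\<mu> \<noteq> 0" "q \<noteq> 0" using q(2) \<open>m \<noteq> 0\<close> by auto
  define e where "e = degree \<mu>"
  have deg: "e + degree q \<le> a" using gm(2) nz by (simp add: q(2) degree_mult_eq e_def)
  \<comment> \<open>The factorization of \<open>m\<close> is homogenized to one of \<open>g\<close>.
    The second degree is \<open>a - e\<close> and not \<open>degree q\<close>, so that a power of
    \<open>x\<close> contained in \<open>g\<close> would go into the second factor.\<close>
  have "homog (e + (a - e)) (\<mu> * q) = homog e \<mu> * homog (a - e) q"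
    by (rule homog_mult) (use deg in \<open>auto simp: e_def\<close>)
  hence g_eq: "g = homog e \<mu> * homog (a - e) q" using gm(1) q(2) deg by simp
  have hS: "homog k f \<in> polys2 S" if "f \<in> polys1 S" "degree f \<le> k" for f k
    using that S0 by (auto simp: polys2_iff[OF S0] coeff_homog polys1_iff[OF S0])
  have "dvd_in (polys2 S) (homog e \<mu>) 1 \<or> dvd_in (polys2 S) (homog (a - e) q) 1"
  proof -
    have "homog e \<mu> \<in> polys2 S" using \<mu> by (intro hS) (simp_all add: Q_def e_def)
    moreover have "homog (a - e) q \<in> polys2 S" using q(1) deg by (intro hS) simp_all
    moreover have "\<forall>A\<in>polys2 S. \<forall>B\<in>polys2 S. g = A * B \<longrightarrow>
        dvd_in (polys2 S) A 1 \<or> dvd_in (polys2 S) B 1"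
      using g(1) by (simp add: irreducible_in_def)
    ultimately have "g = homog e \<mu> * homog (a - e) q \<longrightarrow>
        dvd_in (polys2 S) (homog e \<mu>) 1 \<or> dvd_in (polys2 S) (homog (a - e) q) 1"
      by simp
    thus ?thesis using g_eq by (rule mp)
  qed
  \<comment> \<open>Setting \<open>x = 1\<close> maps units to units, but \<open>\<mu>\<close> has
    the root \<open>\<beta>\<close>.\<close>
  moreover have "\<not> dvd_in (polys2 S) (homog e \<mu>) 1"
  proof
    assume "dvd_in (polys2 S) (homog e \<mu>) 1"
    then obtain c where "1 = homog e \<mu> * c" by (auto simp: dvd_in_def)
    hence "set_x_1 1 = set_x_1 (homog e \<mu>) * set_x_1 c" by (metis set_x_1.hom_mult)
    hence "1 = \<mu> * set_x_1 c" by (simp add: set_x_1_homog e_def)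
    hence "poly 1 \<beta> = poly (\<mu> * set_x_1 c) \<beta>" by simp
    thus False using \<mu> by (simp add: Q_def)
  qed
  ultimately have "dvd_in (polys2 S) (homog (a - e) q) 1" by blast
  then obtain c where "1 = homog (a - e) q * c" by (auto simp: dvd_in_def)
  hence "set_x_1 1 = set_x_1 (homog (a - e) q) * set_x_1 c" by (metis set_x_1.hom_mult)
  hence "1 = q * set_x_1 c" using deg by (simp add: set_x_1_homog)
  hence qc: "\<mu> = m * set_x_1 c" unfolding q(2) by (metis mult.assoc mult.right_neutral)
  obtain b where "h = \<mu> * b" using div[OF h] by blast
  thus ?thesis unfolding qc m_def[symmetric] by simp
qed

subsection \<open>The decomposition of a singular curve is not empty\<close>

lemma eval2_prod:
  assumes "comm_ring_hom h"
  shows "eval2 h (prod f A) x y = (\<Prod>a\<in>A. eval2 h (f a) x y)"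
  by (induction A rule: infinite_finite_induct) (simp_all add: eval2_hom[OF assms])

lemma eval2_sum:
  assumes "comm_ring_hom h"
  shows "eval2 h (sum f A) x y = (\<Sum>a\<in>A. eval2 h (f a) x y)"
  by (induction A rule: infinite_finite_induct) (simp_all add: eval2_add[OF assms])

lemma eval2_power:
  assumes "comm_ring_hom h"
  shows "eval2 h (f ^ n) x y = eval2 h f x y ^ n"
  by (induction n) (simp_all add: eval2_hom[OF assms])

text \<open>All members of the radical ideal vanish at the singular point. So the basis is not
  \<open>{1}\<close>, and \<open>A\<close> has the root \<open>x\<close>; hence \<open>A\<close> is
  not a unit and has an irreducible factor.\<close>

lemma affine_part_nonempty:
  assumes D: "is_affine_part \<gamma> G \<D>"
    and sing: "eval2 id G x y = 0" "eval2 id (partial2 1 0 G) x y = 0" "eval2 id (partial2 0 1 G) x y = 0"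
  shows "\<D> \<noteq> {}"
proof -
  define I where "I = radical_ideal (polys2 (ext_field \<gamma>)) {G, partial2 1 0 G, partial2 0 1 G}"
  have van: "eval2 id p x y = 0" if p: "p \<in> I" for p
  proof -
    obtain N u where "p ^ N = (\<Sum>f\<in>{G, partial2 1 0 G, partial2 0 1 G}. u f * f)"
      using p unfolding I_def radical_ideal_def by blast
    hence "eval2 id (p ^ N) x y = eval2 id (\<Sum>f\<in>{G, partial2 1 0 G, partial2 0 1 G}. u f * f) x y" by simp
    also have "\<dots> = (\<Sum>f\<in>{G, partial2 1 0 G, partial2 0 1 G}. eval2 id (u f) x y * eval2 id f x y)"
      unfolding eval2_sum[OF comm_ring_hom_id] eval2_hom(2)[OF comm_ring_hom_id] ..
    also have "\<dots> = 0" using sing by (intro sum.neutral) auto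
    finally show ?thesis by (simp add: eval2_power[OF comm_ring_hom_id])
  qed
  have not_1: "1 \<notin> I" using van[of 1] by (auto simp: eval2_hom[OF comm_ring_hom_id])
  have "\<not> is_normed_reduced_GB I {1}" using not_1 by (auto simp: is_normed_reduced_GB_def)
  then obtain A B c P e where AB: "is_normed_reduced_GB I {[:A:], [:- B, 1:]}"
    and fac: "is_factorization_in (polys1 (ext_field \<gamma>)) A c P e" and D_eq: "\<D> = (\<lambda>m. ([:0, 1:], B, 1, m)) ` P"
    using D unfolding is_affine_part_def Let_def I_def[symmetric] by blast
  have "[:A:] \<in> I" using AB by (auto simp: is_normed_reduced_GB_def)
  hence Ax: "poly A x = 0" using van[of "[:A:]"] by (simp add: eval2_id)
  have "P \<noteq> {}"
  proof
    assume "P = {}"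
    hence "A = c" "dvd_in (polys1 (ext_field \<gamma>)) c 1" using fac by (simp_all add: is_factorization_in_def)
    then obtain c' where "1 = A * c'" by (auto simp: dvd_in_def)
    hence "poly 1 x = poly A x * poly c' x" by (metis poly_mult)
    thus False using Ax by simp
  qed
  thus ?thesis by (simp add: D_eq)
qed

text \<open>Some irreducible factor of the form of highest degree vanishes at
  \<open>(1, \<beta>)\<close>. Its dehomogenization is, up to a constant, the minimal polynomial of
  \<open>\<beta>\<close>. It divides the first partial derivatives at \<open>(1 : t : 0)\<close>,
  which are polynomials in \<open>t\<close> over the same field with root
  \<open>\<beta>\<close>.\<close>

lemma infinity_part_nonempty:
  fixes G :: "('n::{finite,linorder}, 'k::field_char_0) acl poly poly"
  assumes D: "is_infinity_part \<gamma> G \<D>" and GS: "G \<in> polys2 (ext_field \<gamma>)" and nz: "G \<noteq> 0"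
    and top: "eval2 id (top_form G) 1 \<beta> = 0"
    and sing: "\<And>i j k. i + j + k = 1 \<Longrightarrow> eval3 id (partial3 i j k (homogenize G)) 1 \<beta> 0 = 0"
  shows "\<D> \<noteq> {}"
proof -
  define S where "S = ext_field \<gamma>"
  have S: "subring_set S" "\<And>x. x \<in> S \<Longrightarrow> inverse x \<in> S"
    unfolding S_def by (rule subring_set_ext_field, rule inverse_ext_field)
  have S0: "0 \<in> S" by (rule subring_setD(2)[OF S(1)])
  obtain c P e where fac: "is_factorization_in (polys2 S) (top_form G) c P e"
    and D_eq: "\<D> = {(1, [:0, 1:], 0, m) | m. m \<in> (\<lambda>g. map_poly (\<lambda>q. poly q 1) g) ` P \<and>
               (\<forall>i j k. i + j + k = 1 \<longrightarrow>
                  m dvd eval3 (\<lambda>c. [:c:]) (partial3 i j k (homogenize G)) 1 [:0, 1:] 0)}"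
    using D unfolding is_infinity_part_def S_def by blast
  have P: "finite P" "\<And>g. g \<in> P \<Longrightarrow> irreducible_in (polys2 S) g \<and> 0 < e g"
    and c: "dvd_in (polys2 S) c 1" and tf: "top_form G = c * (\<Prod>g\<in>P. g ^ e g)"
    using fac by (auto simp: is_factorization_in_def)
  have tf_nz: "top_form G \<noteq> 0"
  proof
    assume "top_form G = 0"
    hence "coeff (coeff (top_form G) j) i = 0" for i j by simp
    thus False using total_degree_attained[OF nz] unfolding coeff_top_form by metis
  qed
  have tf_hom: "homogeneous (total_degree G) (top_form G)" by (simp add: homogeneous_def coeff_top_form)
  obtain c' where "1 = c * c'" using c by (auto simp: dvd_in_def)
  hence "eval2 id 1 1 \<beta> = eval2 id c 1 \<beta> * eval2 id c' 1 \<beta>"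
    using eval2_hom(2)[OF comm_ring_hom_id] by metis
  hence "eval2 id c 1 \<beta> \<noteq> 0" by (auto simp: eval2_hom(3)[OF comm_ring_hom_id])
  hence "(\<Prod>g\<in>P. eval2 id g 1 \<beta> ^ e g) = 0"
    using top unfolding tf by (simp add: eval2_hom(2)[OF comm_ring_hom_id] eval2_prod[OF comm_ring_hom_id]
        eval2_power[OF comm_ring_hom_id])
  then obtain g where g: "g \<in> P" "eval2 id g 1 \<beta> = 0" using P(1) by (auto simp: prod_zero_iff)
  define W where "W = c * (g ^ (e g - 1) * (\<Prod>g\<in>P - {g}. g ^ e g))"
  have tfW: "top_form G = g * W"
  proof -
    have "(\<Prod>g\<in>P. g ^ e g) = g ^ e g * (\<Prod>g\<in>P - {g}. g ^ e g)" by (rule prod.remove[OF P(1) g(1)])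
    moreover have "g ^ e g = g * g ^ (e g - 1)" using P(2)[OF g(1)] by (simp add: power_eq_if)
    ultimately show ?thesis unfolding tf W_def by (simp only: mult_ac)
  qed
  have "\<exists>a. homogeneous a g" by (rule homogeneous_factor[OF tf_hom[unfolded tfW] tf_nz[unfolded tfW]])
  then obtain a where a: "homogeneous a g" ..
  define m where "m = set_x_1 g"
  have "m dvd eval3 (\<lambda>c. [:c:]) (partial3 i j k (homogenize G)) 1 [:0, 1:] 0" if ijk: "i + j + k = 1" for i j k
  proof -
    define H where "H = partial3 i j k (homogenize G)"
    define h where "h = eval3 (\<lambda>c. [:c:]) H 1 [:0, 1:] 0"
    have G_S: "coeff (coeff G j) i \<in> S" for i j using GS polys2_iff[OF S0] by (simp add: S_def)
    have hom_S: "coeff (coeff (coeff (homogenize G) k) j) i \<in> S" for i j k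
    proof -
      have mon: "coeff (coeff (coeff (monom (monom (monom x i') j') k') k) j) i \<in> S" if "x \<in> S" for x i' j' k'
        using that S0 by simp
      thus ?thesis
        unfolding homogenize_def Let_def coeff_sum by (intro subring_set_sum[OF S(1)] mon G_S)
    qed
    have H_S: "coeff (coeff (coeff H k') j') i' \<in> S" for i' j' k'
    proof -
      have "(i, j, k) \<in> {(1, 0, 0), (0, 1, 0), (0, 0, 1)}" using ijk by auto
      moreover have "of_nat n * x \<in> S" if "x \<in> S" for n x
        using subring_setD(4)[OF S(1) subring_setD(7)[OF S(1)] that] .
      ultimately show ?thesis
        using hom_S by (auto simp: H_def partial3_def coeff_map_poly coeff_pderiv of_nat_poly
            simp del: of_nat_Suc)
    qed
    \<comment> \<open>The third coordinate 0 leaves only the part of \<open>H\<close> that is free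
      of \<open>z\<close>.\<close>
    have h_eq: "h = set_x_1 (coeff H 0)"
    proof -
      obtain g0 H' where H: "H = pCons g0 H'" by (cases H)
      have "h = eval2 (\<lambda>c. [:c:]) g0 1 [:0, 1:]" unfolding h_def H by (subst eval3_pCons) simp_all
      also have "\<dots> = set_x_1 g0"
      proof (induction g0)
        case (pCons f g)
        have "poly (map_poly (\<lambda>c. [:c:]) f) 1 = [:poly f 1:]" for f :: "('n, 'k) acl poly"
          by (induction f) (simp_all add: Polynomial.map_poly_pCons)
        thus ?case using pCons.IH by (simp add: eval2_pCons set_x_1_def Polynomial.map_poly_pCons)
      qed (simp add: set_x_1_def)
      finally show ?thesis by (simp add: H)
    qed
    have "h \<in> polys1 S"
      unfolding polys1_iff[OF S0] h_eq coeff_set_x_1 poly_altdef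
      using H_S by (auto intro!: subring_set_sum[OF S(1)])
    moreover have "poly h \<beta> = 0"
    proof -
      obtain g0 H' where H: "H = pCons g0 H'" by (cases H)
      have "eval3 id H 1 \<beta> 0 = eval2 id g0 1 \<beta>" unfolding H by (subst eval3_pCons) simp_all
      thus ?thesis using sing[OF ijk] by (simp add: h_eq poly_set_x_1 H_def[symmetric] H)
    qed
    ultimately show ?thesis
      using irreducible_form_dvd[OF S _ a, of \<beta> h] P(2)[OF g(1)] g(2)
      by (simp add: m_def poly_set_x_1 h_def H_def)
  qed
  hence "(1, [:0, 1:], 0, m) \<in> \<D>" using g(1) unfolding D_eq m_def set_x_1_def by blast
  thus ?thesis by blast
qed

lemma det_2_2:
  fixes M :: "'a::comm_ring_1 mat"
  assumes "M \<in> carrier_mat 2 2"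
  shows "det M = M $$ (0, 0) * M $$ (1, 1) - M $$ (0, 1) * M $$ (1, 0)"
proof -
  have car: "mat_delete M i 0 \<in> carrier_mat 1 1" for i
    using assms by (simp add: mat_delete_def)
  have "det M = (\<Sum>i<2. M $$ (i, 0) * cofactor M i 0)"
    by (rule laplace_expansion_column[OF assms]) simp
  also have "\<dots> = M $$ (0, 0) * det (mat_delete M 0 0) - M $$ (1, 0) * det (mat_delete M 1 0)"
    by (simp add: numeral_2_eq_2 cofactor_def)
  also have "det (mat_delete M 0 0) = M $$ (1, 1)"
    unfolding det_single[OF car] using assms by (simp add: mat_delete_def)
  also have "det (mat_delete M 1 0) = M $$ (0, 1)"
    unfolding det_single[OF car] using assms by (simp add: mat_delete_def)
  finally show ?thesis by (simp add: mult.commute)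
qed

text \<open>A singular point of the given curve is carried to the new coordinates. If it is finite,
  it is a common zero of the radical ideal and yields an affine family; otherwise it yields a family
  at infinity.\<close>

lemma standard_decomposition_nonempty:
  fixes F :: "('n::{finite,linorder}, 'k::field_char_0) acl poly poly"
  assumes F: "F \<in> polys2 (ext_field \<gamma>)" "F \<noteq> 0"
    and sing: "singular_curve (homogenize F)" and D: "is_standard_decomposition \<gamma> F \<D>"
  shows "\<D> \<noteq> {}"
proof -
  interpret of_base: comm_ring_hom "of_base :: 'k \<Rightarrow> ('n, 'k) acl" by (rule of_base_hom)
  obtain M b1 b2 \<D>1 \<D>2 where M: "M \<in> carrier_mat 2 2" "det M \<noteq> 0"
    and reg: "regular_position (affine_change M b1 b2 F)"
    and D1: "is_infinity_part \<gamma> (affine_change M b1 b2 F) \<D>1"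
    and D2: "is_affine_part \<gamma> (affine_change M b1 b2 F) \<D>2"
    and D_eq: "\<D> = undo_change M b1 b2 ` (\<D>1 \<union> \<D>2)"
    using D unfolding is_standard_decomposition_def by blast
  define G where "G = affine_change M b1 b2 F"
  define d where "d = total_degree F"
  have G_eq: "G = eval2 (\<lambda>c. [:[:c:]:]) F
     [:[:of_base b1, of_base (M $$ (0, 0)):], [:of_base (M $$ (0, 1)):]:]
     [:[:of_base b2, of_base (M $$ (1, 0)):], [:of_base (M $$ (1, 1)):]:]"
    by (simp add: G_def affine_change_def)
  have det: "of_base (M $$ (0, 0)) * of_base (M $$ (1, 1)) - of_base (M $$ (0, 1)) * of_base (M $$ (1, 0)) \<noteq> (0 :: ('n, 'k) acl)"
  proof -
    have "of_base (det M) \<noteq> (0 :: ('n, 'k) acl)"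
      using M(2) by (simp add: of_base_def) (metis lookup_single_eq lookup_zero)
    thus ?thesis unfolding det_2_2[OF M(1)] by (simp add: of_base.hom_minus of_base.hom_mult)
  qed
  note deg = total_degree_change[OF F(2) det G_eq d_def]
  obtain x y z r where P: "(x, y, z) \<noteq> (0, 0, 0)" "2 \<le> r" "fold_point (homogenize F) x y z r"
    using sing by (auto simp: singular_curve_def)
  have sF: "singular_at d F x y z u v w" for u v w
    unfolding d_def by (rule fold_point_singular_at[OF P(3,2)])
  obtain x' y' where P': "(x', y', z) \<noteq> (0, 0, 0)"
    and sG: "\<And>u v w. z \<noteq> 0 \<or> w \<noteq> 0 \<Longrightarrow> singular_at d G x' y' z u v w"
  proof (rule singular_at_change[OF F(2) det G_eq d_def sF P(1)])
    fix x' y'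
    assume *: "(x', y', z) \<noteq> (0, 0, 0)" "\<And>u v w. z \<noteq> 0 \<or> w \<noteq> 0 \<Longrightarrow> singular_at d G x' y' z u v w"
    show thesis by (rule that[OF *])
  qed
  have "\<D>1 \<union> \<D>2 \<noteq> {}"
  proof (cases "z = 0")
    case False
    have degG: "coeff (coeff G j) i = 0" if "d < i + j" for i j
      using total_degree_le[of G j i] deg(1) that by fastforce
    have "singular_at d G x' y' z u v w" for u v w using sG False by blast
    note sing = singular_at_affine[OF degG this False]
    from affine_part_nonempty[OF D2[folded G_def] sing] show ?thesis by blast
  next
    case True
    have s: "singular_at d G x' y' 0 u v 1" for u v using sG[of 1 u v] True by simp
    have zero: "form_eval id d G x' y' 0 = 0"
    proof -
      have "poly (form_eval (\<lambda>c. [:c:]) d G [:x', 0:] [:y', 0:] [:0, 1:]) 0 = 0"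
        using s[of 0 0] by (simp add: singular_at_def poly_0_coeff_0)
      thus ?thesis by (simp add: poly_form_eval[where h = "\<lambda>c. c"] id_def)
    qed
    \<comment> \<open>Regular position makes the coefficient of \<open>y ^ d\<close> a nonzero
      constant, which keeps the curve away from \<open>(0 : 1 : 0)\<close>. So the point at infinity
      can be written as \<open>(1 : \<beta> : 0)\<close>.\<close>
    have "x' \<noteq> 0"
    proof
      assume x0: "x' = 0"
      obtain b where b: "b \<noteq> 0" "coeff G d = [:b:]"
        using reg unfolding regular_position_def G_def[symmetric] deg(1) by blast
      have "form_eval id d G 0 y' 0 = (\<Sum>i\<le>d. if i = 0 then b * y' ^ d else 0)"
        unfolding form_eval_z_0 by (rule sum.cong) (auto simp: b)
      hence "b * y' ^ d = 0" using zero x0 by simp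
      thus False using b(1) P' x0 True by simp
    qed
    define \<beta> where "\<beta> = y' / x'"
    have "form_eval id d G (x' * 1) (x' * \<beta>) (x' * 0) = 0" using zero \<open>x' \<noteq> 0\<close> by (simp add: \<beta>_def)
    hence z1: "form_eval id d G 1 \<beta> 0 = 0" unfolding form_eval_scale using \<open>x' \<noteq> 0\<close> by simp
    have "eval2 id (top_form G) 1 \<beta> = 0"
    proof -
      have "eval2 id (top_form G) 1 \<beta> = form_eval id d (top_form G) 1 \<beta> 1"
        by (rule eval2_eq_form_eval) (auto simp: coeff_top_form deg)
      also have "\<dots> = (\<Sum>i\<le>d. \<Sum>j\<le>d - i. if j = d - i then coeff (coeff G j) i * \<beta> ^ j else 0)"
        unfolding form_eval_def by (intro sum.cong refl) (auto simp: coeff_top_form deg)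
      also have "\<dots> = form_eval id d G 1 \<beta> 0" unfolding form_eval_z_0 by simp
      finally show ?thesis using z1 by simp
    qed
    moreover have "eval3 id (partial3 i j k (homogenize G)) 1 \<beta> 0 = 0" if "i + j + k = 1" for i j k
      unfolding \<beta>_def using singular_at_infinity[OF _ \<open>x' \<noteq> 0\<close> that, of G y'] s deg(1) by simp
    moreover have "G \<in> polys2 (ext_field \<gamma>)"
    proof -
      note S = subring_set_ext_field[of \<gamma>]
      have S0: "0 \<in> ext_field \<gamma>" by (rule subring_setD(2)[OF S])
      have c: "[:[:u, v:], [:w:]:] \<in> polys2 (ext_field \<gamma>)" if "u \<in> ext_field \<gamma>" "v \<in> ext_field \<gamma>" "w \<in> ext_field \<gamma>" for u v w
        using that S0 by (auto simp: polys2_iff[OF S0] coeff_pCons split: nat.splits)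
      have c0: "[:[:u:]:] \<in> polys2 (ext_field \<gamma>)" if "u \<in> ext_field \<gamma>" for u
        using that S0 by (auto simp: polys2_iff[OF S0] coeff_pCons split: nat.splits)
      have "coeff (coeff F j) i = 0" if "d < i + j" for i j
        using total_degree_le[of F j i] that by (fastforce simp: d_def)
      hence eq: "G = form_eval (\<lambda>c. [:[:c:]:]) d F
         [:[:of_base b1, of_base (M $$ (0, 0)):], [:of_base (M $$ (0, 1)):]:]
         [:[:of_base b2, of_base (M $$ (1, 0)):], [:of_base (M $$ (1, 1)):]:] 1"
        unfolding G_eq by (intro eval2_eq_form_eval) simp_all
      show ?thesis
        unfolding eq
      proof (rule form_eval_mem[OF subring_set_polys2[OF S]])
        show "[:[:coeff (coeff F j) i:]:] \<in> polys2 (ext_field \<gamma>)" for i j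
          using F(1) polys2_iff[OF S0, of F] by (intro c0) blast
      qed (intro c of_base_ext_field subring_setD(1)[OF subring_set_polys2[OF S]])+
    qed
    ultimately have "\<D>1 \<noteq> {}" using infinity_part_nonempty[OF D1[folded G_def]] deg(2) by blast
    thus ?thesis by blast
  qed
  thus ?thesis by (simp add: D_eq)
qed

lemma Omega_ord_subset: "is_Omega_ord \<gamma> G \<F> \<Omega> \<Longrightarrow> \<Omega> \<subseteq> Omega_curve \<gamma> G"
proof -
  assume "is_Omega_ord \<gamma> G \<F> \<Omega>"
  then obtain r \<Omega>0 where 0: "is_Omega_mult \<gamma> G \<F> r \<Omega>0" "\<Omega> \<subseteq> \<Omega>0"
    unfolding is_Omega_ord_def Let_def by blast
  then obtain \<Omega>1 where 1: "is_Omega_def_family \<gamma> G \<F> \<Omega>1" "\<Omega>0 \<subseteq> \<Omega>1"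
    unfolding is_Omega_mult_def Let_def by blast
  obtain f1 f2 f3 m where "\<F> = (f1, f2, f3, m)" by (cases \<F>)
  hence "\<Omega>1 \<subseteq> Omega_curve \<gamma> G" using 1(1) by (auto simp: Let_def)
  thus ?thesis using 0 1 by blast
qed

theorem corollary4p3:
  fixes \<gamma> :: "('n::{finite,linorder}, 'k::field_char_0) acl"
    and F :: "('n, 'k) acl poly poly"
    and \<Omega> :: "('n \<Rightarrow> 'k alg_closure) set"
    and a0 :: "'n \<Rightarrow> 'k alg_closure"
    and \<gamma>0 :: "'k alg_closure"
  assumes "F \<in> polys2 (par_ring \<gamma>)"
    and "\<nexists>c. F = [:[:c:]:]"
    and "irreducible F"
    and "only_ordinary_singularities (homogenize F)"
    and "rational_curve F"
    and "is_Omega_singOrd \<gamma> F \<Omega>"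
    and "a0 \<in> \<Omega>"
    and "poly (min_poly_at \<gamma> a0) \<gamma>0 = 0"
    and "irreducible (special_curve \<gamma> a0 \<gamma>0 F)"
  shows "rational_curve (special_curve \<gamma> a0 \<gamma>0 F)"
proof -
  have "a0 \<in> Omega_curve \<gamma> F"
  proof (cases "singular_curve (homogenize F)")
    case True
    then obtain \<D> \<omega> where D: "is_standard_decomposition \<gamma> F \<D>"
      "\<And>\<F>. \<F> \<in> \<D> \<Longrightarrow> is_Omega_ord \<gamma> F \<F> (\<omega> \<F>)" "\<Omega> = (\<Inter>\<F>\<in>\<D>. \<omega> \<F>)"
      using assms(6) unfolding is_Omega_singOrd_def by auto
    have z: "0 \<in> par_ring \<gamma>" unfolding par_ring_def by (rule range_eqI[of _ _ 0]) simp
    have z': "0 \<in> ext_field \<gamma>" by (rule subring_setD(2)[OF subring_set_ext_field])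
    have "F \<in> polys2 (ext_field \<gamma>)"
      using assms(1) par_ring_subset[of \<gamma>] unfolding polys2_iff[OF z] polys2_iff[OF z'] by blast
    moreover have "F \<noteq> 0" using assms(3) by auto
    \<comment> \<open>The intersection over an empty decomposition would be the whole space and say
      nothing about \<open>a0\<close>; hence a family has to be exhibited.\<close>
    ultimately obtain \<F> where "\<F> \<in> \<D>" using standard_decomposition_nonempty True D(1) by blast
    thus ?thesis using Omega_ord_subset[OF D(2)] D(3) assms(7) by blast
  next
    case False
    thus ?thesis using assms(6,7) by (simp add: is_Omega_singOrd_def)
  qed
  thus ?thesis using assms(1,5,8,9) by (intro rational_curve_special)
qed

end
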